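(* Let $\|\cdot\|$ be a norm on $\mathbb{R}^d$ and let $\mathbf{X}_1,\dots,\mathbf{X}_n$ be i.i.d. random vectors in $\mathbb{R}^d$ with parent random vector $\mathbf{X}$. Assume: (C1) for every $y>0$, the truncated distribution $F_{\mathbf{X}|\|\mathbf{X}\|}(\cdot\,|\,y)=\mathbb{P}(\mathbf{X}\in\cdot\mid \|\mathbf{X}\|\le y)$ is nondegenerate, i.e. there is no hyperplane $\mathcal{H}\subset\mathbb{R}^d$ with $\mathbb{P}(\mathbf{X}\in\mathcal{H}\mid\|\mathbf{X}\|\le y)=1$; (C2) the distribution of the real random variable $\|\mathbf{X}\|$ is absolutely continuous and regularly varying at infinity with index $-\alpha$, $\alpha>0$, i.e. $\lim_{t\to\infty}\mathbb{P}(\|\mathbf{X}\|>tx)/\mathbb{P}(\|\mathbf{X}\|>t)=x^{-\alpha}$ for all $x>0$. Let $\mathbf{S}_n=\mathbf{X}_1+\dots+\mathbf{X}_n$ and let $G_n$ be the $d$-Normex distribution defined in the context. Then, for any $\alpha\in(2,3]$, there exists a slowly varying function $L(\cdot)$ (at infinity) such that $$\sup_{\mathbf{B}\in\mathcal{C}}\big|\mathbb{P}(\mathbf{S}_n\in\mathbf{B})-G_n(\mathbf{B})\big|\le L(n)\,n^{-\frac12+\frac{3-\alpha}{\alpha}},$$ where $\mathcal{C}$ is the class of all Borel-measurable convex subsets of $\mathbb{R}^d$.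
   Context: Order statistics w.r.t. the norm: $(\mathbf{X}_{(1)},\dots,\mathbf{X}_{(n)})$ is the reordering of $(\mathbf{X}_1,\dots,\mathbf{X}_n)$ with $\|\mathbf{X}_{(1)}\|\le\dots\le\|\mathbf{X}_{(n)}\|$ (ties have probability zero since $\|\mathbf{X}\|$ has an absolutely continuous law); in particular $\mathbf{X}_{(n)}$ is the summand of largest norm. For $y>0$, let $\mu(y)$ and $\Sigma(y)$ denote the mean vector and covariance matrix of the truncated distribution $\mathbb{P}(\mathbf{X}\in\cdot\mid\|\mathbf{X}\|\le y)$. For a vector $m$ and a covariance matrix $\Gamma$, $\Phi_{m,\Gamma}$ denotes the Gaussian distribution $\mathcal{N}(m,\Gamma)$ on $\mathbb{R}^d$. The $d$-Normex distribution is defined for Borel $\mathbf{B}\subset\mathbb{R}^d$ by $G_n(\mathbf{B})=\mathbb{P}(\mathbf{Z}+\mathbf{X}_{(n)}\in\mathbf{B})$, where conditionally on $\mathbf{X}_{(n)}=\mathbf{x}$ the vector $\mathbf{Z}$ is Gaussian with mean $(n-1)\mu(\|\mathbf{x}\|)$ and covariance $(n-1)\Sigma(\|\mathbf{x}\|)$; equivalently $G_n(\mathbf{B})=\mathbb{E}\big[\Phi_{(n-1)\mu(\|\mathbf{X}_{(n)}\|),(n-1)\Sigma(\|\mathbf{X}_{(n)}\|)}(\mathbf{B}-\mathbf{X}_{(n)})\big]$. A function $L>0$ is slowly varying at infinity if $L(tx)/L(t)\to1$ as $t\to\infty$ for all $x>0$. *)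

theory Defs
  imports "HOL-Probability.Probability"
begin

definition is_norm :: "(real^'d \<Rightarrow> real) \<Rightarrow> bool" where
  "is_norm N \<longleftrightarrow> (\<forall>x. N x = 0 \<longleftrightarrow> x = 0) \<and> (\<forall>c x. N (c *\<^sub>R x) = \<bar>c\<bar> * N x)
     \<and> (\<forall>x y. N (x + y) \<le> N x + N y)"

definition slowly_varying :: "(real \<Rightarrow> real) \<Rightarrow> bool" where
  "slowly_varying L \<longleftrightarrow> (\<forall>x>0. L x > 0) \<and>
     (\<forall>x>0. ((\<lambda>t. L (t * x) / L t) \<longlongrightarrow> 1) at_top)"

text \<open>Standard Gaussian on R^d and general Gaussian N(m, Gamma) as the law of m + A Z
  with A A^T = Gamma (covers degenerate Gamma as well).\<close>
definition std_gaussian :: "(real^'d) measure" where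
  "std_gaussian = density lborel
     (\<lambda>z. ennreal ((2 * pi) powr (- real CARD('d) / 2) * exp (- (norm z)\<^sup>2 / 2)))"

definition gaussian :: "real^'d \<Rightarrow> real^'d^'d \<Rightarrow> (real^'d) measure" where
  "gaussian m \<Gamma> = distr std_gaussian borel
     (\<lambda>z. m + (SOME A :: real^'d^'d. A ** transpose A = \<Gamma>) *v z)"

definition trunc_event :: "'b measure \<Rightarrow> ('b \<Rightarrow> real^'d) \<Rightarrow> (real^'d \<Rightarrow> real) \<Rightarrow> real \<Rightarrow> 'b set" where
  "trunc_event M Y N y = {\<omega> \<in> space M. N (Y \<omega>) \<le> y}"

definition trunc_mean :: "'b measure \<Rightarrow> ('b \<Rightarrow> real^'d) \<Rightarrow> (real^'d \<Rightarrow> real) \<Rightarrow> real \<Rightarrow> real^'d" where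
  "trunc_mean M Y N y = (\<chi> i. (\<integral>\<omega>. Y \<omega> $ i * indicator (trunc_event M Y N y) \<omega> \<partial>M)
                               / measure M (trunc_event M Y N y))"

definition trunc_cov :: "'b measure \<Rightarrow> ('b \<Rightarrow> real^'d) \<Rightarrow> (real^'d \<Rightarrow> real) \<Rightarrow> real \<Rightarrow> real^'d^'d" where
  "trunc_cov M Y N y = (\<chi> i j. (\<integral>\<omega>. (Y \<omega> $ i - trunc_mean M Y N y $ i)
                                   * (Y \<omega> $ j - trunc_mean M Y N y $ j)
                                   * indicator (trunc_event M Y N y) \<omega> \<partial>M)
                               / measure M (trunc_event M Y N y))"

definition max_summand :: "(nat \<Rightarrow> 'b \<Rightarrow> real^'d) \<Rightarrow> (real^'d \<Rightarrow> real) \<Rightarrow> nat \<Rightarrow> 'b \<Rightarrow> real^'d" where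
  "max_summand X N n \<omega> = X (ARG_MAX (\<lambda>i. N (X i \<omega>)) i. i < n) \<omega>"

definition normex :: "'b measure \<Rightarrow> (nat \<Rightarrow> 'b \<Rightarrow> real^'d) \<Rightarrow> (real^'d \<Rightarrow> real) \<Rightarrow> nat \<Rightarrow> (real^'d) set \<Rightarrow> real" where
  "normex M X N n B = (\<integral>\<omega>.
      (let x = max_summand X N n \<omega> in
        measure (gaussian (real (n - 1) *\<^sub>R trunc_mean M (X 0) N (N x))
                          (real (n - 1) *\<^sub>R trunc_cov M (X 0) N (N x)))
                ((\<lambda>b. b - x) ` B)) \<partial>M)"

end

theory Submission
  imports Defs
begin

text \<open>
  Conditionally on \<open>N X\<^sub>(\<^sub>n\<^sub>) = y\<close> the other summands are i.i.d. with the truncated law, so the error is an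
  average over \<open>y\<close> of the Gaussian approximation error of a sum of \<open>n - 1\<close> truncated vectors over convex
  sets. A Berry--Esseen bound of order \<open>\<beta> harm n / sqrt n\<close>, with \<open>\<beta>\<close> the third absolute moment after
  whitening, is uniform over all laws; for truncation at \<open>y\<close> and \<open>2 < p < \<alpha>\<close> one has \<open>\<beta> \<le> C y powr (3 - p)\<close>, and averaging
  over the maximum, whose \<open>p\<close>-th moment is \<open>O(n)\<close>, gives \<open>n powr (-1/2 + (3 - p) / p)\<close> up to
  a logarithm. Letting \<open>p\<close> tend to \<open>\<alpha>\<close> loses an arbitrarily small power of \<open>n\<close> only, and such a loss
  is dominated by a slowly varying function.

  The Berry--Esseen bound is Lindeberg's replacement scheme combined with induction on \<open>n\<close>. Replacing
  one summand changes a Gaussian average over a convex set only through the oscillation of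
  \<open>w \<mapsto> \<mu> (B - w)\<close>, where \<open>\<mu>\<close> is the law of the partial sum; by the induction hypothesis \<open>\<mu>\<close> is close to a Gaussian on
  convex sets, and for a Gaussian this function is Lipschitz because \<open>B - (B - h)\<close> has
  many disjoint translates.
\<close>

section \<open>Isotropic Gaussian measures\<close>

text \<open>The Berry--Esseen induction is circular unless the induction hypothesis is damped: it
  enters the modulus of \<open>w \<mapsto> \<mu> (B - w)\<close> as an additive error that no
  smoothness of the Gaussian improves. Adding Gaussian noise at scale \<tau> to all sums divides
  that error by \<tau>, at the price of a boundary layer of Gaussian mass of order \<tau> / sqrt n;
  with \<tau> a large multiple of \<beta> harm n both are of the claimed order, and the damped error
  is at most half of the claim. The harmonic number is the sum of the reciprocals of the remaining
  variances. The slowly varying function is the lower envelope, on a logarithmic scale, of the power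
  bounds for all p. Whitening needs a truncated covariance bounded below, which fails as y tends to
  0; the event that the maximum is at most 1 is therefore split off, and its probability is
  exponentially small. The square root in \<open>gaussian\<close> is an arbitrary choice, so even
  the measurability of the integrand of \<open>normex\<close> has to be won indirectly.\<close>

definition gauss_density :: "real \<Rightarrow> real^'d \<Rightarrow> real" where
  "gauss_density s z = (2 * pi * s) powr (- real CARD('d) / 2) * exp (- (norm z)\<^sup>2 / (2 * s))"

text \<open>The parameter is the variance of each coordinate, not the standard deviation: parameters
  then add under convolution, and \<open>gauss (real n)\<close> has the covariance of a sum of n
  standardised vectors.\<close>

definition gauss :: "real \<Rightarrow> (real^'d) measure" where
  "gauss s = density lborel (\<lambda>z. ennreal (gauss_density s z))"

lemma gauss_density_nonneg [simp]: "0 \<le> gauss_density s z"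
  by (simp add: gauss_density_def)

lemma gauss_density_measurable [measurable]: "gauss_density s \<in> borel_measurable borel"
  by (simp add: gauss_density_def[abs_def])

lemma sets_gauss [simp, measurable_cong]: "sets (gauss s) = sets borel"
  by (simp add: gauss_def)

lemma space_gauss [simp]: "space (gauss s) = UNIV"
  by (simp add: gauss_def)

lemma std_gaussian_eq_gauss: "std_gaussian = gauss 1"
  by (simp add: std_gaussian_def gauss_def gauss_density_def)

lemma nn_integral_lborel_shift:
  fixes f :: "'a::euclidean_space \<Rightarrow> ennreal"
  assumes [measurable]: "f \<in> borel_measurable borel"
  shows "(\<integral>\<^sup>+x. f (c + x) \<partial>lborel) = (\<integral>\<^sup>+x. f x \<partial>lborel)"
  by (subst (2) lborel_distr_plus[of c, symmetric]) (simp add: nn_integral_distr)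

lemma norm_vec_sq: "(norm (z :: real^'d))\<^sup>2 = (\<Sum>i\<in>UNIV. (z $ i)\<^sup>2)"
  by (simp add: norm_vec_def L2_set_def sum_nonneg)

lemma norm_sq_Basis: "(norm z)\<^sup>2 = (\<Sum>b\<in>Basis. (z \<bullet> b)\<^sup>2)"
  unfolding power2_norm_eq_inner by (subst euclidean_inner) (simp add: power2_eq_square)

lemma gauss_density_prod:
  fixes z :: "real^'d"
  assumes "s > 0"
  shows "gauss_density s z = (\<Prod>b\<in>Basis. normal_density 0 (sqrt s) (z \<bullet> b))"
proof -
  have "(\<Prod>b\<in>(Basis::(real^'d) set). normal_density 0 (sqrt s) (z \<bullet> b))
      = (\<Prod>b\<in>(Basis::(real^'d) set). 1 / sqrt (2 * pi * s)) * exp (\<Sum>b\<in>Basis. - (z \<bullet> b)\<^sup>2 / (2 * s))"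
    using assms by (simp only: exp_sum finite_Basis prod.distrib[symmetric]) (simp add: normal_density_def)
  also have "(\<Sum>b\<in>Basis. - (z \<bullet> b)\<^sup>2 / (2 * s)) = - (norm z)\<^sup>2 / (2 * s)"
    by (simp add: norm_sq_Basis sum_divide_distrib[symmetric] sum_negf)
  also have "(\<Prod>b\<in>(Basis::(real^'d) set). 1 / sqrt (2 * pi * s)) = (2 * pi * s) powr (- real CARD('d) / 2)"
  proof -
    have "1 / sqrt (2 * pi * s) = (2 * pi * s) powr (- (1/2))"
      using assms by (simp only: powr_minus_divide) (simp add: powr_half_sqrt)
    then have "(\<Prod>b\<in>(Basis::(real^'d) set). 1 / sqrt (2 * pi * s)) = ((2 * pi * s) powr (- (1/2))) ^ CARD('d)"
      by simp
    also have "\<dots> = (2 * pi * s) powr (- (1/2) * real CARD('d))"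
      using assms by (subst powr_powr[symmetric], subst powr_realpow) auto
    finally show ?thesis by simp
  qed
  finally show ?thesis by (simp add: gauss_density_def)
qed

lemma nn_integral_normal_density:
  assumes "s > 0" shows "(\<integral>\<^sup>+x. ennreal (normal_density m s x) \<partial>lborel) = 1"
  using prob_space.emeasure_space_1[OF prob_space_normal_density[OF assms, of m]]
  by (simp add: emeasure_density)

lemma nn_integral_gauss_density:
  assumes "s > 0" shows "(\<integral>\<^sup>+z. ennreal (gauss_density s (z::real^'d)) \<partial>lborel) = 1"
proof -
  have "(\<integral>\<^sup>+z. ennreal (gauss_density s (z::real^'d)) \<partial>lborel)
      = (\<integral>\<^sup>+z. (\<Prod>b\<in>Basis. ennreal (normal_density 0 (sqrt s) ((z::real^'d) \<bullet> b))) \<partial>lborel)"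
    by (simp add: gauss_density_prod[OF assms] prod_ennreal)
  also have "\<dots> = (\<Prod>b\<in>(Basis::(real^'d) set). (\<integral>\<^sup>+x. ennreal (normal_density 0 (sqrt s) x) \<partial>lborel))"
    by (rule nn_integral_lborel_prod) auto
  also have "\<dots> = 1" using assms by (simp add: nn_integral_normal_density)
  finally show ?thesis .
qed

lemma prob_space_gauss: assumes "s > 0" shows "prob_space (gauss s :: (real^'d) measure)"
  by standard (simp add: gauss_def emeasure_density nn_integral_gauss_density[OF assms])

lemma nn_integral_gauss:
  assumes [measurable]: "f \<in> borel_measurable borel"
  shows "(\<integral>\<^sup>+z. f z \<partial>gauss s) = (\<integral>\<^sup>+z. ennreal (gauss_density s z) * f z \<partial>lborel)"
  unfolding gauss_def by (subst nn_integral_density) auto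

lemma gauss_scale:
  assumes "s > 0"
  shows "distr (gauss 1) borel (\<lambda>z. sqrt s *\<^sub>R z) = (gauss s :: (real^'d) measure)"
proof (rule measure_eqI)
  fix A :: "(real^'d) set" assume "A \<in> sets (distr (gauss 1) borel (\<lambda>z. sqrt s *\<^sub>R z))"
  then have [measurable]: "A \<in> sets borel" by simp
  have dens: "ennreal (sqrt s ^ CARD('d)) * ennreal (gauss_density s (sqrt s *\<^sub>R x))
      = ennreal (gauss_density 1 x)" for x :: "real^'d"
  proof -
    have "sqrt s ^ CARD('d) * (2 * pi * s) powr (- real CARD('d) / 2) = (2*pi) powr (- real CARD('d) / 2)"
      using assms by (simp add: powr_realpow[symmetric] powr_half_sqrt[symmetric] powr_powr powr_mult
        powr_minus divide_simps)
    moreover have "(norm (sqrt s *\<^sub>R x))\<^sup>2 / (2 * s) = (norm x)\<^sup>2 / (2 * 1)"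
      using assms by (simp add: power_mult_distrib)
    ultimately show ?thesis
      using assms unfolding gauss_density_def
      by (simp add: ennreal_mult'[symmetric] mult.assoc[symmetric])
  qed
  have "emeasure (gauss s) A = (\<integral>\<^sup>+z. ennreal (gauss_density s z) * indicator A z \<partial>lborel)"
    by (simp add: gauss_def emeasure_density)
  also have "\<dots> = (\<integral>\<^sup>+x. ennreal (sqrt s ^ CARD('d)) * (ennreal (gauss_density s (sqrt s *\<^sub>R x)) * indicator A (sqrt s *\<^sub>R x)) \<partial>lborel)"
    using assms by (subst lborel_affine[of "sqrt s" 0])
      (simp_all add: nn_integral_density nn_integral_distr)
  also have "\<dots> = emeasure (distr (gauss 1) borel (\<lambda>z. sqrt s *\<^sub>R z)) A"
    by (simp add: emeasure_distr gauss_def emeasure_density mult.assoc[symmetric] dens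
       indicator_def vimage_def cong: if_cong)
  finally show "emeasure (distr (gauss 1) borel (\<lambda>z. sqrt s *\<^sub>R z)) A = emeasure (gauss s) A" ..
qed simp

text \<open>Completing the square in \<open>y\<close>. The last factor is the conditional density of
  the second summand given that the sum is \<open>z\<close>; it integrates to 1 in \<open>y\<close>,
  which is all that the convolution formula needs.\<close>

lemma gauss_density_mult:
  assumes "a > 0" "b > 0"
  shows "gauss_density a (z - y) * gauss_density b (y::real^'d)
    = gauss_density (a + b) z * gauss_density (a * b / (a + b)) (y - (b / (a + b)) *\<^sub>R z)"
proof -
  have e: "(norm (z - y))\<^sup>2 / (2*a) + (norm y)\<^sup>2 / (2*b)
     = (norm z)\<^sup>2 / (2*(a+b)) + (norm (y - (b / (a + b)) *\<^sub>R z))\<^sup>2 / (2 * (a * b / (a + b)))"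
  proof -
    define c where "c = a + b"
    have "c > 0" and bc: "b = c - a" using assms by (auto simp: c_def)
    show ?thesis
      using assms \<open>c > 0\<close> unfolding c_def[symmetric]
      apply (simp add: power2_norm_eq_inner inner_diff_left inner_diff_right inner_commute field_simps)
      apply (simp add: bc algebra_simps power2_eq_square)
      done
  qed
  have p: "(2*pi*a) powr (- real CARD('d) / 2) * (2*pi*b) powr (- real CARD('d) / 2)
    = (2*pi*(a+b)) powr (- real CARD('d) / 2) * (2*pi*(a*b/(a+b))) powr (- real CARD('d) / 2)"
  proof -
    have "(2*pi*a) * (2*pi*b) = (2*pi*(a+b)) * (2*pi*(a*b/(a+b)))"
      using assms by simp
    moreover have "(2*pi*a) powr t * (2*pi*b) powr t = ((2*pi*a) * (2*pi*b)) powr t"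
      "(2*pi*(a+b)) powr t * (2*pi*(a*b/(a+b))) powr t = ((2*pi*(a+b)) * (2*pi*(a*b/(a+b)))) powr t" for t
      using assms by (intro powr_mult[symmetric]; simp)+
    ultimately show ?thesis by (simp only:)
  qed
  have "exp (- (norm (z - y))\<^sup>2 / (2*a)) * exp (- (norm y)\<^sup>2 / (2*b))
     = exp (- ((norm (z - y))\<^sup>2 / (2*a) + (norm y)\<^sup>2 / (2*b)))"
    by (simp add: exp_add[symmetric])
  also have "\<dots> = exp (- (norm z)\<^sup>2 / (2*(a+b))) * exp (- (norm (y - (b / (a + b)) *\<^sub>R z))\<^sup>2 / (2 * (a * b / (a + b))))"
    unfolding e by (simp add: exp_add[symmetric])
  finally have q: "exp (- (norm (z - y))\<^sup>2 / (2*a)) * exp (- (norm y)\<^sup>2 / (2*b)) = \<dots>" .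
  have "gauss_density a (z - y) * gauss_density b y
    = ((2*pi*a) powr (- real CARD('d) / 2) * (2*pi*b) powr (- real CARD('d) / 2))
      * (exp (- (norm (z - y))\<^sup>2 / (2*a)) * exp (- (norm y)\<^sup>2 / (2*b)))"
    by (simp only: gauss_density_def mult_ac)
  also have "\<dots> = gauss_density (a + b) z * gauss_density (a * b / (a + b)) (y - (b / (a + b)) *\<^sub>R z)"
    unfolding p q by (simp only: gauss_density_def mult_ac)
  finally show ?thesis .
qed

lemma gauss_convolution:
  assumes "a > 0" "b > 0"
  shows "gauss a \<star> gauss b = (gauss (a + b) :: (real^'d) measure)"
proof (rule measure_eqI)
  fix A :: "(real^'d) set" assume "A \<in> sets (gauss a \<star> gauss b)"
  then have [measurable]: "A \<in> sets borel" by simp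
  let ?c = "a * b / (a + b)" and ?d = "b / (a + b)"
  interpret a: prob_space "gauss a :: (real^'d) measure" by (rule prob_space_gauss) fact
  interpret b: prob_space "gauss b :: (real^'d) measure" by (rule prob_space_gauss) fact
  have "emeasure (gauss a \<star> gauss b) A = (\<integral>\<^sup>+x. \<integral>\<^sup>+y. indicator A (x + y) \<partial>gauss a \<partial>gauss b)"
    unfolding convolution_commutative[OF a.finite_measure_axioms b.finite_measure_axioms sets_gauss sets_gauss]
    by (intro convolution_emeasure') (auto simp: a.finite_measure_axioms b.finite_measure_axioms)
  also have "\<dots> = (\<integral>\<^sup>+y. ennreal (gauss_density b y) * (\<integral>\<^sup>+x. ennreal (gauss_density a x) * indicator A (y + x) \<partial>lborel) \<partial>lborel)"
    by (simp add: nn_integral_gauss)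
  also have "\<dots> = (\<integral>\<^sup>+y. ennreal (gauss_density b y) * (\<integral>\<^sup>+z. ennreal (gauss_density a (z - y)) * indicator A z \<partial>lborel) \<partial>lborel)"
    by (subst nn_integral_lborel_shift[symmetric, where f="\<lambda>z. ennreal (gauss_density a (z - y)) * indicator A z" and c=y for y]) simp_all
  also have "\<dots> = (\<integral>\<^sup>+y. (\<integral>\<^sup>+z. ennreal (gauss_density a (z - y) * gauss_density b y) * indicator A z \<partial>lborel) \<partial>lborel)"
  proof (rule nn_integral_cong)
    fix y :: "real^'d"
    show "ennreal (gauss_density b y) * (\<integral>\<^sup>+z. ennreal (gauss_density a (z - y)) * indicator A z \<partial>lborel)
       = (\<integral>\<^sup>+z. ennreal (gauss_density a (z - y) * gauss_density b y) * indicator A z \<partial>lborel)"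
      by (subst nn_integral_cmult[symmetric])
        (auto simp: ennreal_mult mult_ac intro!: nn_integral_cong)
  qed
  also have "\<dots> = (\<integral>\<^sup>+z. (\<integral>\<^sup>+y. ennreal (gauss_density a (z - y) * gauss_density b y) * indicator A z \<partial>lborel) \<partial>lborel)"
    by (rule lborel_pair.Fubini') simp
  also have "\<dots> = (\<integral>\<^sup>+z. (\<integral>\<^sup>+y. ennreal (gauss_density ?c (- (?d *\<^sub>R z) + y)) * (ennreal (gauss_density (a + b) z) * indicator A z) \<partial>lborel) \<partial>lborel)"
  proof (intro nn_integral_cong)
    fix y z :: "real^'d"
    show "ennreal (gauss_density a (z - y) * gauss_density b y) * indicator A z
      = ennreal (gauss_density ?c (- (?d *\<^sub>R z) + y)) * (ennreal (gauss_density (a + b) z) * indicator A z)"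
      unfolding gauss_density_mult[OF assms]
      by (subst ennreal_mult) (auto simp: mult.assoc mult.left_commute)
  qed
  also have "\<dots> = (\<integral>\<^sup>+z. ennreal (gauss_density (a + b) z) * indicator A z \<partial>lborel)"
  proof (rule nn_integral_cong)
    fix z :: "real^'d"
    have "(\<integral>\<^sup>+y. ennreal (gauss_density ?c (- (?d *\<^sub>R z) + y)) \<partial>lborel) = 1"
      using assms nn_integral_lborel_shift[of "\<lambda>y. ennreal (gauss_density ?c y)" "- (?d *\<^sub>R z)"]
      by (simp add: nn_integral_gauss_density)
    then show "(\<integral>\<^sup>+y. ennreal (gauss_density ?c (- (?d *\<^sub>R z) + y)) * (ennreal (gauss_density (a + b) z) * indicator A z) \<partial>lborel)
       = ennreal (gauss_density (a + b) z) * indicator A z"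
      by (subst nn_integral_multc) auto
  qed
  also have "\<dots> = emeasure (gauss (a + b)) A"
    by (simp add: gauss_def emeasure_density)
  finally show "emeasure (gauss a \<star> gauss b) A = emeasure (gauss (a + b)) A" .
qed simp

section \<open>Moments and reflection symmetry of the standard Gaussian\<close>

lemma power_le_exp_sq: 
  fixes x :: real assumes "x \<ge> 0"
  shows "x ^ k \<le> (fact k * exp 1) * exp (x\<^sup>2 / 4)"
proof -
  have "x ^ k / fact k \<le> exp x"
  proof -
    have "(\<Sum>n\<in>{k}. x ^ n / fact n) \<le> (\<Sum>n. x ^ n /\<^sub>R fact n)"
      using assms summable_exp_generic[of x] sum_le_suminf[of "\<lambda>n. x ^ n /\<^sub>R fact n" "{k}"]
      by (simp add: divide_inverse mult.commute)
    then show ?thesis by (simp add: exp_def)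
  qed
  also have "exp x \<le> exp (1 + x\<^sup>2 / 4)"
    using zero_le_power2[of "x / 2 - 1"] by (simp add: power2_eq_square field_simps)
  also have "\<dots> = exp 1 * exp (x\<^sup>2 / 4)" by (rule exp_add)
  finally show ?thesis by (simp add: field_simps)
qed

text \<open>The majorant \<open>exp ((norm z)\<^sup>2 / 4)\<close> of the power uses up half of the
  Gaussian exponent; what remains is, up to a constant, the density of variance 2, which has mass
  1.\<close>

lemma gauss_integrable_norm_power: "integrable (gauss 1) (\<lambda>z::real^'d. norm z ^ k)"
proof (rule integrableI_bounded)
  let ?C = "fact k * exp 1 :: real" and ?E = "2 powr (real CARD('d) / 2)"
  have dens: "gauss_density 1 z * exp ((norm z)\<^sup>2 / 4) = ?E * gauss_density 2 z" for z :: "real^'d"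
  proof -
    have "exp (- (norm z)\<^sup>2 / (2*1)) * exp ((norm z)\<^sup>2 / 4) = exp (- (norm z)\<^sup>2 / (2*2))"
      by (simp add: exp_add[symmetric])
    moreover have "(2*pi*1) powr (- real CARD('d) / 2) = ?E * (2*pi*2) powr (- real CARD('d) / 2)"
    proof -
      have "(2*pi*2) powr (- real CARD('d) / 2) = (2*pi*1) powr (- real CARD('d) / 2) * 2 powr (- real CARD('d) / 2)"
        by (subst powr_mult[symmetric]) auto
      then show ?thesis by (simp add: powr_minus)
    qed
    ultimately show ?thesis unfolding gauss_density_def by (simp add: mult_ac)
  qed
  have "(\<integral>\<^sup>+z. ennreal (norm (norm (z::real^'d) ^ k)) \<partial>gauss 1)
     = (\<integral>\<^sup>+z. ennreal (gauss_density 1 (z::real^'d)) * ennreal (norm z ^ k) \<partial>lborel)"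
    by (subst nn_integral_gauss) auto
  also have "\<dots> \<le> (\<integral>\<^sup>+z. ennreal (?C * ?E) * ennreal (gauss_density 2 (z::real^'d)) \<partial>lborel)"
  proof (intro nn_integral_mono)
    fix z :: "real^'d"
    have "gauss_density 1 z * norm z ^ k \<le> gauss_density 1 z * (?C * exp ((norm z)\<^sup>2 / 4))"
      by (intro mult_left_mono power_le_exp_sq) auto
    also have "\<dots> = ?C * ?E * gauss_density 2 z" using dens[of z] by (simp add: mult_ac)
    finally show "ennreal (gauss_density 1 z) * ennreal (norm z ^ k) \<le> ennreal (?C * ?E) * ennreal (gauss_density 2 z)"
      by (simp add: ennreal_mult[symmetric])
  qed
  also have "\<dots> = ennreal (?C * ?E)"
    by (simp add: nn_integral_cmult nn_integral_gauss_density)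
  finally show "(\<integral>\<^sup>+z. ennreal (norm (norm (z::real^'d) ^ k)) \<partial>gauss 1) < \<infinity>"
    by (auto simp: le_less_trans)
qed simp

text \<open>Sign changes of coordinates preserve Lebesgue measure and the Euclidean norm, hence the
  density. This symmetry makes the odd moments and the mixed second moments vanish.\<close>

lemma gauss_reflect:
  fixes e :: "'d::finite \<Rightarrow> real"
  assumes e: "\<And>i. \<bar>e i\<bar> = 1"
  shows "distr (gauss s) borel (\<lambda>z. \<chi> i. e i * z $ i) = gauss s"
proof -
  \<comment> \<open>The signs are indexed by coordinates, whereas the affine change of variables for
    Lebesgue measure is indexed by basis vectors; \<open>c\<close> transports them.\<close>
  define c where "c j = e (SOME i. j = axis i 1)" for j :: "real^'d"
  let ?T = "\<lambda>z::real^'d. (\<chi> i. e i * z $ i)"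
  have c: "c (axis i 1) = e i" for i
  proof -
    have "i = (SOME k. axis i (1::real) = axis k 1)" by (rule sym) (simp add: axis_eq_axis)
    then show ?thesis by (simp add: c_def)
  qed
  have T: "?T x = 0 + (\<Sum>j\<in>Basis. (c j * (x \<bullet> j)) *\<^sub>R j)" for x
  proof (rule vector_eq_ldot[THEN iffD1], rule allI)
    fix y
    have "y \<bullet> (\<Sum>j\<in>Basis. (c j * (x \<bullet> j)) *\<^sub>R j) = (\<Sum>j\<in>(Basis::(real^'d) set). c j * (x \<bullet> j) * (y \<bullet> j))"
      by (simp add: inner_sum_right)
    also have "\<dots> = (\<Sum>i\<in>UNIV. e i * x $ i * y $ i)"
      by (simp add: Basis_vec_def axis_eq_axis sum.UNION_disjoint c inner_axis UNION_singleton_eq_range sum.reindex inj_on_def)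
    finally show "y \<bullet> ?T x = y \<bullet> (0 + (\<Sum>j\<in>Basis. (c j * (x \<bullet> j)) *\<^sub>R j))"
      by (simp add: inner_vec_def mult_ac)
  qed
  have [measurable]: "?T \<in> borel_measurable borel"
    unfolding T by measurable
  have lb: "distr lborel borel ?T = lborel"
  proof -
    have *: "\<bar>c j\<bar> = 1" for j by (simp add: c_def e)
    then have "c j \<noteq> 0" for j by (metis abs_0 zero_neq_one)
    then have "lborel = density (distr lborel borel ?T) (\<lambda>_. (\<Prod>j\<in>Basis. \<bar>c j\<bar>))"
      unfolding T by (intro lborel_affine_euclidean)
    then show ?thesis by (simp add: * density_1)
  qed
  have n: "norm (?T x) = norm x" for x
  proof -
    have "(e i * x $ i)\<^sup>2 = (x $ i)\<^sup>2" for i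
      using e[of i] by (metis abs_mult mult_1 power2_abs)
    then show ?thesis by (simp add: norm_vec_def L2_set_def)
  qed
  have "gauss s = density (distr lborel borel ?T) (\<lambda>z. ennreal (gauss_density s z))"
    by (simp add: lb gauss_def)
  also have "\<dots> = distr (density lborel (\<lambda>z. ennreal (gauss_density s (?T z)))) borel ?T"
    by (rule density_distr) auto
  also have "\<dots> = distr (gauss s) borel ?T"
    by (simp add: gauss_def gauss_density_def n)
  finally show ?thesis ..
qed

lemma measurable_vec_lambda_scale [measurable]:
  fixes e :: "'d::finite \<Rightarrow> real"
  shows "(\<lambda>z. (\<chi> i. e i * z $ i) :: real^'d) \<in> borel_measurable borel"
  by (intro borel_measurable_continuous_onI continuous_intros)

lemma gauss_integrable_nth [simp]: "integrable (gauss 1) (\<lambda>z::real^'d. z $ i)"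
  by (rule Bochner_Integration.integrable_bound[OF gauss_integrable_norm_power[of 1]])
     (auto simp: component_le_norm_cart)

lemma gauss_integrable_nth2 [simp]: "integrable (gauss 1) (\<lambda>z::real^'d. z $ i * z $ j)"
  by (rule Bochner_Integration.integrable_bound[OF gauss_integrable_norm_power[of 2]])
     (auto simp: abs_mult power2_eq_square intro!: mult_mono component_le_norm_cart)

lemma measurable_vec_uminus [measurable]:
  "(\<lambda>z. (\<chi> i. - z $ i) :: real^'d) \<in> borel_measurable borel"
  by (intro borel_measurable_continuous_onI continuous_intros)

lemma gauss_mean: "(\<integral>z. (z::real^'d) $ i \<partial>gauss 1) = 0"
proof -
  have "(\<integral>z. (z::real^'d) $ i \<partial>gauss 1) = (\<integral>z. z $ i \<partial>distr (gauss 1) borel (\<lambda>z::real^'d. \<chi> i. - 1 * z $ i))"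
    by (subst gauss_reflect) auto
  also have "\<dots> = - (\<integral>z. (z::real^'d) $ i \<partial>gauss 1)"
    by (subst integral_distr) auto
  finally show ?thesis by simp
qed

lemma gauss_cov: "(\<integral>z. (z::real^'d) $ i * z $ j \<partial>gauss 1) = (if i = j then 1 else 0)"
proof (cases "i = j")
  case False
  let ?e = "\<lambda>k. if k = i then - 1 else 1 :: real"
  have "(\<integral>z. (z::real^'d) $ i * z $ j \<partial>gauss 1) = (\<integral>z. z $ i * z $ j \<partial>distr (gauss 1) borel (\<lambda>z::real^'d. \<chi> k. ?e k * z $ k))"
    by (subst gauss_reflect) auto
  also have "\<dots> = - (\<integral>z. (z::real^'d) $ i * z $ j \<partial>gauss 1)"
    using False by (subst integral_distr) auto
  finally show ?thesis using False by simp
next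
  case True
  let ?a = "axis i 1 :: real^'d"
  have "(\<integral>\<^sup>+z. ennreal ((z $ i)\<^sup>2) \<partial>gauss 1) = (\<integral>\<^sup>+z. ennreal (gauss_density 1 (z::real^'d)) * ennreal ((z $ i)\<^sup>2) \<partial>lborel)"
    by (subst nn_integral_gauss) auto
  \<comment> \<open>The squared coordinate is put into its own factor, so the integrand is still a
    product over the basis: one factor is the second moment of the standard normal law, the others
    are total masses.\<close>
  also have "\<dots> = (\<integral>\<^sup>+z. (\<Prod>b\<in>Basis. ennreal (normal_density 0 1 ((z::real^'d) \<bullet> b) * (if b = ?a then (z \<bullet> b)\<^sup>2 else 1))) \<partial>lborel)"
  proof (rule nn_integral_cong)
    fix z :: "real^'d"
    have "gauss_density 1 z * (z $ i)\<^sup>2 = (\<Prod>b\<in>Basis. normal_density 0 1 (z \<bullet> b) * (if b = ?a then (z \<bullet> b)\<^sup>2 else 1))"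
      by (subst gauss_density_prod) (auto simp: prod.distrib prod.delta' inner_axis axis_in_Basis_iff cong: if_cong)
    then show "ennreal (gauss_density 1 z) * ennreal ((z $ i)\<^sup>2) = (\<Prod>b\<in>Basis. ennreal (normal_density 0 1 (z \<bullet> b) * (if b = ?a then (z \<bullet> b)\<^sup>2 else 1)))"
      by (subst prod_ennreal) (auto simp: ennreal_mult[symmetric])
  qed
  also have "\<dots> = (\<Prod>b\<in>(Basis::(real^'d) set). (\<integral>\<^sup>+x. ennreal (normal_density 0 1 x * (if b = ?a then x\<^sup>2 else 1)) \<partial>lborel))"
    by (rule nn_integral_lborel_prod) auto
  also have "\<dots> = 1"
  proof (rule prod.neutral, rule ballI)
    fix b :: "real^'d"
    have "(\<integral>\<^sup>+x. ennreal (std_normal_density x * x\<^sup>2) \<partial>lborel) = ennreal (\<integral>x. std_normal_density x * x\<^sup>2 \<partial>lborel)"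
      using std_normal_moment_even[of 1] by (intro nn_integral_eq_integral) (auto simp: has_bochner_integral_iff)
    also have "\<dots> = 1"
      using integral_std_normal_moment_even[of 1] by (simp add: fact_numeral)
    finally show "(\<integral>\<^sup>+x. ennreal (normal_density 0 1 x * (if b = ?a then x\<^sup>2 else 1)) \<partial>lborel) = 1"
      by (cases "b = ?a") (auto simp: nn_integral_normal_density)
  qed
  finally have *: "(\<integral>\<^sup>+z. ennreal (((z::real^'d) $ i)\<^sup>2) \<partial>gauss 1) = ennreal 1" by simp
  have "(\<integral>z. ((z::real^'d) $ i)\<^sup>2 \<partial>gauss 1) = 1"
    by (rule integral_eq_nn_integral[THEN trans]) (auto simp: *)
  with True show ?thesis by (simp add: power2_eq_square)
qed

section \<open>Gaussian mass of the boundary layer of a convex set\<close>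

lemma exp_plus_exp_minus_ge: "2 \<le> exp x + exp (- x)" for x :: real
proof -
  have "0 \<le> (exp (x/2) - exp (-x/2))\<^sup>2" by simp
  also have "\<dots> = exp x + exp (-x) - 2"
    by (simp add: power2_diff exp_double[symmetric] exp_add[symmetric])
  finally show ?thesis by simp
qed

text \<open>A single shift multiplies the density by \<open>exp (z \<bullet> h)\<close>, which may
  be arbitrarily small. Adding the opposite shift turns this factor into 2 cosh, which is at least 2
  everywhere.\<close>

lemma gauss_density_pair:
  "2 * exp (- (norm h)\<^sup>2 / 2) * gauss_density 1 z \<le> gauss_density 1 (z - h) + gauss_density 1 (z + h)"
proof -
  have "gauss_density 1 (z - h) = gauss_density 1 z * exp (- (norm h)\<^sup>2 / 2) * exp (z \<bullet> h)"
    by (simp add: gauss_density_def exp_add[symmetric] power2_norm_eq_inner inner_simps inner_commute field_simps)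
  moreover have "gauss_density 1 (z + h) = gauss_density 1 z * exp (- (norm h)\<^sup>2 / 2) * exp (- (z \<bullet> h))"
    by (simp add: gauss_density_def exp_add[symmetric] power2_norm_eq_inner inner_simps inner_commute field_simps)
  ultimately have "gauss_density 1 (z - h) + gauss_density 1 (z + h)
     = gauss_density 1 z * exp (- (norm h)\<^sup>2 / 2) * (exp (z \<bullet> h) + exp (- (z \<bullet> h)))"
    by (simp add: algebra_simps)
  also have "\<dots> \<ge> gauss_density 1 z * exp (- (norm h)\<^sup>2 / 2) * 2"
    by (intro mult_left_mono exp_plus_exp_minus_ge) auto
  finally show ?thesis by (simp add: mult_ac)
qed

text \<open>The translates of \<open>{x \<in> C. x + h \<notin> C}\<close> by multiples of \<open>h\<close> are disjoint, and about
  \<open>2 / norm h\<close> of them have Gaussian mass comparable to the original.\<close>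
lemma gauss1_convex_shift:
  fixes C :: "(real^'d) set"
  assumes C: "convex C" and [measurable]: "C \<in> sets borel"
  shows "measure (gauss 1) {x\<in>C. x + h \<notin> C} \<le> exp (1/2) * norm h"
proof -
  interpret prob_space "gauss 1 :: (real^'d) measure" by (rule prob_space_gauss) simp
  consider "h = 0" | "norm h \<ge> 1" | "0 < norm h" "norm h < 1" by fastforce
  then show ?thesis
  proof cases
    case 2
    have "measure (gauss 1) {x\<in>C. x + h \<notin> C} \<le> 1 * 1" by simp
    also have "\<dots> \<le> exp (1/2) * norm h" using 2 by (intro mult_mono) auto
    finally show ?thesis .
  next
    case 3
    define D where "D = {x\<in>C. x + h \<notin> C}"
    have [measurable]: "D \<in> sets borel" unfolding D_def by measurable
    \<comment> \<open>The largest range for which every shift by k h has length at most 1, so that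
      symmetrised shifts lose no more than the factor exp (-1/2). The number of shifts then
      satisfies (2 K + 1) norm h \<ge> 1.\<close>
    define K :: int where "K = \<lfloor>1 / norm h\<rfloor>"
    have K0: "K \<ge> 0" unfolding K_def using 3 by simp
    have Kh: "norm (real_of_int k *\<^sub>R h) \<le> 1" if "k \<in> {-K..K}" for k
    proof -
      have "\<bar>real_of_int k\<bar> \<le> real_of_int K" using that by auto
      also have "\<dots> \<le> 1 / norm h" unfolding K_def by simp
      finally show ?thesis using 3 by (simp add: field_simps)
    qed
    have Kl: "1 \<le> (2 * K + 1) * norm h"
    proof -
      have "1 / norm h < K + 1" unfolding K_def by linarith
      then have "1 < (K + 1) * norm h" using 3 by (simp add: field_simps)
      then show ?thesis using 3 by (simp add: algebra_simps)
    qed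
    let ?D = "\<lambda>k::int. {x. x + k *\<^sub>R h \<in> D}"
    have disj: "disjoint_family_on ?D {-K..K}"
    proof -
      \<comment> \<open>Since k \<ge> l + 1, the point one step after x + l h lies on the segment
        from x + l h to x + k h. Both ends are in C, so by convexity this point cannot have left
        C.\<close>
      have "x + k *\<^sub>R h \<notin> D" if "x + l *\<^sub>R h \<in> D" "k > l" for x and k l :: int
      proof
        assume "x + k *\<^sub>R h \<in> D"
        then have "x + k *\<^sub>R h \<in> C" "x + l *\<^sub>R h \<in> C" "x + l *\<^sub>R h + h \<notin> C"
          using that by (auto simp: D_def)
        moreover have "x + l *\<^sub>R h + h = (1 - 1 / (k - l)) *\<^sub>R (x + l *\<^sub>R h) + (1 / (k - l)) *\<^sub>R (x + k *\<^sub>R h)"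
        proof -
          define t where "t = 1 / (real_of_int k - l)"
          have "t * (k - l) = 1" using that by (simp add: t_def)
          moreover have "(1 - t) *\<^sub>R (x + l *\<^sub>R h) + t *\<^sub>R (x + k *\<^sub>R h) = x + l *\<^sub>R h + (t * (k - l)) *\<^sub>R h"
            by (simp add: algebra_simps)
          ultimately show ?thesis unfolding t_def by simp
        qed
        moreover have "1 / (real_of_int k - l) \<le> 1" "0 \<le> 1 / (real_of_int k - l)"
          using that by auto
        ultimately show False
          using C by (simp add: convex_alt) 
      qed
      then show ?thesis
        unfolding disjoint_family_on_def by (auto simp: disjoint_iff) (metis linorder_neqE)
    qed
    have "(\<Sum>k\<in>{-K..K}. emeasure (gauss 1) (?D k)) = emeasure (gauss 1) (\<Union>k\<in>{-K..K}. ?D k)"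
      using disj by (intro sum_emeasure) auto
    also have "\<dots> \<le> 1" by (simp add: emeasure_eq_measure) 
    finally have le1: "(\<Sum>k\<in>{-K..K}. emeasure (gauss 1) (?D k)) \<le> 1" .
    have eD: "emeasure (gauss 1) (?D k) = (\<integral>\<^sup>+x. ennreal (gauss_density 1 (x - real_of_int k *\<^sub>R h)) * indicator D x \<partial>lborel)" for k
    proof -
      have "emeasure (gauss 1) (?D k) = (\<integral>\<^sup>+x. ennreal (gauss_density 1 x) * indicator (?D k) x \<partial>lborel)"
        by (simp add: gauss_def emeasure_density)
      also have "\<dots> = (\<integral>\<^sup>+x. ennreal (gauss_density 1 (k *\<^sub>R h + x - k *\<^sub>R h)) * indicator D (k *\<^sub>R h + x) \<partial>lborel)"
        by (intro nn_integral_cong) (auto simp: add.commute split: split_indicator)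
      also have "\<dots> = (\<integral>\<^sup>+x. ennreal (gauss_density 1 (x - k *\<^sub>R h)) * indicator D x \<partial>lborel)"
        by (rule nn_integral_lborel_shift) measurable
      finally show ?thesis .
    qed
    have sumge: "(2 * K + 1) * exp (-1/2) * gauss_density 1 x \<le> (\<Sum>k\<in>{-K..K}. gauss_density 1 (x - real_of_int k *\<^sub>R h))" for x :: "real^'d"
    proof -
      \<comment> \<open>The range is symmetric, so twice the sum is a sum over pairs of opposite
        shifts, and \<open>gauss_density_pair\<close> applies to each pair.\<close>
      have "(\<Sum>k\<in>{-K..K}. gauss_density 1 (x - real_of_int k *\<^sub>R h)) = (\<Sum>k\<in>{-K..K}. gauss_density 1 (x + real_of_int k *\<^sub>R h))"
        by (rule sum.reindex_bij_witness[of _ uminus uminus]) auto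
      then have "2 * (\<Sum>k\<in>{-K..K}. gauss_density 1 (x - real_of_int k *\<^sub>R h))
          = (\<Sum>k\<in>{-K..K}. gauss_density 1 (x - real_of_int k *\<^sub>R h) + gauss_density 1 (x + real_of_int k *\<^sub>R h))"
        by (simp add: sum.distrib)
      also have "\<dots> \<ge> (\<Sum>k\<in>{-K..K}. 2 * exp (-1/2) * gauss_density 1 x)"
      proof (rule sum_mono)
        fix k assume k: "k \<in> {-K..K}"
        have "(norm (real_of_int k *\<^sub>R h))\<^sup>2 \<le> 1"
          using Kh[OF k] by (intro power_le_one) auto
        then have "2 * exp (-1/2) * gauss_density 1 x \<le> 2 * exp (- (norm (real_of_int k *\<^sub>R h))\<^sup>2 / 2) * gauss_density 1 x"
          by (intro mult_right_mono mult_left_mono) auto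
        also note gauss_density_pair
        finally show "2 * exp (-1/2) * gauss_density 1 x \<le> gauss_density 1 (x - real_of_int k *\<^sub>R h) + gauss_density 1 (x + real_of_int k *\<^sub>R h)" .
      qed
      finally show ?thesis using K0 by simp
    qed
    have "ennreal ((2 * K + 1) * exp (-1/2)) * emeasure (gauss 1) D
        = (\<integral>\<^sup>+x. ennreal ((2 * K + 1) * exp (-1/2)) * (ennreal (gauss_density 1 x) * indicator D x) \<partial>lborel)"
      by (subst nn_integral_cmult) (auto simp: gauss_def emeasure_density)
    also have "\<dots> \<le> (\<integral>\<^sup>+x. (\<Sum>k\<in>{-K..K}. ennreal (gauss_density 1 (x - real_of_int k *\<^sub>R h)) * indicator D x) \<partial>lborel)"
    proof (rule nn_integral_mono)
      fix x :: "real^'d"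
      have "ennreal ((2 * K + 1) * exp (-1/2)) * ennreal (gauss_density 1 x) \<le> (\<Sum>k\<in>{-K..K}. ennreal (gauss_density 1 (x - real_of_int k *\<^sub>R h)))"
        using sumge[of x] K0 by (simp add: ennreal_mult[symmetric] ennreal_leI)
      then show "ennreal ((2 * K + 1) * exp (-1/2)) * (ennreal (gauss_density 1 x) * indicator D x) \<le> (\<Sum>k\<in>{-K..K}. ennreal (gauss_density 1 (x - real_of_int k *\<^sub>R h)) * indicator D x)"
        by (cases "x \<in> D") simp_all
    qed
    also have "\<dots> = (\<Sum>k\<in>{-K..K}. emeasure (gauss 1) (?D k))"
      by (subst nn_integral_sum) (auto simp: eD)
    also note le1
    finally have "ennreal ((2 * K + 1) * exp (-1/2) * measure (gauss 1) D) \<le> ennreal 1"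
      using K0 by (simp add: emeasure_eq_measure ennreal_mult)
    then have m: "(2 * K + 1) * exp (-1/2) * measure (gauss 1) D \<le> 1"
      by (subst (asm) ennreal_le_iff) auto
    have "measure (gauss 1) D = 1 * measure (gauss 1) D" by simp
    also have "\<dots> \<le> ((2 * K + 1) * norm h) * measure (gauss 1) D"
      using Kl by (intro mult_right_mono) auto
    also have "\<dots> = (exp (1/2) * norm h) * ((2 * K + 1) * exp (-1/2) * measure (gauss 1) D)"
      by (simp add: mult_ac exp_minus)
    also have "\<dots> \<le> (exp (1/2) * norm h) * 1"
      using m by (intro mult_left_mono) auto
    finally show ?thesis by (simp add: D_def)
  qed auto
qed

lemma gauss_convex_shift:
  fixes C :: "(real^'d) set"
  assumes C: "convex C" and [measurable]: "C \<in> sets borel" and s: "s > 0"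
  shows "measure (gauss s) {x\<in>C. x + h \<notin> C} \<le> exp (1/2) * norm h / sqrt s"
proof -
  let ?C = "(\<lambda>x. sqrt s *\<^sub>R x) -` C"
  have [measurable]: "?C \<in> sets borel" by (rule measurable_sets_borel[OF _ assms(2)]) measurable
  have "measure (gauss s) {x\<in>C. x + h \<notin> C} = measure (gauss 1) ((\<lambda>x. sqrt s *\<^sub>R x) -` {x\<in>C. x + h \<notin> C})"
    by (subst gauss_scale[OF s, symmetric], subst measure_distr) auto
  also have "(\<lambda>x. sqrt s *\<^sub>R x) -` {x\<in>C. x + h \<notin> C} = {x\<in>?C. x + h /\<^sub>R sqrt s \<notin> ?C}"
    using s by (auto simp: scaleR_right_distrib)
  also have "measure (gauss 1) \<dots> \<le> exp (1/2) * norm (h /\<^sub>R sqrt s)"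
    by (intro gauss1_convex_shift convex_linear_vimage C) (auto intro!: linearI simp: scaleR_right_distrib)
  finally show ?thesis using s by (simp add: field_simps)
qed

section \<open>Taylor expansion of Gaussian averages\<close>

lemma DERIV_integral_dominated:
  fixes f f' :: "real \<Rightarrow> 'a \<Rightarrow> real"
  assumes deriv: "\<And>t x. x \<in> space M \<Longrightarrow> ((\<lambda>t. f t x) has_real_derivative f' t x) (at t)"
    and int: "\<And>t. integrable M (f t)"
    and [measurable]: "\<And>t. f' t \<in> borel_measurable M"
    and bound: "\<And>t x. x \<in> space M \<Longrightarrow> \<bar>t - t0\<bar> \<le> 1 \<Longrightarrow> \<bar>f' t x\<bar> \<le> g x"
    and g: "integrable M g"
  shows "((\<lambda>t. \<integral>x. f t x \<partial>M) has_real_derivative (\<integral>x. f' t0 x \<partial>M)) (at t0)"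
  unfolding has_field_derivative_iff
proof (subst tendsto_at_iff_sequentially, intro allI impI)
  fix s :: "nat \<Rightarrow> real" assume s: "\<forall>i. s i \<in> UNIV - {t0}" "s \<longlonglongrightarrow> t0"
  have ev: "\<forall>\<^sub>F i in sequentially. \<bar>s i - t0\<bar> \<le> 1"
    using s(2) by (auto simp: tendsto_iff dist_real_def elim!: allE[of _ 1] eventually_mono)
  have [measurable]: "f t \<in> borel_measurable M" for t using int by auto
  \<comment> \<open>The majorant only works within distance 1 of \<open>t0\<close>. Difference
    quotients taken further away, finitely many, are overwritten by the limit so that dominated
    convergence applies to the whole sequence.\<close>
  let ?q = "\<lambda>i x. if \<bar>s i - t0\<bar> \<le> 1 then (f (s i) x - f t0 x) / (s i - t0) else f' t0 x"
  have "(\<lambda>i. \<integral>x. ?q i x \<partial>M) \<longlonglongrightarrow> (\<integral>x. f' t0 x \<partial>M)"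
  proof (rule integral_dominated_convergence[where w=g])
    show "AE x in M. (\<lambda>i. ?q i x) \<longlonglongrightarrow> f' t0 x"
    proof (rule AE_I2)
      fix x assume x: "x \<in> space M"
      have "(\<lambda>i. (f (s i) x - f t0 x) / (s i - t0)) \<longlonglongrightarrow> f' t0 x"
        using deriv[OF x, of t0] s unfolding has_field_derivative_iff
        by (subst (asm) tendsto_at_iff_sequentially) (auto simp: o_def)
      then show "(\<lambda>i. ?q i x) \<longlonglongrightarrow> f' t0 x"
        by (rule Lim_transform_eventually) (use ev in \<open>auto elim!: eventually_mono\<close>)
    qed
    show "AE x in M. norm (?q i x) \<le> g x" for i
    proof (rule AE_I2)
      fix x assume x: "x \<in> space M"
      show "norm (?q i x) \<le> g x"
      proof (cases "\<bar>s i - t0\<bar> \<le> 1")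
        case True
        have ne: "s i \<noteq> t0" using s by auto
        have "\<exists>z. \<bar>z - t0\<bar> \<le> 1 \<and> f (s i) x - f t0 x = (s i - t0) * f' z x"
        proof (cases "s i > t0")
          case True
          with MVT2[of t0 "s i" "\<lambda>t. f t x" "\<lambda>t. f' t x"] deriv[OF x] \<open>\<bar>s i - t0\<bar> \<le> 1\<close>
          show ?thesis by force
        next
          case False
          with ne have "s i < t0" by simp
          with MVT2[of "s i" t0 "\<lambda>t. f t x" "\<lambda>t. f' t x"] deriv[OF x]
          obtain z where "s i < z" "z < t0" "f t0 x - f (s i) x = (t0 - s i) * f' z x" by auto
          then show ?thesis using \<open>\<bar>s i - t0\<bar> \<le> 1\<close>
            by (intro exI[of _ z]) (auto simp: algebra_simps)
        qed
        then obtain z where "\<bar>z - t0\<bar> \<le> 1" "(f (s i) x - f t0 x) / (s i - t0) = f' z x"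
          using ne by auto
        then show ?thesis using bound[OF x, of z] True by simp
      next
        case False
        then show ?thesis using bound[OF x, of t0] by simp
      qed
    qed
  qed (use g in auto)
  then have "(\<lambda>i. ((\<integral>x. f (s i) x \<partial>M) - (\<integral>x. f t0 x \<partial>M)) / (s i - t0)) \<longlonglongrightarrow> (\<integral>x. f' t0 x \<partial>M)"
  proof (rule Lim_transform_eventually)
    show "\<forall>\<^sub>F i in sequentially. (\<integral>x. ?q i x \<partial>M) = ((\<integral>x. f (s i) x \<partial>M) - (\<integral>x. f t0 x \<partial>M)) / (s i - t0)"
      using ev by eventually_elim (simp add: int)
  qed
  then show "((\<lambda>t. ((\<integral>x. f t x \<partial>M) - (\<integral>x. f t0 x \<partial>M)) / (t - t0)) \<circ> s) \<longlonglongrightarrow> (\<integral>x. f' t0 x \<partial>M)"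
    by (simp add: o_def)
qed

lemma integral_lborel_shift:
  fixes f :: "'a::euclidean_space \<Rightarrow> real"
  assumes [measurable]: "f \<in> borel_measurable borel"
  shows "(\<integral>x. f (c + x) \<partial>lborel) = (\<integral>x. f x \<partial>lborel)"
  by (subst (2) lborel_distr_plus[of c, symmetric]) (simp add: integral_distr)

lemma integral_gauss:
  fixes f :: "real^'d \<Rightarrow> real"
  assumes [measurable]: "f \<in> borel_measurable borel"
  shows "(\<integral>z. f z \<partial>gauss s) = (\<integral>z. gauss_density s z * f z \<partial>lborel)"
  unfolding gauss_def by (subst integral_density) auto

text \<open>\<open>herm k v w * gauss_density 1 w\<close> is the \<open>k\<close>-th derivative of
  \<open>t \<mapsto> gauss_density 1 (w - t v)\<close> at \<open>t = 0\<close>.\<close>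
definition herm :: "nat \<Rightarrow> real^'d \<Rightarrow> real^'d \<Rightarrow> real" where
  "herm k v w = (if k = 0 then 1 else if k = 1 then w \<bullet> v
     else if k = 2 then (w \<bullet> v)\<^sup>2 - (norm v)\<^sup>2 else (w \<bullet> v) ^ 3 - 3 * (norm v)\<^sup>2 * (w \<bullet> v))"

lemma herm_measurable [measurable]: "herm k v \<in> borel_measurable borel"
  unfolding herm_def[abs_def] by measurable

lemma herm_deriv:
  assumes "k < 3"
  shows "((\<lambda>t. herm k v (z - t *\<^sub>R v) * gauss_density 1 (z - t *\<^sub>R v)) has_real_derivative
    herm (Suc k) v (z - t *\<^sub>R v) * gauss_density 1 (z - t *\<^sub>R v)) (at t)"
proof -
  have n: "(norm (z - t *\<^sub>R v))\<^sup>2 = (norm z)\<^sup>2 - 2 * t * (z \<bullet> v) + t\<^sup>2 * (norm v)\<^sup>2" for t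
    unfolding power2_norm_eq_inner by (simp add: inner_simps inner_commute power2_eq_square algebra_simps)
  have i: "(z - t *\<^sub>R v) \<bullet> v = z \<bullet> v - t * (norm v)\<^sup>2" for t
    unfolding power2_norm_eq_inner by (simp add: inner_simps)
  have g: "gauss_density 1 (z - t *\<^sub>R v) = (2 * pi) powr (- real CARD('a) / 2) * exp (t * (z \<bullet> v) - t\<^sup>2 * ((norm v)\<^sup>2 / 2) - (norm z)\<^sup>2 / 2)" for t
    by (simp add: gauss_density_def n algebra_simps add_divide_distrib diff_divide_distrib)
  have G: "((\<lambda>t. gauss_density 1 (z - t *\<^sub>R v)) has_real_derivative
     (z \<bullet> v - t * (norm v)\<^sup>2) * gauss_density 1 (z - t *\<^sub>R v)) (at t)"
    unfolding g by (auto intro!: derivative_eq_intros)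
  have P: "((\<lambda>t. herm k v (z - t *\<^sub>R v)) has_real_derivative
     herm (Suc k) v (z - t *\<^sub>R v) - (z \<bullet> v - t * (norm v)\<^sup>2) * herm k v (z - t *\<^sub>R v)) (at t)"
  proof -
    consider "k = 0" | "k = 1" | "k = 2" using assms by linarith
    then show ?thesis
      unfolding herm_def i
      by cases (auto intro!: derivative_eq_intros simp: power2_eq_square power3_eq_cube algebra_simps)
  qed
  show ?thesis
    using DERIV_mult[OF P G] by (rule DERIV_cong) (simp add: algebra_simps)
qed

lemma herm_le: "\<bar>herm k v w\<bar> \<le> (1 + norm v) ^ 3 * (1 + 4 * norm w + (norm w)\<^sup>2 + norm w ^ 3)"
proof -
  have a: "\<bar>w \<bullet> v\<bar> \<le> norm w * norm v" by (rule Cauchy_Schwarz_ineq2)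
  have a2: "(w \<bullet> v)\<^sup>2 \<le> (norm w * norm v)\<^sup>2" using a by (rule abs_le_square_iff[THEN iffD1, OF order_trans]) simp
  have a3: "\<bar>(w \<bullet> v) ^ 3\<bar> \<le> (norm w * norm v) ^ 3" using a unfolding power_abs by (intro power_mono) auto
  have v: "1 \<le> (1 + norm v) ^ 3" "norm v \<le> (1 + norm v) ^ 3" "(norm v)\<^sup>2 \<le> (1 + norm v) ^ 3" "norm v ^ 3 \<le> (1 + norm v) ^ 3"
    by (auto simp: power3_eq_cube power2_eq_square algebra_simps)
  let ?V = "(1 + norm v) ^ 3"
  consider "k = 0" | "k = 1" | "k = 2" | "k > 2" by linarith
  then show ?thesis
  proof cases
    case 1
    have "1 * 1 \<le> ?V * (1 + 4 * norm w + (norm w)\<^sup>2 + norm w ^ 3)"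
      by (intro mult_mono v) auto
    then show ?thesis using 1 by (simp add: herm_def)
  next
    case 2
    note a
    also have "norm w * norm v \<le> (1 + 4 * norm w + (norm w)\<^sup>2 + norm w ^ 3) * ?V"
      by (intro mult_mono v) auto
    finally show ?thesis using 2 by (simp add: herm_def mult.commute)
  next
    case 3
    have "\<bar>(w \<bullet> v)\<^sup>2 - (norm v)\<^sup>2\<bar> \<le> (norm w * norm v)\<^sup>2 + (norm v)\<^sup>2" using a2 by (simp add: abs_le_iff) (smt (verit) zero_le_power2)
    also have "\<dots> = ((norm w)\<^sup>2 + 1) * (norm v)\<^sup>2" by (simp add: algebra_simps power_mult_distrib)
    also have "\<dots> \<le> (1 + 4 * norm w + (norm w)\<^sup>2 + norm w ^ 3) * ?V"
      by (intro mult_mono v) auto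
    finally show ?thesis using 3 by (simp add: herm_def mult.commute)
  next
    case 4
    have "\<bar>(w \<bullet> v) ^ 3 - 3 * (norm v)\<^sup>2 * (w \<bullet> v)\<bar> \<le> \<bar>(w \<bullet> v) ^ 3\<bar> + \<bar>3 * (norm v)\<^sup>2 * (w \<bullet> v)\<bar>" by (rule abs_triangle_ineq4)
    also have "\<dots> \<le> (norm w * norm v) ^ 3 + 3 * (norm v)\<^sup>2 * (norm w * norm v)"
      using a3 a by (intro add_mono) (auto simp: abs_mult intro!: mult_left_mono)
    also have "\<dots> = (norm w ^ 3 + 3 * norm w) * norm v ^ 3" by (simp add: algebra_simps power2_eq_square power3_eq_cube)
    also have "\<dots> \<le> (1 + 4 * norm w + (norm w)\<^sup>2 + norm w ^ 3) * ?V"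
      by (intro mult_mono v) auto
    finally show ?thesis using 4 by (simp add: herm_def mult.commute)
  qed
qed

text \<open>Unlike \<open>herm_le\<close>, homogeneous of degree 3 in \<open>v\<close>: this is what
  makes the Taylor remainder proportional to the third moment of a summand.\<close>

lemma herm3_le: "\<bar>herm 3 v w\<bar> \<le> norm v ^ 3 * (norm w ^ 3 + 3 * norm w)"
proof -
  have a: "\<bar>w \<bullet> v\<bar> \<le> norm w * norm v" by (rule Cauchy_Schwarz_ineq2)
  have a3: "\<bar>(w \<bullet> v) ^ 3\<bar> \<le> (norm w * norm v) ^ 3" using a unfolding power_abs by (intro power_mono) auto
  have "\<bar>(w \<bullet> v) ^ 3 - 3 * (norm v)\<^sup>2 * (w \<bullet> v)\<bar> \<le> \<bar>(w \<bullet> v) ^ 3\<bar> + \<bar>3 * (norm v)\<^sup>2 * (w \<bullet> v)\<bar>" by (rule abs_triangle_ineq4)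
  also have "\<dots> \<le> (norm w * norm v) ^ 3 + 3 * (norm v)\<^sup>2 * (norm w * norm v)"
    using a3 a by (intro add_mono) (auto simp: abs_mult intro!: mult_left_mono)
  also have "\<dots> = norm v ^ 3 * (norm w ^ 3 + 3 * norm w)" by (simp add: algebra_simps power2_eq_square power3_eq_cube)
  finally show ?thesis by (simp add: herm_def)
qed

text \<open>One majorant serves all t in the range and all orders. The polynomial costs half of the
  exponent of the shifted Gaussian, and norm z squared is at most 2 norm w squared plus a constant
  for w = z - t v; the remaining half therefore dominates in the form of a density of variance 4
  that does not involve t.\<close>

lemma herm_gauss_dominated:
  "\<exists>g. integrable lborel g \<and> (\<forall>t z k. \<bar>t\<bar> \<le> T \<longrightarrow> \<bar>herm k v (z - t *\<^sub>R v) * gauss_density 1 (z - t *\<^sub>R v)\<bar> \<le> g z)"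
proof -
  define K where "K = (1 + norm v) ^ 3 * (\<Sum>j<4::nat. 4 * (fact j * exp 1))"
  have K0: "K \<ge> 0" unfolding K_def by (intro mult_nonneg_nonneg sum_nonneg) auto
  have hK: "\<bar>herm k v w\<bar> \<le> K * exp ((norm w)\<^sup>2 / 4)" for k w
  proof -
    note herm_le[of k v w]
    also have "1 + 4 * norm w + (norm w)\<^sup>2 + norm w ^ 3 \<le> (\<Sum>j<4::nat. 4 * norm w ^ j)"
      by (simp add: eval_nat_numeral)
    also have "\<dots> \<le> (\<Sum>j<4::nat. 4 * ((fact j * exp 1) * exp ((norm w)\<^sup>2 / 4)))"
      by (intro sum_mono mult_left_mono power_le_exp_sq) auto
    also have "\<dots> = (\<Sum>j<4::nat. 4 * (fact j * exp 1)) * exp ((norm w)\<^sup>2 / 4)"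
      by (simp add: sum_distrib_right mult.assoc)
    finally show ?thesis by (simp add: K_def mult.assoc mult_left_mono)
  qed
  let ?c = "(2 * pi) powr (- real CARD('a) / 2)"
  define L where "L = K * ?c * exp (T\<^sup>2 * (norm v)\<^sup>2 / 4) / (8 * pi) powr (- real CARD('a) / 2)"
  have main: "\<bar>herm k v (z - t *\<^sub>R v) * gauss_density 1 (z - t *\<^sub>R v)\<bar> \<le> L * gauss_density 4 z" if "\<bar>t\<bar> \<le> T" for t z k
  proof -
    let ?w = "z - t *\<^sub>R v"
    have "norm z \<le> norm ?w + norm (t *\<^sub>R v)" using norm_triangle_ineq[of ?w "t *\<^sub>R v"] by simp
    then have "(norm z)\<^sup>2 \<le> (norm ?w + norm (t *\<^sub>R v))\<^sup>2" by (intro power_mono) auto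
    also have "\<dots> \<le> 2 * (norm ?w)\<^sup>2 + 2 * (norm (t *\<^sub>R v))\<^sup>2"
      using zero_le_power2[of "norm ?w - norm (t *\<^sub>R v)"] by (simp add: power2_eq_square algebra_simps)
    also have "(norm (t *\<^sub>R v))\<^sup>2 = t\<^sup>2 * (norm v)\<^sup>2" by (simp add: power_mult_distrib)
    also have "t\<^sup>2 * (norm v)\<^sup>2 \<le> T\<^sup>2 * (norm v)\<^sup>2" using that by (intro mult_right_mono) (auto simp: abs_le_square_iff[symmetric])
    finally have *: "- (norm ?w)\<^sup>2 / 4 \<le> T\<^sup>2 * (norm v)\<^sup>2 / 4 - (norm z)\<^sup>2 / 8" by simp
    have "\<bar>herm k v ?w * gauss_density 1 ?w\<bar> = \<bar>herm k v ?w\<bar> * (?c * exp (- (norm ?w)\<^sup>2 / 2))"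
      by (simp add: abs_mult gauss_density_def)
    also have "\<dots> \<le> (K * exp ((norm ?w)\<^sup>2 / 4)) * (?c * exp (- (norm ?w)\<^sup>2 / 2))"
      by (intro mult_right_mono hK) auto
    also have "\<dots> = K * ?c * exp (- (norm ?w)\<^sup>2 / 4)" by (simp add: exp_add[symmetric])
    also have "\<dots> \<le> K * ?c * exp (T\<^sup>2 * (norm v)\<^sup>2 / 4 - (norm z)\<^sup>2 / 8)"
      using * K0 by (intro mult_left_mono) auto
    also have "exp (T\<^sup>2 * (norm v)\<^sup>2 / 4 - (norm z)\<^sup>2 / 8) = exp (T\<^sup>2 * (norm v)\<^sup>2 / 4) * exp (- (norm z)\<^sup>2 / 8)"
      by (simp add: exp_add[symmetric])
    also have "K * ?c * \<dots> = L * gauss_density 4 z"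
      by (simp add: L_def gauss_density_def)
    finally show ?thesis .
  qed
  have "integrable lborel (\<lambda>z::real^'a. L * gauss_density 4 z)"
    by (intro integrable_mult_right integrableI_bounded)
       (auto simp: nn_integral_gauss_density)
  with main show ?thesis by blast
qed

text \<open>The integrand is odd. In the Taylor remainder this permits subtracting a constant from
  the test function, so that only its increments matter.\<close>

lemma gauss_odd_herm3: "(\<integral>w. herm 3 v w \<partial>gauss 1) = 0"
proof -
  have e: "(\<chi> i. - 1 * z $ i) = - z" for z :: "real^'a" by (simp add: vec_eq_iff)
  have "(\<integral>w. herm 3 v w \<partial>gauss 1) = (\<integral>w. herm 3 v w \<partial>distr (gauss 1) borel (\<lambda>z. \<chi> i. - 1 * z $ i))"
    by (subst gauss_reflect) auto
  also have "\<dots> = (\<integral>w. herm 3 v (- w) \<partial>gauss 1)"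
    unfolding e by (rule integral_distr) auto
  also have "\<dots> = - (\<integral>w. herm 3 v w \<partial>gauss 1)"
    by (simp add: herm_def algebra_simps flip: Bochner_Integration.integral_minus)
  finally show ?thesis by simp
qed

text \<open>The Gaussian mean of (1 + norm w) times the polynomial of \<open>herm3_le\<close>; the
  factor 1 + norm w covers the linear and the constant part of the modulus at once.\<close>

definition gauss_taylor_const :: "'d::finite itself \<Rightarrow> real" where
  "gauss_taylor_const _ = (\<integral>w. norm w ^ 4 + norm w ^ 3 + 3 * (norm w)\<^sup>2 + 3 * norm w \<partial>(gauss 1 :: (real^'d) measure))"

lemma gauss_taylor_const_nonneg: "0 \<le> gauss_taylor_const TYPE('d::finite)"
  unfolding gauss_taylor_const_def by (intro Bochner_Integration.integral_nonneg) auto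

text \<open>The test function is only measurable: written with the shift in the density, all
  derivatives fall on the Gaussian. The remainder is the third derivative at an intermediate point;
  since \<open>herm 3 v\<close> has Gaussian mean 0, it sees only increments of \<open>F\<close> and
  is bounded by the modulus A, D instead of the sup norm. This gain is what lets the induction for
  the Berry--Esseen bound close.\<close>

lemma gauss_taylor_line:
  fixes F :: "real^'d \<Rightarrow> real"
  assumes [measurable]: "F \<in> borel_measurable borel"
    and F: "\<And>x. 0 \<le> F x" "\<And>x. F x \<le> 1"
    and mod: "\<And>a w. \<bar>F (a + w) - F a\<bar> \<le> A * norm w + D"
  defines "D' \<equiv> \<lambda>k v. \<integral>z. F z * herm k v z \<partial>gauss 1"
  shows "\<bar>(\<integral>z. F (v + z) \<partial>gauss 1) - (D' 0 v + D' 1 v + D' 2 v / 2)\<bar>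
    \<le> gauss_taylor_const TYPE('d) * (A + D) * norm v ^ 3"
proof -
  let ?f = "\<lambda>k t z. F z * (herm k v (z - t *\<^sub>R v) * gauss_density 1 (z - t *\<^sub>R v))"
  define d where "d k t = (\<integral>z. ?f k t z \<partial>lborel)" for k t
  have Fle: "\<bar>F x\<bar> \<le> 1" for x using F[of x] by simp
  have fb: "\<bar>?f k t z\<bar> \<le> \<bar>herm k v (z - t *\<^sub>R v) * gauss_density 1 (z - t *\<^sub>R v)\<bar>" for k t z
    using mult_right_mono[OF Fle[of z], of "\<bar>herm k v (z - t *\<^sub>R v) * gauss_density 1 (z - t *\<^sub>R v)\<bar>"]
    by (simp add: abs_mult)
  have int: "integrable lborel (?f k t)" for k t
  proof -
    obtain g where g: "integrable lborel g" "\<And>z. \<bar>herm k v (z - t *\<^sub>R v) * gauss_density 1 (z - t *\<^sub>R v)\<bar> \<le> g z"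
      using herm_gauss_dominated[of "\<bar>t\<bar>" v] by blast
    show ?thesis
      by (rule Bochner_Integration.integrable_bound[OF g(1)])
         (auto intro!: order_trans[OF fb] order_trans[OF g(2)] simp del: abs_mult)
  qed
  have der: "(d k has_real_derivative d (Suc k) t) (at t)" if "k < 3" for k t
  proof -
    obtain g where g: "integrable lborel g" "\<And>t' k z. \<bar>t'\<bar> \<le> \<bar>t\<bar> + 1 \<Longrightarrow> \<bar>herm k v (z - t' *\<^sub>R v) * gauss_density 1 (z - t' *\<^sub>R v)\<bar> \<le> g z"
      using herm_gauss_dominated[of "\<bar>t\<bar> + 1" v] by blast
    show ?thesis unfolding d_def
    proof (rule DERIV_integral_dominated[OF _ int _ _ g(1)])
      show "((\<lambda>t. ?f k t z) has_real_derivative ?f (Suc k) t z) (at t)" for t z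
        using herm_deriv[OF that] by (rule DERIV_cmult)
      show "\<bar>?f (Suc k) t' z\<bar> \<le> g z" if "\<bar>t' - t\<bar> \<le> 1" for t' z
        using that by (intro order_trans[OF fb] g(2)) auto
    qed measurable
  qed
  \<comment> \<open>Substituting z = t v + w moves the shift from the density back into
    \<open>F\<close>, which exposes the increments of \<open>F\<close>.\<close>
  have dt: "d k t = (\<integral>w. F (t *\<^sub>R v + w) * herm k v w \<partial>gauss 1)" for k t
  proof -
    have "d k t = (\<integral>w. ?f k t (t *\<^sub>R v + w) \<partial>lborel)"
      unfolding d_def by (rule integral_lborel_shift[symmetric]) measurable
    then show ?thesis by (simp add: integral_gauss mult_ac)
  qed
  have "\<exists>t. 0 < t \<and> t < 1 \<and> d 0 1 = (\<Sum>m<3. d m 0 / fact m * 1 ^ m) + d 3 t / fact 3 * 1 ^ 3"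
    by (rule Maclaurin) (auto intro: der)
  then obtain t where t: "d 0 1 = d 0 0 + d 1 0 + d 2 0 / 2 + d 3 t / 6"
    by (auto simp: eval_nat_numeral)
  have igk: "integrable (gauss 1) (\<lambda>w::real^'d. norm w ^ k)" for k by (rule gauss_integrable_norm_power)
  have igk1: "integrable (gauss 1) (\<lambda>w::real^'d. norm w)" using igk[of 1] by simp
  have "integrable (gauss 1) (herm 3 v)"
    by (rule Bochner_Integration.integrable_bound[of _ "\<lambda>w. norm v ^ 3 * (norm w ^ 3 + 3 * norm w)"])
       (auto simp: igk igk1 intro!: order_trans[OF herm3_le])
  then have i3: "integrable (gauss 1) (\<lambda>w. F (t *\<^sub>R v) * herm 3 v w)" by simp
  have i3': "integrable (gauss 1) (\<lambda>w. F (t *\<^sub>R v + w) * herm 3 v w)"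
    by (rule Bochner_Integration.integrable_bound[of _ "\<lambda>w. norm v ^ 3 * (norm w ^ 3 + 3 * norm w)"])
       (auto simp: igk igk1 abs_mult intro!: order_trans[OF mult_right_mono[OF Fle]] order_trans[OF herm3_le])
  have A0: "0 \<le> A * norm w + D" for w :: "real^'d" using mod[of 0 w] by linarith
  have D0: "0 \<le> D" using A0[of 0] by simp
  \<comment> \<open>A negative A would make the modulus equal to -1 at a vector of norm (D + 1) /
    (-A).\<close>
  have A00: "0 \<le> A"
  proof (rule ccontr)
    assume "\<not> 0 \<le> A"
    obtain u :: "real^'d" where u: "norm u = 1" using vector_choose_size[of 1] by auto
    show False using A0[of "((D + 1) / - A) *\<^sub>R u"] \<open>\<not> 0 \<le> A\<close> D0 u by (simp add: divide_simps split: if_splits)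
  qed
  have "\<bar>d 3 t\<bar> = \<bar>(\<integral>w. F (t *\<^sub>R v + w) * herm 3 v w \<partial>gauss 1) - (\<integral>w. F (t *\<^sub>R v) * herm 3 v w \<partial>gauss 1)\<bar>"
    by (simp add: dt gauss_odd_herm3)
  also have "\<dots> = \<bar>\<integral>w. (F (t *\<^sub>R v + w) - F (t *\<^sub>R v)) * herm 3 v w \<partial>gauss 1\<bar>"
    by (subst Bochner_Integration.integral_diff[symmetric, OF i3' i3]) (simp add: left_diff_distrib)
  also have "\<dots> \<le> (\<integral>w. \<bar>(F (t *\<^sub>R v + w) - F (t *\<^sub>R v)) * herm 3 v w\<bar> \<partial>gauss 1)"
    by (rule integral_abs_bound)
  also have "\<dots> \<le> (\<integral>w. (A + D) * norm v ^ 3 * (norm (w::real^'d) ^ 4 + norm w ^ 3 + 3 * (norm w)\<^sup>2 + 3 * norm w) \<partial>gauss 1)"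
  proof (rule Bochner_Integration.integral_mono)
    show "integrable (gauss 1) (\<lambda>w. \<bar>(F (t *\<^sub>R v + w) - F (t *\<^sub>R v)) * herm 3 v w\<bar>)"
      using Bochner_Integration.integrable_diff[OF i3' i3] by (auto simp: left_diff_distrib)
    show "integrable (gauss 1) (\<lambda>w::real^'d. (A + D) * norm v ^ 3 * (norm w ^ 4 + norm w ^ 3 + 3 * (norm w)\<^sup>2 + 3 * norm w))"
      by (simp add: igk igk1)
    fix w :: "real^'d"
    have "\<bar>(F (t *\<^sub>R v + w) - F (t *\<^sub>R v)) * herm 3 v w\<bar> \<le> (A * norm w + D) * (norm v ^ 3 * (norm w ^ 3 + 3 * norm w))"
      unfolding abs_mult by (intro mult_mono mod herm3_le A0) auto
    \<comment> \<open>Adds the nonnegative terms that complete the product (A + D) (1 + norm w)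
      (norm w ^ 3 + 3 norm w).\<close>
    also have "\<dots> \<le> (A * norm w + D) * (norm v ^ 3 * (norm w ^ 3 + 3 * norm w)) +
       norm v ^ 3 * (A * (norm w ^ 3 + 3 * norm w) + D * (norm w ^ 4 + 3 * (norm w)\<^sup>2))"
      using A00 D0 by simp
    also have "\<dots> = (A + D) * norm v ^ 3 * (norm w ^ 4 + norm w ^ 3 + 3 * (norm w)\<^sup>2 + 3 * norm w)"
      by (simp add: algebra_simps eval_nat_numeral)
    finally show "\<bar>(F (t *\<^sub>R v + w) - F (t *\<^sub>R v)) * herm 3 v w\<bar> \<le> \<dots>" .
  qed
  also have "\<dots> = gauss_taylor_const TYPE('d) * (A + D) * norm v ^ 3"
    by (simp add: gauss_taylor_const_def mult_ac)
  finally have "\<bar>d 3 t\<bar> \<le> gauss_taylor_const TYPE('d) * (A + D) * norm v ^ 3" .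
  moreover have "D' k v = d k 0" for k by (simp add: D'_def dt)
  moreover have "(\<integral>z. F (v + z) \<partial>gauss 1) = d 0 1" by (simp add: dt herm_def)
  ultimately show ?thesis using t by simp
qed

section \<open>Lindeberg replacement\<close>

lemma vec_nth_measurable [measurable (raw)]:
  assumes "f \<in> borel_measurable M"
  shows "(\<lambda>x. (f x :: real^'d) $ i) \<in> borel_measurable M"
  by (rule measurable_compose[OF assms]) simp

lemma (in prob_space) integrable_coords_of_moment3:
  fixes f :: "'a \<Rightarrow> real^'d"
  assumes [measurable]: "f \<in> borel_measurable M" and i3: "integrable M (\<lambda>x. norm (f x) ^ 3)"
  shows "integrable M (\<lambda>x. f x $ i)" "integrable M (\<lambda>x. f x $ i * f x $ j)"
proof -
  have i: "integrable M (\<lambda>x. 1 + norm (f x) ^ 3)" using i3 by simp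
  have a: "t \<le> 1 + t ^ 3" "t\<^sup>2 \<le> 1 + t ^ 3" if t: "t \<ge> 0" for t :: real
  proof -
    have "0 \<le> t ^ 3" using t by simp
    moreover have "t\<^sup>2 \<le> 1 \<or> t\<^sup>2 \<le> t ^ 3" "t \<le> 1 \<or> t \<le> t ^ 3"
      using power_le_one[OF t, of 2] power_increasing[of 2 3 t] power_increasing[of 1 3 t]
      by (cases "t \<le> 1"; simp)+
    ultimately show "t\<^sup>2 \<le> 1 + t ^ 3" "t \<le> 1 + t ^ 3" by linarith+
  qed
  show "integrable M (\<lambda>x. f x $ i)"
    by (rule Bochner_Integration.integrable_bound[OF i])
       (auto intro!: order_trans[OF component_le_norm_cart] a(1) AE_I2 simp: abs_of_nonneg)
  have "\<bar>y $ i * y $ j\<bar> \<le> (norm y)\<^sup>2" for y :: "real^'d"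
    unfolding abs_mult power2_eq_square by (intro mult_mono component_le_norm_cart) auto
  then have *: "\<bar>y $ i * y $ j\<bar> \<le> 1 + norm y ^ 3" for y :: "real^'d"
    using a(2)[of "norm y"] by (meson norm_ge_zero order_trans)
  show "integrable M (\<lambda>x. f x $ i * f x $ j)"
    by (rule Bochner_Integration.integrable_bound[OF i]) (use * in \<open>auto intro!: AE_I2\<close>)
qed

definition std_law :: "(real^'d) measure \<Rightarrow> bool" where
  "std_law \<nu> \<longleftrightarrow> prob_space \<nu> \<and> sets \<nu> = sets borel \<and> integrable \<nu> (\<lambda>x. norm x ^ 3)
     \<and> (\<forall>i. (\<integral>x. x $ i \<partial>\<nu>) = 0) \<and> (\<forall>i j. (\<integral>x. x $ i * x $ j \<partial>\<nu>) = (if i = j then 1 else 0))"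

definition moment3 :: "('a::real_normed_vector) measure \<Rightarrow> real" where
  "moment3 \<nu> = (\<integral>x. norm x ^ 3 \<partial>\<nu>)"

lemma std_law_gauss: "std_law (gauss 1)"
  by (auto simp: std_law_def gauss_mean gauss_cov gauss_integrable_norm_power intro: prob_space_gauss)

lemma std_lawD:
  assumes "std_law \<nu>"
  shows "prob_space \<nu>" "sets \<nu> = sets borel" "integrable \<nu> (\<lambda>x. norm x ^ 3)"
    "(\<integral>x. x $ i \<partial>\<nu>) = 0" "(\<integral>x. x $ i * x $ j \<partial>\<nu>) = (if i = j then 1 else 0)"
  using assms by (auto simp: std_law_def)

lemma std_law_integrable:
  assumes "std_law (\<nu> :: (real^'d) measure)"
  shows "integrable \<nu> (\<lambda>x. x $ i)" "integrable \<nu> (\<lambda>x. x $ i * x $ j)"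
proof -
  note [measurable_cong] = std_lawD(2)[OF assms]
  interpret prob_space \<nu> by (rule std_lawD(1)[OF assms])
  show "integrable \<nu> (\<lambda>x. x $ i)" "integrable \<nu> (\<lambda>x. x $ i * x $ j)"
    using integrable_coords_of_moment3[of "\<lambda>x. x", OF _ std_lawD(3)[OF assms]] by simp_all
qed

text \<open>From 3 t^2 \<le> 1 + 2 t^3 for t \<ge> 0 and the second moment d \<ge> 1. It lets
  additive constants be absorbed into the third moment in the Berry--Esseen bound.\<close>

lemma std_law_moment3_ge_1:
  assumes "std_law (\<nu> :: (real^'d) measure)"
  shows "1 \<le> moment3 \<nu>"
proof -
  interpret prob_space \<nu> by (rule std_lawD(1)[OF assms])
  note i = std_law_integrable[OF assms] std_lawD(3)[OF assms]
  have "3 * (\<integral>x. (\<Sum>i\<in>UNIV. x $ i * x $ i) \<partial>\<nu>) \<le> (\<integral>x. 1 + 2 * norm x ^ 3 \<partial>\<nu>)"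
  proof (subst Bochner_Integration.integral_mult_right[symmetric], simp add: i, rule Bochner_Integration.integral_mono)
    fix x :: "real^'d"
    have "0 \<le> (norm x - 1)\<^sup>2 * (2 * norm x + 1)" by simp
    also have "\<dots> = 1 + 2 * norm x ^ 3 - 3 * (norm x)\<^sup>2" by (simp add: algebra_simps eval_nat_numeral)
    also have "(norm x)\<^sup>2 = (\<Sum>i\<in>UNIV. x $ i * x $ i)" unfolding norm_vec_sq by (simp add: power2_eq_square)
    finally show "3 * (\<Sum>i\<in>UNIV. x $ i * x $ i) \<le> 1 + 2 * norm x ^ 3" by simp
  qed (auto simp: i)
  also have "(\<integral>x. 1 + 2 * norm x ^ 3 \<partial>\<nu>) = 1 + 2 * moment3 \<nu>"
    by (subst Bochner_Integration.integral_add) (auto simp: i moment3_def prob_space)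
  also have "(\<integral>x. (\<Sum>i\<in>UNIV. x $ i * x $ i) \<partial>\<nu>) = real CARD('d)"
    by (subst Bochner_Integration.integral_sum) (auto simp: i std_lawD(5)[OF assms])
  finally have "3 * real CARD('d) \<le> 1 + 2 * moment3 \<nu>" .
  moreover have "1 \<le> real CARD('d)" by (simp add: Suc_leI)
  ultimately show ?thesis by linarith
qed

text \<open>Only the form matters: the second-order expansion is a quadratic polynomial in
  \<open>v\<close>, so its integral over a law of \<open>v\<close> depends on the first two moments
  alone.\<close>

lemma gauss_taylor_quadratic:
  fixes F :: "real^'d \<Rightarrow> real"
  assumes [measurable]: "F \<in> borel_measurable borel"
    and F: "\<And>x. 0 \<le> F x" "\<And>x. F x \<le> 1"
  shows "\<exists>c b q. \<forall>v. (\<integral>z. F z * herm 0 v z \<partial>gauss 1) + (\<integral>z. F z * herm 1 v z \<partial>gauss 1)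
      + (\<integral>z. F z * herm 2 v z \<partial>gauss 1) / 2
    = c + (\<Sum>i\<in>UNIV. b i * v $ i) + (\<Sum>i\<in>UNIV. \<Sum>j\<in>UNIV. q i j * (v $ i * v $ j))"
proof -
  interpret prob_space "gauss 1 :: (real^'d) measure" by (rule prob_space_gauss) simp
  have Fle: "\<bar>F x\<bar> \<le> 1" for x using F[of x] by simp
  have iF: "integrable (gauss 1) (\<lambda>z. F z * f z)" if "integrable (gauss 1) f" for f :: "real^'d \<Rightarrow> real"
    by (rule Bochner_Integration.integrable_bound[OF that])
       (use that Fle in \<open>auto simp: abs_mult intro!: AE_I2 mult_left_le_one_le\<close>)
  let ?b = "\<lambda>i. \<integral>z. F z * z $ i \<partial>gauss 1"
  let ?h = "\<lambda>i j (z::real^'d). z $ i * z $ j - (if i = j then 1 else 0)"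
  let ?q = "\<lambda>i j. (\<integral>z. F z * ?h i j z \<partial>gauss 1)"
  have ih: "integrable (gauss 1) (?h i j)" for i j by simp
  have h1: "herm 1 v z = (\<Sum>i\<in>UNIV. v $ i * z $ i)" for v z :: "real^'d"
    by (simp add: herm_def inner_vec_def mult.commute)
  have h2: "herm 2 v z = (\<Sum>i\<in>UNIV. \<Sum>j\<in>UNIV. (v $ i * v $ j) * ?h i j z)" for v z :: "real^'d"
  proof -
    have "(z \<bullet> v)\<^sup>2 = (\<Sum>i\<in>UNIV. \<Sum>j\<in>UNIV. (v $ i * v $ j) * (z $ i * z $ j))"
      by (simp add: inner_vec_def power2_eq_square sum_product mult_ac)
    moreover have "(norm v)\<^sup>2 = (\<Sum>i\<in>UNIV. \<Sum>j\<in>UNIV. (v $ i * v $ j) * (if i = j then 1 else 0))"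
      unfolding norm_vec_sq by (simp add: power2_eq_square sum.delta' if_distrib cong: if_cong)
    moreover have "herm 2 v z = (z \<bullet> v)\<^sup>2 - (norm v)\<^sup>2" by (simp add: herm_def)
    ultimately show ?thesis
      by (simp only: right_diff_distrib sum_subtractf)
  qed
  have 1: "(\<integral>z. F z * herm 1 v z \<partial>gauss 1) = (\<Sum>i\<in>UNIV. ?b i * v $ i)" for v :: "real^'d"
  proof -
    have "(\<integral>z. F z * herm 1 v z \<partial>gauss 1) = (\<integral>z. (\<Sum>i\<in>UNIV. v $ i * (F z * z $ i)) \<partial>gauss 1)"
      by (intro Bochner_Integration.integral_cong refl) (simp only: h1 sum_distrib_left mult.left_commute)
    also have "\<dots> = (\<Sum>i\<in>UNIV. v $ i * ?b i)"
      by (subst Bochner_Integration.integral_sum) (simp_all add: iF)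
    finally show ?thesis by (simp add: mult.commute)
  qed
  have 2: "(\<integral>z. F z * herm 2 v z \<partial>gauss 1) = (\<Sum>i\<in>UNIV. \<Sum>j\<in>UNIV. ?q i j * (v $ i * v $ j))" for v :: "real^'d"
  proof -
    have "(\<integral>z. F z * herm 2 v z \<partial>gauss 1) = (\<integral>z. (\<Sum>i\<in>UNIV. \<Sum>j\<in>UNIV. (v $ i * v $ j) * (F z * ?h i j z)) \<partial>gauss 1)"
      by (intro Bochner_Integration.integral_cong refl) (simp only: h2 sum_distrib_left mult.left_commute)
    also have "\<dots> = (\<Sum>i\<in>UNIV. \<integral>z. (\<Sum>j\<in>UNIV. (v $ i * v $ j) * (F z * ?h i j z)) \<partial>gauss 1)"
      by (rule Bochner_Integration.integral_sum) (intro Bochner_Integration.integrable_sum integrable_mult_right iF ih)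
    also have "\<dots> = (\<Sum>i\<in>UNIV. \<Sum>j\<in>UNIV. (v $ i * v $ j) * ?q i j)"
    proof (rule sum.cong[OF refl])
      fix i
      have "(\<integral>z. (\<Sum>j\<in>UNIV. (v $ i * v $ j) * (F z * ?h i j z)) \<partial>gauss 1) = (\<Sum>j\<in>UNIV. \<integral>z. (v $ i * v $ j) * (F z * ?h i j z) \<partial>gauss 1)"
        by (rule Bochner_Integration.integral_sum) (intro integrable_mult_right iF ih)
      also have "\<dots> = (\<Sum>j\<in>UNIV. (v $ i * v $ j) * ?q i j)"
        by (intro sum.cong refl Bochner_Integration.integral_mult_right_zero)
      finally show "(\<integral>z. (\<Sum>j\<in>UNIV. (v $ i * v $ j) * (F z * ?h i j z)) \<partial>gauss 1) = \<dots>" .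
    qed
    finally show ?thesis by (simp add: mult.commute)
  qed
  show ?thesis
  proof (rule exI[of _ "\<integral>z. F z \<partial>gauss 1"], rule exI[of _ ?b], rule exI[of _ "\<lambda>i j. ?q i j / 2"], rule allI)
    fix v
    have "(\<integral>z. F z * herm 0 v z \<partial>gauss 1) = (\<integral>z. F z \<partial>gauss 1)" by (simp add: herm_def)
    then show "(\<integral>z. F z * herm 0 v z \<partial>gauss 1) + (\<integral>z. F z * herm 1 v z \<partial>gauss 1) + (\<integral>z. F z * herm 2 v z \<partial>gauss 1) / 2
      = (\<integral>z. F z \<partial>gauss 1) + (\<Sum>i\<in>UNIV. ?b i * v $ i) + (\<Sum>i\<in>UNIV. \<Sum>j\<in>UNIV. ?q i j / 2 * (v $ i * v $ j))"
      by (simp only: 1 2 sum_divide_distrib times_divide_eq_left)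
  qed
qed

text \<open>The number m is common to all standardised laws, because the quadratic part of the
  expansion integrates to the same value for each of them. Comparing two such laws is then a
  triangle inequality through m.\<close>

lemma lindeberg_step1:
  fixes F :: "real^'d \<Rightarrow> real"
  assumes [measurable]: "F \<in> borel_measurable borel"
    and F: "\<And>x. 0 \<le> F x" "\<And>x. F x \<le> 1"
    and mod: "\<And>a w. \<bar>F (a + w) - F a\<bar> \<le> A * norm w + D"
    and s: "s > 0"
  shows "\<exists>m. \<forall>\<nu>. std_law \<nu> \<longrightarrow> \<bar>(\<integral>x. \<integral>z. F (x + z) \<partial>gauss s \<partial>\<nu>) - m\<bar>
     \<le> gauss_taylor_const TYPE('d) * (A * sqrt s + D) * moment3 \<nu> / sqrt s ^ 3"
proof -
  interpret g: prob_space "gauss s :: (real^'d) measure" by (rule prob_space_gauss) (rule s)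
  let ?Fs = "\<lambda>z. F (sqrt s *\<^sub>R z)" and ?C = "gauss_taylor_const TYPE('d) * (A * sqrt s + D)"
  obtain c b q where cbq: "\<And>v. (\<integral>z. ?Fs z * herm 0 v z \<partial>gauss 1) + (\<integral>z. ?Fs z * herm 1 v z \<partial>gauss 1)
      + (\<integral>z. ?Fs z * herm 2 v z \<partial>gauss 1) / 2
    = c + (\<Sum>i\<in>UNIV. b i * v $ i) + (\<Sum>i\<in>UNIV. \<Sum>j\<in>UNIV. q i j * (v $ i * v $ j))"
    using gauss_taylor_quadratic[of ?Fs] F by auto
  define P where "P v = c + (\<Sum>i\<in>UNIV. b i * v $ i) + (\<Sum>i\<in>UNIV. \<Sum>j\<in>UNIV. q i j * (v $ i * v $ j))" for v
  let ?H = "\<lambda>x. \<integral>z. F (x + z) \<partial>gauss s"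
  have tay: "\<bar>?H x - P (x /\<^sub>R sqrt s)\<bar> \<le> ?C / sqrt s ^ 3 * norm x ^ 3" for x
  proof -
    have "?H x = (\<integral>z. F (x + sqrt s *\<^sub>R z) \<partial>gauss 1)"
      by (subst gauss_scale[OF s, symmetric], subst integral_distr) auto
    also have "\<dots> = (\<integral>z. ?Fs (x /\<^sub>R sqrt s + z) \<partial>gauss 1)" using s by (simp add: scaleR_right_distrib)
    finally have H: "?H x = \<dots>" .
    have "\<bar>?Fs (a + w) - ?Fs a\<bar> \<le> (A * sqrt s) * norm w + D" for a w
      using mod[of "sqrt s *\<^sub>R a" "sqrt s *\<^sub>R w"] s by (simp add: scaleR_right_distrib mult.assoc)
    from gauss_taylor_line[of ?Fs, OF _ _ _ this, of "x /\<^sub>R sqrt s"] F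
    have "\<bar>?H x - P (x /\<^sub>R sqrt s)\<bar> \<le> ?C * norm (x /\<^sub>R sqrt s) ^ 3"
      unfolding H P_def cbq by simp
    then show ?thesis using s by (simp add: divide_simps power_mult_distrib)
  qed
  \<comment> \<open>The quadratic polynomial at x / sqrt s, integrated with mean 0 and identity
    covariance: the linear part vanishes and the trace of q survives.\<close>
  define m where "m = c + (\<Sum>i\<in>UNIV. q i i) / s"
  have "\<bar>(\<integral>x. ?H x \<partial>\<nu>) - m\<bar> \<le> ?C * moment3 \<nu> / sqrt s ^ 3" if \<nu>: "std_law \<nu>" for \<nu>
  proof -
    interpret prob_space \<nu> by (rule std_lawD(1)[OF \<nu>])
    note [measurable_cong] = std_lawD(2)[OF \<nu>]
    note i = std_law_integrable[OF \<nu>] std_lawD(3)[OF \<nu>]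
    have iH: "integrable \<nu> ?H"
    proof (rule integrable_const_bound[where B=1])
      have "\<bar>?H x\<bar> \<le> 1" for x
      proof -
        have "\<bar>?H x\<bar> \<le> (\<integral>z. \<bar>F (x + z)\<bar> \<partial>gauss s)" by (rule integral_abs_bound)
        also have "\<dots> \<le> (\<integral>z. 1 \<partial>(gauss s :: (real^'d) measure))"
          using F by (intro integral_mono') (auto simp: g.integrable_const)
        finally show ?thesis using g.prob_space by simp
      qed
      then show "AE x in \<nu>. norm (?H x) \<le> 1" by simp
    qed measurable
    have Ps: "P (x /\<^sub>R sqrt s) = c + (\<Sum>i\<in>UNIV. b i / sqrt s * x $ i) + (\<Sum>i\<in>UNIV. \<Sum>j\<in>UNIV. q i j / s * (x $ i * x $ j))" for x
    proof -
      have "b i * (x /\<^sub>R sqrt s) $ i = b i / sqrt s * x $ i" for i by (simp add: divide_inverse)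
      moreover have "q i j * ((x /\<^sub>R sqrt s) $ i * (x /\<^sub>R sqrt s) $ j) = q i j / s * (x $ i * x $ j)" for i j
        using s by (simp add: divide_simps)
      ultimately show ?thesis by (simp only: P_def)
    qed
    have iP: "integrable \<nu> (\<lambda>x. P (x /\<^sub>R sqrt s))"
      unfolding Ps by (intro Bochner_Integration.integrable_add Bochner_Integration.integrable_sum integrable_mult_right i integrable_const)
    have "(\<integral>x. P (x /\<^sub>R sqrt s) \<partial>\<nu>) = c + (\<Sum>i\<in>UNIV. b i / sqrt s * (\<integral>x. x $ i \<partial>\<nu>)) + (\<Sum>i\<in>UNIV. \<Sum>j\<in>UNIV. q i j / s * (\<integral>x. x $ i * x $ j \<partial>\<nu>))"
      unfolding Ps by (simp add: i prob_space)
    also have "\<dots> = m"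
      by (simp add: std_lawD(4,5)[OF \<nu>] m_def sum_divide_distrib if_distrib sum.delta' cong: if_cong)
    finally have Pm: "(\<integral>x. P (x /\<^sub>R sqrt s) \<partial>\<nu>) = m" .
    have "\<bar>(\<integral>x. ?H x \<partial>\<nu>) - m\<bar> = \<bar>\<integral>x. ?H x - P (x /\<^sub>R sqrt s) \<partial>\<nu>\<bar>"
      by (simp add: Pm[symmetric] iH iP)
    also have "\<dots> \<le> (\<integral>x. \<bar>?H x - P (x /\<^sub>R sqrt s)\<bar> \<partial>\<nu>)" by (rule integral_abs_bound)
    also have "\<dots> \<le> (\<integral>x. ?C / sqrt s ^ 3 * norm x ^ 3 \<partial>\<nu>)"
      by (rule Bochner_Integration.integral_mono[OF _ _ tay]) (auto simp: iH iP i)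
    also have "\<dots> = ?C * moment3 \<nu> / sqrt s ^ 3" by (simp add: moment3_def)
    finally show ?thesis .
  qed
  then show ?thesis by blast
qed

lemma lindeberg_step:
  fixes F :: "real^'d \<Rightarrow> real"
  assumes "F \<in> borel_measurable borel" "\<And>x. 0 \<le> F x" "\<And>x. F x \<le> 1"
    and "\<And>a w. \<bar>F (a + w) - F a\<bar> \<le> A * norm w + D"
    and "s > 0" and \<nu>: "std_law \<nu>"
  shows "\<bar>(\<integral>x. \<integral>z. F (x + z) \<partial>gauss s \<partial>\<nu>) - (\<integral>x. \<integral>z. F (x + z) \<partial>gauss s \<partial>gauss 1)\<bar>
     \<le> gauss_taylor_const TYPE('d) * (moment3 \<nu> + moment3 (gauss 1 :: (real^'d) measure)) * ((A * sqrt s + D) / sqrt s ^ 3)"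
proof -
  let ?b = "\<lambda>\<nu>. gauss_taylor_const TYPE('d) * (A * sqrt s + D) * moment3 (\<nu> :: (real^'d) measure) / sqrt s ^ 3"
  obtain m where "\<And>\<nu>. std_law \<nu> \<Longrightarrow> \<bar>(\<integral>x. \<integral>z. F (x + z) \<partial>gauss s \<partial>\<nu>) - m\<bar> \<le> ?b \<nu>"
    using lindeberg_step1[OF assms(1-5)] by blast
  from this[OF \<nu>] this[OF std_law_gauss]
  have "\<bar>(\<integral>x. \<integral>z. F (x + z) \<partial>gauss s \<partial>\<nu>) - (\<integral>x. \<integral>z. F (x + z) \<partial>gauss s \<partial>gauss 1)\<bar> \<le> ?b \<nu> + ?b (gauss 1)"
    by linarith
  also have "\<dots> = gauss_taylor_const TYPE('d) * (moment3 \<nu> + moment3 (gauss 1 :: (real^'d) measure)) * ((A * sqrt s + D) / sqrt s ^ 3)"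
    by (simp add: algebra_simps add_divide_distrib)
  finally show ?thesis .
qed

section \<open>Smoothing over convex sets\<close>

text \<open>Open balls are used here and in \<open>erode\<close>, so that the enlarged set is open
  and the eroded one closed, hence both Borel, for an arbitrary set.\<close>

definition neigh :: "real \<Rightarrow> 'a::euclidean_space set \<Rightarrow> 'a set" where
  "neigh r B = (\<Union>x\<in>B. ball x r)"

definition erode :: "real \<Rightarrow> 'a::euclidean_space set \<Rightarrow> 'a set" where
  "erode r B = {x. ball x r \<subseteq> B}"

lemma neigh_measurable [measurable]: "neigh r B \<in> sets borel"
  unfolding neigh_def by (intro borel_open) auto

lemma neigh_convex: assumes "convex B" shows "convex (neigh r B)"
proof -
  have "neigh r B = (\<Union>x\<in>B. \<Union>y\<in>ball 0 r. {x + y})"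
    unfolding neigh_def by (auto simp: dist_norm) (metis add_diff_cancel_left' diff_add_cancel add.commute norm_minus_commute mem_ball_0)
  then show ?thesis using convex_sums[OF assms convex_ball[of 0 r]] by simp
qed

lemma erode_eq: "erode r B = - (\<Union>p\<in>-B. ball p r)"
  unfolding erode_def by (auto simp: subset_iff dist_commute)

lemma erode_measurable [measurable]: "erode r B \<in> sets borel"
  unfolding erode_eq by (intro borel_closed) (auto intro!: closed_Compl)

lemma erode_convex: assumes "convex B" shows "convex (erode r B)"
  unfolding convex_alt erode_def
proof safe
  fix x y z u assume h: "ball x r \<subseteq> B" "ball y r \<subseteq> B" "0 \<le> u" "u \<le> (1::real)"
    and z: "z \<in> ball ((1 - u) *\<^sub>R x + u *\<^sub>R y) r"
  define d where "d = z - ((1 - u) *\<^sub>R x + u *\<^sub>R y)"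
  have "norm d < r" using z by (simp add: d_def dist_norm norm_minus_commute)
  then have "x + d \<in> B" "y + d \<in> B" using h by (auto simp: subset_iff dist_norm)
  then have "(1 - u) *\<^sub>R (x + d) + u *\<^sub>R (y + d) \<in> B"
    using assms h by (simp add: convex_alt)
  then show "z \<in> B" by (simp add: d_def algebra_simps)
qed

lemma neigh_mono: "B \<subseteq> neigh r B" if "r > 0"
  using that unfolding neigh_def by force

text \<open>Finitely many directions that do not depend on the convex set: a union bound over them
  is affordable, whereas the normal directions of the boundary form a continuum.\<close>

definition push_dirs :: "real \<Rightarrow> (real^'d) set" where
  "push_dirs t = (\<lambda>(i, e). (e * t) *\<^sub>R axis i 1) ` (UNIV \<times> {-1, 1})"

text \<open>A point outside a convex set can be pushed, together with a ball around it, away from the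
  set along one of the coordinate directions: the one in which a separating functional is largest.\<close>
lemma convex_push_away:
  fixes B :: "(real^'d) set" and r :: real
  assumes "convex B" "p \<notin> B" "r > 0"
  shows "\<exists>h\<in>push_dirs (r * CARD('d)). \<forall>x\<in>ball p r. x + h \<notin> B"
proof (cases "B = {}")
  case True
  then show ?thesis by (auto simp: push_dirs_def)
next
  case False
  obtain a b where a: "a \<noteq> 0" and ab: "\<And>x. x \<in> B \<Longrightarrow> a \<bullet> x \<le> b" "a \<bullet> p \<ge> b"
    using separating_hyperplane_sets[of B "{p}"] assms False by auto
  obtain i where i: "\<And>j. \<bar>a $ j\<bar> \<le> \<bar>a $ i\<bar>"
  proof -
    have "Max (range (\<lambda>j. \<bar>a $ j\<bar>)) \<in> range (\<lambda>j. \<bar>a $ j\<bar>)" by (rule Max_in) auto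
    then obtain i where "Max (range (\<lambda>j. \<bar>a $ j\<bar>)) = \<bar>a $ i\<bar>" by (rule imageE)
    then have "\<bar>a $ j\<bar> \<le> \<bar>a $ i\<bar>" for j by (metis Max_ge finite finite_imageI rangeI)
    then show ?thesis using that by blast
  qed
  \<comment> \<open>By the l1 bound, a push of length r d along the dominant coordinate raises the
    functional by at least r norm a. A displacement shorter than r cannot undo that, which explains
    the factor CARD('d) in \<open>push_dirs\<close>.\<close>
  have na: "norm a \<le> CARD('d) * \<bar>a $ i\<bar>"
    using norm_le_l1_cart[of a] sum_bounded_above[of UNIV "\<lambda>j. \<bar>a $ j\<bar>" "\<bar>a $ i\<bar>"] i by force
  define h :: "real^'d" where "h = ((if a $ i \<ge> 0 then 1 else -1) * (r * CARD('d))) *\<^sub>R axis i 1"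
  have ah: "a \<bullet> h = r * (CARD('d) * \<bar>a $ i\<bar>)"
    by (simp add: h_def inner_axis)
  have "x + h \<notin> B" if "x \<in> ball p r" for x
  proof
    assume "x + h \<in> B"
    then have "a \<bullet> (x + h) \<le> a \<bullet> p" using ab by fastforce
    then have "r * norm a \<le> a \<bullet> (p - x)" 
    proof -
      have "r * norm a \<le> r * (CARD('d) * \<bar>a $ i\<bar>)" using na \<open>r > 0\<close> by (intro mult_left_mono) auto
      with \<open>a \<bullet> (x + h) \<le> a \<bullet> p\<close> show ?thesis unfolding inner_add_right inner_diff_right ah by linarith
    qed
    also have "\<dots> \<le> norm a * norm (p - x)" by (rule norm_cauchy_schwarz)
    also have "\<dots> < norm a * r" using that a by (simp add: dist_norm)
    finally show False by simp
  qed
  moreover have "h \<in> push_dirs (r * CARD('d))"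
    by (auto simp: push_dirs_def h_def image_def)
  ultimately show ?thesis by blast
qed

lemma finite_push_dirs [simp]: "finite (push_dirs t)" by (simp add: push_dirs_def)

lemma card_push_dirs: "card (push_dirs t :: (real^'d) set) \<le> 2 * CARD('d)"
  unfolding push_dirs_def by (rule order_trans[OF card_image_le]) (simp_all add: card_cartesian_product)

lemma norm_push_dirs: "h \<in> push_dirs t \<Longrightarrow> norm h = \<bar>t\<bar>"
  by (auto simp: push_dirs_def norm_axis_1)

text \<open>Union bound over the 2 d directions, each being a shift of length r d handled by
  \<open>gauss_convex_shift\<close>; this is the origin of the factor d squared.\<close>

lemma gauss_push_bound:
  fixes C :: "(real^'d) set" and r :: real
  assumes C: "convex C" and [measurable]: "C \<in> sets borel" "D \<in> sets borel" and s: "s > 0" and r: "r > 0"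
    and D: "\<And>x. x \<in> D \<Longrightarrow> x \<in> C" "\<And>x. x \<in> D \<Longrightarrow> \<exists>h\<in>push_dirs (r * CARD('d)). x + h \<notin> C"
  shows "measure (gauss s) D \<le> 2 * exp (1/2) * (CARD('d))\<^sup>2 * r / sqrt s"
proof -
  interpret prob_space "gauss s :: (real^'d) measure" by (rule prob_space_gauss) (rule s)
  let ?H = "push_dirs (r * CARD('d)) :: (real^'d) set"
  have "measure (gauss s) D \<le> measure (gauss s) (\<Union>h\<in>?H. {x\<in>C. x + h \<notin> C})"
    using D by (intro finite_measure_mono) auto
  also have "\<dots> \<le> (\<Sum>h\<in>?H. measure (gauss s) {x\<in>C. x + h \<notin> C})"
    by (intro finite_measure_subadditive_finite) auto
  also have "\<dots> \<le> (\<Sum>h\<in>?H. exp (1/2) * (r * CARD('d)) / sqrt s)"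
  proof (rule sum_mono)
    fix h :: "real^'d" assume "h \<in> ?H"
    then have "norm h = \<bar>r * CARD('d)\<bar>" by (rule norm_push_dirs)
    then have "norm h = r * CARD('d)" using r by simp
    then show "measure (gauss s) {x\<in>C. x + h \<notin> C} \<le> exp (1/2) * (r * CARD('d)) / sqrt s"
      using gauss_convex_shift[OF C assms(2) s, of h] by simp
  qed
  also have "\<dots> = real (card ?H) * (exp (1/2) * (r * CARD('d)) / sqrt s)" by simp
  also have "\<dots> \<le> real (2 * CARD('d)) * (exp (1/2) * (r * CARD('d)) / sqrt s)"
    using card_push_dirs r s by (intro mult_right_mono) (auto simp: of_nat_mono simp del: of_nat_mult)
  finally show ?thesis by (simp add: power2_eq_square mult_ac)
qed

text \<open>A push that takes the whole ball of radius r around x off B takes x itself off the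
  r-neighbourhood. The shell is thus covered by shift layers of the convex set
  \<open>neigh r B\<close>; for \<open>gauss_erode\<close> the layers of B itself do the
  same.\<close>

lemma gauss_neigh:
  fixes B :: "(real^'d) set" and r :: real
  assumes B: "convex B" and [measurable]: "B \<in> sets borel" and s: "s > 0" and r: "r > 0"
  shows "measure (gauss s) (neigh r B - B) \<le> 2 * exp (1/2) * (CARD('d))\<^sup>2 * r / sqrt s"
proof (rule gauss_push_bound[OF neigh_convex[OF B, of r] _ _ s r])
  fix x assume x: "x \<in> neigh r B - B"
  then obtain h where h: "h \<in> push_dirs (r * CARD('d))" "\<forall>y\<in>ball x r. y + h \<notin> B"
    using convex_push_away[OF B, of x r] r by auto
  have "x + h \<notin> neigh r B"
  proof
    assume "x + h \<in> neigh r B"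
    then obtain b where b: "b \<in> B" "dist b (x + h) < r" by (auto simp: neigh_def)
    then have "b - h \<in> ball x r" by (simp add: dist_norm norm_minus_commute algebra_simps)
    with h b show False by force
  qed
  with h show "\<exists>h\<in>push_dirs (r * CARD('d)). x + h \<notin> neigh r B" by blast
qed auto

lemma gauss_erode:
  fixes B :: "(real^'d) set" and r :: real
  assumes B: "convex B" and [measurable]: "B \<in> sets borel" and s: "s > 0" and r: "r > 0"
  shows "measure (gauss s) (B - erode r B) \<le> 2 * exp (1/2) * (CARD('d))\<^sup>2 * r / sqrt s"
proof (rule gauss_push_bound[OF B _ _ s r])
  fix x assume "x \<in> B - erode r B"
  then obtain p where "p \<notin> B" "x \<in> ball p r" by (auto simp: erode_eq)
  then show "\<exists>h\<in>push_dirs (r * CARD('d)). x + h \<notin> B"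
    using convex_push_away[OF B _ r] by blast
qed auto

section \<open>Convolution of laws, and removing the smoothing on convex sets\<close>

lemma integral_convolution:
  fixes F :: "'a::ordered_euclidean_space \<Rightarrow> real"
  assumes \<mu>: "prob_space \<mu>" "sets \<mu> = sets borel" and \<nu>: "prob_space \<nu>" "sets \<nu> = sets borel"
    and [measurable]: "F \<in> borel_measurable borel" and F: "\<And>x. \<bar>F x\<bar> \<le> K"
  shows "(\<integral>x. F x \<partial>(\<mu> \<star> \<nu>)) = (\<integral>x. \<integral>y. F (x + y) \<partial>\<nu> \<partial>\<mu>)"
proof -
  note [measurable_cong] = \<mu>(2) \<nu>(2)
  interpret \<mu>: prob_space \<mu> by fact
  interpret \<nu>: prob_space \<nu> by fact
  interpret pair_prob_space \<mu> \<nu> ..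
  have i: "integrable (\<mu> \<Otimes>\<^sub>M \<nu>) (\<lambda>(x, y). F (x + y))"
    by (rule P.integrable_const_bound[where B=K]) (auto simp: F)
  show ?thesis
    unfolding convolution_def using integral_fst'[OF i] by (subst integral_distr) (auto simp: split_beta')
qed

lemma prob_space_convolution:
  assumes \<mu>: "prob_space \<mu>" "sets \<mu> = sets borel" and \<nu>: "prob_space \<nu>" "sets \<nu> = sets borel"
  shows "prob_space (\<mu> \<star> \<nu>)"
proof -
  note [measurable_cong] = \<mu>(2) \<nu>(2)
  interpret \<mu>: prob_space \<mu> by fact
  interpret \<nu>: prob_space \<nu> by fact
  interpret pair_prob_space \<mu> \<nu> ..
  show ?thesis unfolding convolution_def by (rule P.prob_space_distr) measurable
qed

lemma measure_shift_measurable: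
  fixes \<mu> :: "'a::ordered_euclidean_space measure"
  assumes "prob_space \<mu>" and [measurable_cong]: "sets \<mu> = sets borel" and [measurable]: "B \<in> sets borel"
  shows "(\<lambda>w. measure \<mu> {u. u + w \<in> B}) \<in> borel_measurable borel"
proof -
  interpret prob_space \<mu> by fact
  have "(\<lambda>w. measure \<mu> {u. u + w \<in> B}) = (\<lambda>w. \<integral>u. indicator B (u + w) \<partial>\<mu>)"
  proof
    fix w
    have "{u. u + w \<in> B} \<in> sets \<mu>" using measurable_sets[of "\<lambda>u. u + w" \<mu> borel B] sets_eq_imp_space_eq[OF assms(2)]
      by (simp add: vimage_def)
    then have "measure \<mu> {u. u + w \<in> B} = (\<integral>u. indicator {u. u + w \<in> B} u \<partial>\<mu>)" by simp
    then show "measure \<mu> {u. u + w \<in> B} = (\<integral>u. indicator B (u + w) \<partial>\<mu>)" by (simp add: indicator_def)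
  qed
  also have "\<dots> \<in> borel_measurable borel" by measurable
  finally show ?thesis .
qed

lemma measure_convolution:
  fixes \<mu> :: "'a::ordered_euclidean_space measure"
  assumes \<mu>: "prob_space \<mu>" "sets \<mu> = sets borel" and \<nu>: "prob_space \<nu>" "sets \<nu> = sets borel"
    and [measurable]: "B \<in> sets borel"
  shows "measure (\<mu> \<star> \<nu>) B = (\<integral>w. measure \<mu> {u. u + w \<in> B} \<partial>\<nu>)"
proof -
  note [measurable_cong] = \<mu>(2) \<nu>(2)
  have ms: "{u. u + w \<in> B} \<in> sets \<mu>" for w
    using measurable_sets[of "\<lambda>u. u + w" \<mu> borel B] sets_eq_imp_space_eq[OF \<mu>(2)] by (simp add: vimage_def)
  have "measure (\<mu> \<star> \<nu>) B = measure (\<nu> \<star> \<mu>) B"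
    using \<mu> \<nu> by (subst convolution_commutative) (auto simp: prob_space.finite_measure)
  also have "\<dots> = (\<integral>x. indicator B x \<partial>(\<nu> \<star> \<mu>))" by simp
  also have "\<dots> = (\<integral>w. \<integral>u. indicator B (w + u) \<partial>\<mu> \<partial>\<nu>)"
    by (rule integral_convolution[OF \<nu> \<mu>, where K=1]) (auto simp: indicator_def)
  also have "\<dots> = (\<integral>w. measure \<mu> {u. u + w \<in> B} \<partial>\<nu>)"
  proof (rule Bochner_Integration.integral_cong[OF refl])
    fix w
    have "measure \<mu> {u. u + w \<in> B} = (\<integral>u. indicator {u. u + w \<in> B} u \<partial>\<mu>)" using ms by simp
    then show "(\<integral>u. indicator B (w + u) \<partial>\<mu>) = measure \<mu> {u. u + w \<in> B}" by (simp add: indicator_def add.commute)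
  qed
  finally show ?thesis .
qed

definition convex_close :: "(real^'d) measure \<Rightarrow> (real^'d) measure \<Rightarrow> real \<Rightarrow> bool" where
  "convex_close \<mu> \<nu> \<delta> \<longleftrightarrow> (\<forall>B. convex B \<and> B \<in> sets borel \<longrightarrow> \<bar>measure \<mu> B - measure \<nu> B\<bar> \<le> \<delta>)"

lemma convex_shift_set:
  fixes B :: "'a::euclidean_space set"
  assumes "convex B" "B \<in> sets borel"
  shows "convex {u. u + y \<in> B}" "{u. u + y \<in> B} \<in> sets borel"
proof -
  have "{u. u + y \<in> B} = (\<lambda>b. b - y) ` B" by (force simp: image_def)
  then show "convex {u. u + y \<in> B}" using assms by (simp add: convex_translation_subtract)
  show "{u. u + y \<in> B} \<in> sets borel"
    using measurable_sets_borel[of "\<lambda>u. u + y" borel B] assms by (simp add: vimage_def)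
qed

text \<open>If the two laws differ by x on B, the enlarged (or eroded) set retains the difference x
  - b under every shift shorter than r. Averaging over K keeps it with weight at least 3/4, and the
  remaining weight loses at most \<delta> per unit, so 3/4 (x - b) - 1/4 \<delta> \<le> e.\<close>

lemma smoothing_step:
  fixes \<mu> :: "(real^'d) measure"
  assumes \<mu>: "prob_space \<mu>" "sets \<mu> = sets borel" and g: "prob_space g" "sets g = sets borel"
    and K: "prob_space K" "sets K = sets borel" "measure K (ball 0 r) \<ge> 3/4" and r: "r > 0"
    and e: "convex_close (\<mu> \<star> K) (g \<star> K) e"
    and bn: "\<And>B. convex B \<Longrightarrow> B \<in> sets borel \<Longrightarrow> measure g (neigh (2 * r) B - B) \<le> b"
    and be: "\<And>B. convex B \<Longrightarrow> B \<in> sets borel \<Longrightarrow> measure g (B - erode (2 * r) B) \<le> b"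
    and d: "convex_close \<mu> g \<delta>"
  shows "convex_close \<mu> g (b + 4/3 * e + \<delta> / 3)"
proof -
  note [measurable_cong] = \<mu>(2) g(2) K(2)
  note [simp] = \<mu>(2) g(2) K(2)
  interpret \<mu>: prob_space \<mu> by fact
  interpret g: prob_space g by fact
  interpret K: prob_space K by fact
  have d0: "\<delta> \<ge> 0" using d[unfolded convex_close_def, rule_format, of "{}"] by simp
  have e0: "e \<ge> 0" using e[unfolded convex_close_def, rule_format, of "{}"] by simp
  have b0: "b \<ge> 0" using bn[of "{}"] by (simp add: neigh_def)
  note [measurable] = measure_shift_measurable[OF \<mu>] measure_shift_measurable[OF g]
  \<comment> \<open>The sign \<sigma> treats both directions together: an excess of
    \<open>\<mu>\<close> is tested on the enlarged set with \<sigma> = 1, an excess of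
    \<open>g\<close> on the eroded set with \<sigma> = -1.\<close>
  have main: "x \<le> b + 4/3 * e + \<delta> / 3"
    if C: "convex C" "C \<in> sets borel" and \<sigma>: "\<bar>\<sigma>\<bar> = 1"
      and le: "\<And>y. norm y < r \<Longrightarrow> x - b \<le> \<sigma> * (measure \<mu> {u. u + y \<in> C} - measure g {u. u + y \<in> C})" for C \<sigma> x
  proof (cases "x - b \<le> 0")
    case True then show ?thesis using d0 e0 by simp
  next
    case False
    note [measurable] = C(2)
    let ?f = "\<lambda>y. measure \<mu> {u. u + y \<in> C} - measure g {u. u + y \<in> C}"
    have i: "integrable K (\<lambda>y. measure \<mu> {u. u + y \<in> C})" "integrable K (\<lambda>y. measure g {u. u + y \<in> C})"
      by (rule K.integrable_const_bound[where B=1]; simp)+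
    have [measurable]: "ball 0 r \<in> sets K" by simp
    have ind: "integrable K (indicator (ball 0 r) :: real^'d \<Rightarrow> real)"
      by (rule K.integrable_const_bound[where B=1]) (simp_all add: indicator_le_1)
    \<comment> \<open>Replacing the mass of the ball by its lower bound 3/4 is monotone only because
      x - b is positive in this case.\<close>
    have "(3/4) * (x - b) - (1/4) * \<delta> \<le> measure K (ball 0 r) * (x - b) - (1 - measure K (ball 0 r)) * \<delta>"
      using K(3) False d0 by (intro diff_mono mult_right_mono) auto
    also have "\<dots> = (\<integral>y. indicator (ball 0 r) y * (x - b) - (1 - indicator (ball 0 r) y) * \<delta> \<partial>K)"
    proof -
      have "(\<integral>y. indicator (ball 0 r) y * (x - b) - (1 - indicator (ball 0 r) y) * \<delta> \<partial>K)
        = (\<integral>y. (x - b + \<delta>) * indicator (ball 0 r) y - \<delta> \<partial>K)" by (simp add: algebra_simps)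
      also have "\<dots> = (x - b + \<delta>) * measure K (ball 0 r) - \<delta>"
      proof -
        have sp: "space K = UNIV" using sets_eq_imp_space_eq[OF K(2)] by simp
        have "(\<integral>y. (x - b + \<delta>) * indicator (ball 0 r) y - \<delta> \<partial>K) = (\<integral>y. (x - b + \<delta>) * indicator (ball 0 r) y \<partial>K) - (\<integral>y. \<delta> \<partial>K)"
          by (intro Bochner_Integration.integral_diff integrable_mult_right ind) auto
        then show ?thesis
          using K.prob_space by (simp add: sp)
      qed
      finally have I: "(\<integral>y. indicator (ball 0 r) y * (x - b) - (1 - indicator (ball 0 r) y) * \<delta> \<partial>K)
        = (x - b + \<delta>) * measure K (ball 0 r) - \<delta>" .
      show ?thesis unfolding I by (simp add: algebra_simps)
    qed
    also have "\<dots> \<le> (\<integral>y. \<sigma> * ?f y \<partial>K)"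
    proof (rule Bochner_Integration.integral_mono)
      fix y
      have "\<bar>\<sigma> * ?f y\<bar> \<le> \<delta>"
        using d convex_shift_set[OF C, of y] \<sigma> by (simp add: convex_close_def abs_mult)
      then show "indicator (ball 0 r) y * (x - b) - (1 - indicator (ball 0 r) y) * \<delta> \<le> \<sigma> * ?f y"
        using le[of y] by (auto simp: indicator_def abs_le_iff)
    qed (intro Bochner_Integration.integrable_diff integrable_mult_right integrable_mult_left ind i K.integrable_const)+
    also have "\<dots> = \<sigma> * (\<integral>y. ?f y \<partial>K)" by simp
    also have "(\<integral>y. ?f y \<partial>K) = measure (\<mu> \<star> K) C - measure (g \<star> K) C"
      unfolding measure_convolution[OF \<mu> K(1,2) C(2)] measure_convolution[OF g K(1,2) C(2)]
      by (rule Bochner_Integration.integral_diff[OF i])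
    also have "\<sigma> * (measure (\<mu> \<star> K) C - measure (g \<star> K) C) \<le> \<bar>\<sigma> * (measure (\<mu> \<star> K) C - measure (g \<star> K) C)\<bar>" by simp
    also have "\<dots> \<le> e" using e[unfolded convex_close_def, rule_format, of C] C \<sigma> by (simp add: abs_mult)
    finally have "3/4 * (x - b) - 1/4 * \<delta> \<le> e" .
    then show ?thesis by (simp add: field_simps)
  qed
  show ?thesis unfolding convex_close_def
  proof (intro allI impI)
    fix B :: "(real^'d) set" assume "convex B \<and> B \<in> sets borel"
    then have B: "convex B" and [measurable]: "B \<in> sets borel" by auto
    have "measure \<mu> B - measure g B \<le> b + 4/3 * e + \<delta> / 3"
    proof (rule main[of "neigh r B" 1])
      fix y :: "real^'d" assume y: "norm y < r"
      have "B \<subseteq> {u. u + y \<in> neigh r B}"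
      proof
        fix u assume "u \<in> B"
        moreover have "u + y \<in> ball u r" using y by (simp add: dist_norm)
        ultimately show "u \<in> {u. u + y \<in> neigh r B}" unfolding neigh_def by blast
      qed
      then have "measure \<mu> B \<le> measure \<mu> {u. u + y \<in> neigh r B}"
        using convex_shift_set[OF neigh_convex[OF B] neigh_measurable] by (intro \<mu>.finite_measure_mono) simp_all
      moreover have "{u. u + y \<in> neigh r B} \<subseteq> neigh (2 * r) B"
      proof (clarsimp simp: neigh_def)
        fix u x assume "x \<in> B" "dist x (u + y) < r"
        moreover have "dist x u \<le> dist x (u + y) + norm y" using dist_triangle[of x u "u + y"] by (simp add: dist_norm)
        ultimately show "\<exists>x\<in>B. dist x u < 2 * r" using y by (intro bexI[of _ x]) auto
      qed
      then have "measure g {u. u + y \<in> neigh r B} \<le> measure g (neigh (2 * r) B)"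
        by (intro g.finite_measure_mono) auto
      moreover have "measure g (neigh (2 * r) B) = measure g B + measure g (neigh (2 * r) B - B)"
        using neigh_mono[of "2 * r" B] r by (subst g.finite_measure_Diff) auto
      moreover have "measure g (neigh (2 * r) B - B) \<le> b" using bn[OF B] by simp
      ultimately show "measure \<mu> B - measure g B - b \<le> 1 * (measure \<mu> {u. u + y \<in> neigh r B} - measure g {u. u + y \<in> neigh r B})"
        by simp
    qed (auto intro: neigh_convex[OF B])
    moreover have "measure g B - measure \<mu> B \<le> b + 4/3 * e + \<delta> / 3"
    proof (rule main[of "erode r B" "- 1"])
      fix y :: "real^'d" assume y: "norm y < r"
      have "{u. u + y \<in> erode r B} \<subseteq> B"
      proof
        fix u assume "u \<in> {u. u + y \<in> erode r B}"
        then have "ball (u + y) r \<subseteq> B" by (simp add: erode_def)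
        moreover have "u \<in> ball (u + y) r" using y by (simp add: dist_norm)
        ultimately show "u \<in> B" by blast
      qed
      then have "measure \<mu> {u. u + y \<in> erode r B} \<le> measure \<mu> B"
        by (intro \<mu>.finite_measure_mono) auto
      moreover have "erode (2 * r) B \<subseteq> {u. u + y \<in> erode r B}"
      proof (clarsimp simp: erode_def)
        fix u x assume "ball u (2 * r) \<subseteq> B" "dist (u + y) x < r"
        moreover have "dist u x \<le> dist (u + y) x + norm y" using dist_triangle[of u x "u + y"] by (simp add: dist_norm)
        ultimately show "x \<in> B" using y by (auto simp: subset_iff)
      qed
      then have "measure g (erode (2 * r) B) \<le> measure g {u. u + y \<in> erode r B}"
        using convex_shift_set[OF erode_convex[OF B] erode_measurable] by (intro g.finite_measure_mono) auto
      moreover have "erode (2 * r) B \<subseteq> B"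
      proof
        fix u assume "u \<in> erode (2 * r) B"
        then have "ball u (2 * r) \<subseteq> B" by (simp add: erode_def)
        moreover have "u \<in> ball u (2 * r)" using r by simp
        ultimately show "u \<in> B" by (rule subsetD)
      qed
      then have "measure g (B - erode (2 * r) B) = measure g B - measure g (erode (2 * r) B)"
        by (intro g.finite_measure_Diff) simp_all
      moreover have "measure g (B - erode (2 * r) B) \<le> b" using be[OF B] by simp
      ultimately show "measure g B - measure \<mu> B - b \<le> - 1 * (measure \<mu> {u. u + y \<in> erode r B} - measure g {u. u + y \<in> erode r B})"
        by simp
    qed (auto intro: erode_convex[OF B])
    ultimately show "\<bar>measure \<mu> B - measure g B\<bar> \<le> b + 4/3 * e + \<delta> / 3" by linarith
  qed
qed

text \<open>\<open>smoothing_step\<close> is applied to the best possible \<delta>, a supremum that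
  is finite because it is bounded by 1. Its coefficient 1/3 on the right is then absorbed on the
  left.\<close>

lemma smoothing:
  fixes \<mu> :: "(real^'d) measure"
  assumes \<mu>: "prob_space \<mu>" "sets \<mu> = sets borel" and g: "prob_space g" "sets g = sets borel"
    and K: "prob_space K" "sets K = sets borel" "measure K (ball 0 r) \<ge> 3/4" and r: "r > 0"
    and e: "convex_close (\<mu> \<star> K) (g \<star> K) e"
    and bn: "\<And>B. convex B \<Longrightarrow> B \<in> sets borel \<Longrightarrow> measure g (neigh (2 * r) B - B) \<le> b"
    and be: "\<And>B. convex B \<Longrightarrow> B \<in> sets borel \<Longrightarrow> measure g (B - erode (2 * r) B) \<le> b"
  shows "convex_close \<mu> g (2 * (e + b))"
proof -
  interpret \<mu>: prob_space \<mu> by fact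
  interpret g: prob_space g by fact
  let ?S = "(\<lambda>B. \<bar>measure \<mu> B - measure g B\<bar>) ` {B. convex B \<and> B \<in> sets borel}"
  have "\<bar>measure \<mu> B - measure g B\<bar> \<le> 1" for B
    using \<mu>.prob_le_1[of B] g.prob_le_1[of B] measure_nonneg[of \<mu> B] measure_nonneg[of g B] by (simp only: abs_le_iff) linarith
  then have bdd: "bdd_above ?S" by (auto intro!: bdd_aboveI)
  define \<delta> where "\<delta> = Sup ?S"
  have d: "convex_close \<mu> g \<delta>"
    unfolding convex_close_def \<delta>_def using bdd by (auto intro!: cSup_upper)
  have e0: "e \<ge> 0" using e[unfolded convex_close_def, rule_format, of "{}"] by simp
  have b0: "b \<ge> 0" using bn[of "{}"] by (simp add: neigh_def)
  have "convex_close \<mu> g (b + 4/3 * e + \<delta> / 3)"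
    by (rule smoothing_step[OF \<mu> g K r e bn be d])
  then have "\<delta> \<le> b + 4/3 * e + \<delta> / 3"
    unfolding \<delta>_def by (intro cSup_least) (auto simp: convex_close_def intro!: exI[of _ "{}"])
  then have "\<delta> \<le> 2 * (e + b)" using e0 b0 by simp
  with d show ?thesis unfolding convex_close_def by fastforce
qed

section \<open>Berry--Esseen bound for standardised summands\<close>

primrec convpow :: "(real^'d) measure \<Rightarrow> nat \<Rightarrow> (real^'d) measure" where
  "convpow \<nu> 0 = return borel 0"
| "convpow \<nu> (Suc k) = (convpow \<nu> k \<star> \<nu>)"

lemma sets_convpow [simp, measurable_cong]: "sets (convpow \<nu> k) = sets borel"
  by (cases k) auto

lemma prob_space_convpow:
  assumes "prob_space \<nu>" "sets \<nu> = sets borel"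
  shows "prob_space (convpow \<nu> k)"
  by (induction k) (auto simp: prob_space_return intro!: prob_space_convolution assms)

lemma return0_convolution:
  fixes g :: "(real^'d) measure"
  assumes "prob_space g" and s: "sets g = sets borel"
  shows "(return borel 0 \<star> g) = g"
proof (rule measure_eqI)
  interpret prob_space g by fact
  fix A :: "(real^'d) set" assume "A \<in> sets (return borel 0 \<star> g)"
  then have [measurable]: "A \<in> sets borel" by simp
  note [measurable_cong] = s
  have "emeasure (return borel 0 \<star> g) A = (\<integral>\<^sup>+x. \<integral>\<^sup>+y. indicator A (x + y) \<partial>g \<partial>return borel 0)"
    by (rule convolution_emeasure') (auto simp: s finite_measure_axioms prob_space.finite_measure prob_space_return)
  also have "\<dots> = (\<integral>\<^sup>+y. indicator A (0 + y) \<partial>g)"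
    by (subst nn_integral_return) auto
  also have "\<dots> = emeasure g A" using s by simp
  finally show "emeasure (return borel 0 \<star> g) A = emeasure g A" .
qed (simp add: s)

text \<open>With F w = \<open>measure \<mu> {u. u + w \<in> B}\<close> as test function both
  measures become iterated integrals over a summand and a Gaussian. One unit of variance of
  \<open>gauss (1 + s)\<close> is exchanged for \<nu>, and the rest s does the smoothing.\<close>

lemma lindeberg_replace:
  fixes \<mu> \<nu> :: "(real^'d) measure"
  assumes \<mu>: "prob_space \<mu>" "sets \<mu> = sets borel" and \<nu>: "std_law \<nu>" and s: "s > 0"
    and B: "B \<in> sets borel"
    and mod: "\<And>a w. \<bar>measure \<mu> {u. u + (a + w) \<in> B} - measure \<mu> {u. u + a \<in> B}\<bar> \<le> A * norm w + D"
  shows "\<bar>measure ((\<mu> \<star> \<nu>) \<star> gauss s) B - measure (\<mu> \<star> gauss (1 + s)) B\<bar>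
    \<le> gauss_taylor_const TYPE('d) * (moment3 \<nu> + moment3 (gauss 1 :: (real^'d) measure)) * ((A * sqrt s + D) / sqrt s ^ 3)"
proof -
  let ?F = "\<lambda>w. measure \<mu> {u. u + w \<in> B}"
  interpret \<mu>: prob_space \<mu> by fact
  note g = prob_space_gauss[OF s] sets_gauss[of s]
  have F: "?F \<in> borel_measurable borel" "\<And>x. 0 \<le> ?F x" "\<And>x. ?F x \<le> 1"
    by (rule measure_shift_measurable[OF \<mu> B]) auto
  have key: "measure ((\<mu> \<star> \<rho>) \<star> gauss s) B = (\<integral>x. \<integral>z. ?F (x + z) \<partial>gauss s \<partial>\<rho>)"
    if "prob_space \<rho>" "sets \<rho> = sets borel" for \<rho>
  proof -
    have "((\<mu> \<star> \<rho>) \<star> gauss s) = (\<mu> \<star> (\<rho> \<star> gauss s))"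
      using that \<mu> g by (intro convolution_associative[symmetric]) (auto simp: prob_space.finite_measure prob_space.finite_measure[OF prob_space_gauss[OF s]] dest: sets_eq_imp_space_eq)
    also have "measure \<dots> B = (\<integral>w. ?F w \<partial>(\<rho> \<star> gauss s))"
      by (rule measure_convolution[OF \<mu> prob_space_convolution[OF that g] _ B]) simp
    also have "\<dots> = (\<integral>x. \<integral>z. ?F (x + z) \<partial>gauss s \<partial>\<rho>)"
      by (rule integral_convolution[OF that g, where K=1]) (use F in auto)
    finally show ?thesis .
  qed
  have "(gauss (1 + s) :: (real^'d) measure) = (gauss 1 \<star> gauss s)"
    using s by (intro gauss_convolution[symmetric]) auto
  then have g1: "(\<mu> \<star> gauss (1 + s)) = ((\<mu> \<star> gauss 1) \<star> gauss s)"
    using convolution_associative[of "gauss 1" "gauss s" \<mu>] \<mu>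
      prob_space.finite_measure[OF prob_space_gauss[OF s]] prob_space.finite_measure[OF prob_space_gauss[of 1]]
      prob_space.finite_measure[OF \<mu>(1)] sets_eq_imp_space_eq[OF \<mu>(2)] by simp
  show ?thesis
    unfolding g1 key[OF std_lawD(1,2)[OF \<nu>]] key[OF std_lawD(1,2)[OF std_law_gauss]]
    by (rule lindeberg_step[OF F mod s \<nu>])
qed

text \<open>For the Gaussian, shifting a convex set is Lipschitz by
  \<open>gauss_convex_shift\<close>. Exchanging \<open>\<mu>\<close> for the Gaussian at each of the
  two shifted sets, which are again convex, costs \<delta> twice.\<close>

lemma gauss_modulus:
  fixes \<mu> :: "(real^'d) measure"
  assumes c: "convex_close \<mu> (gauss t) \<delta>" and t: "t > 0" and B: "convex B" "B \<in> sets borel"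
  shows "\<bar>measure \<mu> {u. u + (a + w) \<in> B} - measure \<mu> {u. u + a \<in> B}\<bar> \<le> exp (1/2) / sqrt t * norm w + 2 * \<delta>"
proof -
  interpret prob_space "gauss t :: (real^'d) measure" by (rule prob_space_gauss) (rule t)
  let ?S = "\<lambda>y. {u. u + y \<in> B}"
  have le: "measure (gauss t) (?S y) - measure (gauss t) (?S y') \<le> exp (1/2) / sqrt t * norm (y - y')" for y y'
  proof -
    note S = convex_shift_set[OF B, of y]
    note S' = convex_shift_set[OF B, of y']
    note [measurable] = S(2) S'(2)
    have "measure (gauss t) (?S y) \<le> measure (gauss t) (?S y' \<union> {u\<in>?S y. u + (y' - y) \<notin> ?S y})"
    proof (rule finite_measure_mono)
      show "?S y \<subseteq> ?S y' \<union> {u\<in>?S y. u + (y' - y) \<notin> ?S y}" by (auto simp: algebra_simps)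
      show "?S y' \<union> {u\<in>?S y. u + (y' - y) \<notin> ?S y} \<in> sets (gauss t)" by measurable
    qed
    also have "\<dots> \<le> measure (gauss t) (?S y') + measure (gauss t) {u\<in>?S y. u + (y' - y) \<notin> ?S y}"
      by (rule measure_Un_le) measurable
    also have "measure (gauss t) {u\<in>?S y. u + (y' - y) \<notin> ?S y} \<le> exp (1/2) * norm (y' - y) / sqrt t"
      by (rule gauss_convex_shift[OF S t])
    finally show ?thesis by (simp add: norm_minus_commute)
  qed
  show ?thesis
    using le[of "a + w" a] le[of a "a + w"] c[unfolded convex_close_def, rule_format, of "?S a"]
      c[unfolded convex_close_def, rule_format, of "?S (a + w)"] convex_shift_set[OF B]
    by (simp add: abs_le_iff)
qed

text \<open>Telescoping over hybrids made of i summands and a Gaussian carrying the other n - i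
  units of variance plus t. The exchange at index i is smoothed by variance n - i - 1 + t and tested
  with the modulus of the partial sum of length i.\<close>

lemma lindeberg_sum:
  fixes \<nu> :: "(real^'d) measure" and t :: real
  assumes \<nu>: "std_law \<nu>" and t: "t > 0" and B: "convex B" "B \<in> sets borel"
    and mod: "\<And>i. i < n \<Longrightarrow> (\<forall>a w. \<bar>measure (convpow \<nu> i) {u. u + (a + w) \<in> B} - measure (convpow \<nu> i) {u. u + a \<in> B}\<bar> \<le> A i * norm w + D i)"
  shows "\<bar>measure (convpow \<nu> n \<star> gauss t) B - measure (gauss (n + t)) B\<bar>
    \<le> gauss_taylor_const TYPE('d) * (moment3 \<nu> + moment3 (gauss 1 :: (real^'d) measure))
      * (\<Sum>i<n. (A i * sqrt (n - Suc i + t) + D i) / sqrt (n - Suc i + t) ^ 3)"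
proof -
  let ?c = "gauss_taylor_const TYPE('d) * (moment3 \<nu> + moment3 (gauss 1 :: (real^'d) measure))"
  let ?m = "\<lambda>i. measure (convpow \<nu> i \<star> gauss (real (n - i) + t)) B"
  have step: "\<bar>?m (Suc i) - ?m i\<bar> \<le> ?c * ((A i * sqrt (n - Suc i + t) + D i) / sqrt (n - Suc i + t) ^ 3)" if i: "i < n" for i
  proof -
    have e: "real (n - i) + t = 1 + (real (n - Suc i) + t)" using i by (simp add: of_nat_diff)
    show ?thesis unfolding e
      by (rule lindeberg_replace[OF prob_space_convpow[OF std_lawD(1,2)[OF \<nu>]] sets_convpow \<nu> _ B(2) mod[OF i, rule_format], simplified convpow.simps(2)[symmetric]])
         (use t in auto)
  qed
  have "\<bar>?m n - ?m 0\<bar> = \<bar>\<Sum>i<n. ?m (Suc i) - ?m i\<bar>"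
    unfolding sum_lessThan_telescope[of ?m n] ..
  also have "\<dots> \<le> (\<Sum>i<n. ?c * ((A i * sqrt (n - Suc i + t) + D i) / sqrt (n - Suc i + t) ^ 3))"
    by (rule order_trans[OF sum_abs]) (intro sum_mono step, simp)
  finally show ?thesis
    using t by (simp add: sum_distrib_left return0_convolution prob_space_gauss)
qed

lemma gauss_ball_mass: "\<exists>R>0. measure (gauss 1 :: (real^'d) measure) (ball 0 R) \<ge> 3/4"
proof -
  interpret prob_space "gauss 1 :: (real^'d) measure" by (rule prob_space_gauss) simp
  have "(\<Union>k::nat. ball (0::real^'d) (real k)) = UNIV"
    using reals_Archimedean2 by auto
  moreover have "(\<lambda>k. prob (ball 0 (real k))) \<longlonglongrightarrow> prob (\<Union>k::nat. ball 0 (real k))"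
    by (rule finite_Lim_measure_incseq) (auto simp: incseq_def)
  ultimately have "(\<lambda>k. prob (ball 0 (real k))) \<longlonglongrightarrow> 1"
    using prob_space by simp
  then have "\<forall>\<^sub>F k in sequentially. prob (ball 0 (real k)) > 3/4 \<and> k > 0"
    by (intro eventually_conj order_tendstoD(1)[of _ 1] eventually_gt_at_top) auto
  then obtain k :: nat where "prob (ball 0 (real k)) > 3/4" "k > 0"
    using eventually_happens' trivial_limit_sequentially by blast
  then show ?thesis by (intro exI[of _ "real k"]) auto
qed

lemma gauss_ball_scale:
  assumes "\<tau> > 0"
  shows "measure (gauss (\<tau>\<^sup>2) :: (real^'d) measure) (ball 0 (R * \<tau>)) = measure (gauss 1 :: (real^'d) measure) (ball 0 R)"
proof -
  have "measure (gauss (\<tau>\<^sup>2) :: (real^'d) measure) (ball 0 (R * \<tau>))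
      = measure (gauss 1) ((\<lambda>z::real^'d. sqrt (\<tau>\<^sup>2) *\<^sub>R z) -` ball 0 (R * \<tau>))"
    using assms by (subst gauss_scale[symmetric]) (auto simp: measure_distr)
  also have "(\<lambda>z::real^'d. sqrt (\<tau>\<^sup>2) *\<^sub>R z) -` ball 0 (R * \<tau>) = ball 0 R"
    using assms by (auto simp: mult.commute)
  finally show ?thesis .
qed

lemma sum_inverse_rev: "(\<Sum>i<n. 1 / real (n - i)) = harm n"
  unfolding harm_def
  by (rule sum.reindex_bij_witness[of _ "\<lambda>k. n - k" "\<lambda>i. n - i"]) (auto simp: divide_inverse)

lemma harm_ge_1: "n \<ge> 1 \<Longrightarrow> 1 \<le> (harm n :: real)"
  using harm_mono[of 1 n] by (simp add: harm_def)

text \<open>For i below n / 2 much Gaussian variance remains, so even the trivial modulus 1 gives n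
  terms of total order 1 / sqrt n. For the other indices the Lipschitz part costs 1 / (n - i),
  whence the harmonic number, and sqrt s \<ge> \<tau> divides the constant part D by \<tau>.\<close>

lemma lindeberg_term_le:
  fixes n i :: nat
  assumes i: "i < n" and \<tau>: "\<tau> \<ge> 1" and A: "A \<ge> 0" and D: "D \<ge> 0"
  defines "s \<equiv> real (n - Suc i) + \<tau>\<^sup>2"
  shows "2 * i < n \<Longrightarrow> 1 / sqrt s ^ 3 \<le> 3 / (n * sqrt n)"
    and "(A * sqrt s + D) / sqrt s ^ 3 \<le> 1 / real (n - i) * (A + D / \<tau>)"
proof -
  have \<tau>2: "1 \<le> \<tau>\<^sup>2" using \<tau> by simp
  have s: "s \<ge> real (n - i)" using i \<tau>2 by (simp add: s_def of_nat_diff)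
  have s\<tau>: "\<tau> \<le> sqrt s" using \<tau> by (intro real_le_rsqrt) (simp add: s_def)
  have pos: "real (n - i) > 0" "s > 0" using i s by auto
  have s3: "sqrt s ^ 3 = s * sqrt s" using pos by (simp add: power3_eq_cube)
  have "(A * sqrt s + D) / sqrt s ^ 3 = 1 / s * (A + D / sqrt s)"
    using pos by (simp add: s3 field_simps)
  also have "\<dots> \<le> 1 / real (n - i) * (A + D / \<tau>)"
    using s s\<tau> \<tau> A D pos by (intro mult_mono add_mono divide_left_mono) auto
  finally show "(A * sqrt s + D) / sqrt s ^ 3 \<le> 1 / real (n - i) * (A + D / \<tau>)" .
  assume i2: "2 * i < n"
  have "real n / 2 \<le> s" using s i2 i by (simp add: of_nat_diff)
  then have "real n / 2 * sqrt (real n / 2) \<le> s * sqrt s" by (intro mult_mono) auto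
  \<comment> \<open>The constant 3 bounds 2 sqrt 2.\<close>
  moreover have "n * sqrt n \<le> 3 * (real n / 2 * sqrt (real n / 2))"
  proof -
    have "sqrt 2 \<le> 3 / 2" by (rule real_le_lsqrt) (auto simp: power2_eq_square)
    then have "n * sqrt n * sqrt 2 \<le> n * sqrt n * (3/2)" by (intro mult_left_mono) auto
    then show ?thesis by (simp add: real_sqrt_divide field_simps)
  qed
  ultimately have "n * sqrt n \<le> 3 * (s * sqrt s)" by linarith
  then show "1 / sqrt s ^ 3 \<le> 3 / (n * sqrt n)"
    using i pos by (simp add: s3 divide_simps)
qed

text \<open>Strong induction on n. The hypothesis for partial sums of length i \<ge> n / 2 only
  enters through the constant part of their modulus, which the smoothing divides by \<tau>. The
  Lipschitz part and the removal of the smoothing are of the claimed order without it.\<close>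

theorem berry_esseen_convex_std:
  "\<exists>C>0. \<forall>(\<nu> :: (real^'d) measure) n. std_law \<nu> \<longrightarrow> n \<ge> 1 \<longrightarrow>
     convex_close (convpow \<nu> n) (gauss (real n)) (C * moment3 \<nu> * harm n / sqrt n)"
proof -
  define m\<gamma> where "m\<gamma> = moment3 (gauss 1 :: (real^'d) measure)"
  define c0 where "c0 = gauss_taylor_const TYPE('d) * (1 + m\<gamma>)"
  define C1 :: real where "C1 = exp (1/2)"
  define cb where "cb = 2 * exp (1/2) * real ((CARD('d))\<^sup>2)"
  obtain R where R: "R > 0" "measure (gauss 1 :: (real^'d) measure) (ball 0 R) \<ge> 3/4"
    using gauss_ball_mass by blast
  \<comment> \<open>Makes 8 c0 / K0 \<le> 1/2: the contribution of the induction hypothesis then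
    takes up at most half of the claimed constant.\<close>
  define K0 where "K0 = 16 * c0 + 1"
  \<comment> \<open>Twice the sum of all contributions that are free of D0. The choice is not
    circular, since K0 was fixed before.\<close>
  define D0 where "D0 = 4 * (c0 * (3 + 2 * C1) + 2 * cb * R * K0)"
  have m\<gamma>: "1 \<le> m\<gamma>" unfolding m\<gamma>_def by (rule std_law_moment3_ge_1[OF std_law_gauss])
  have c0: "c0 \<ge> 0" unfolding c0_def using m\<gamma> gauss_taylor_const_nonneg by (intro mult_nonneg_nonneg) auto
  have cb: "cb > 0" unfolding cb_def by simp
  have C1: "C1 > 0" unfolding C1_def by simp
  have K0: "K0 \<ge> 1" unfolding K0_def using c0 by simp
  have D0: "D0 > 0" unfolding D0_def using c0 cb R K0 C1
    by (intro mult_pos_pos add_nonneg_pos mult_nonneg_nonneg) auto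
  have "convex_close (convpow \<nu> n) (gauss (real n)) (D0 * moment3 \<nu> * harm n / sqrt n)"
    if \<nu>: "std_law (\<nu> :: (real^'d) measure)" and "n \<ge> 1" for \<nu> n
    using \<open>n \<ge> 1\<close>
  proof (induction n rule: less_induct)
    case (less n)
    define \<beta> where "\<beta> = moment3 \<nu>"
    define h :: real where "h = harm n"
    have n: "n \<ge> 1" by fact
    have \<beta>: "\<beta> \<ge> 1" unfolding \<beta>_def by (rule std_law_moment3_ge_1[OF \<nu>])
    have h: "h \<ge> 1" unfolding h_def using n by (rule harm_ge_1)
    have h0: "h \<ge> 0" using h by simp
    \<comment> \<open>The claimed rate times sqrt n, up to a constant. Unsmoothing then costs a
      multiple of the claim, and D i / \<tau> becomes 4 D0 / (K0 sqrt n), from which \<beta> and h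
      have cancelled.\<close>
    define \<tau> where "\<tau> = K0 * \<beta> * h"
    have "1 * 1 * 1 \<le> \<tau>" unfolding \<tau>_def using K0 \<beta> h by (intro mult_mono) auto
    then have \<tau>: "\<tau> \<ge> 1" by simp
    \<comment> \<open>The trivial modulus for i below n / 2, which includes i = 0 where no induction
      hypothesis exists; otherwise \<open>gauss_modulus\<close> with the hypothesis for i, using
      sqrt n \<le> 2 sqrt i.\<close>
    define A where "A i = (if 2 * i < n then 0 else 2 * C1 / sqrt n)" for i :: nat
    define D where "D i = (if 2 * i < n then 1 else 4 * D0 * \<beta> * h / sqrt n)" for i :: nat
    define e where "e = c0 * \<beta> * (h / sqrt n * (3 + 2 * C1 + 4 * D0 / K0))"
    define b where "b = cb * (2 * (R * \<tau>)) / sqrt n"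
    let ?\<mu> = "convpow \<nu>"
    note P = prob_space_convpow[OF std_lawD(1,2)[OF \<nu>]]
    have mod: "\<forall>a w. \<bar>measure (?\<mu> i) {u. u + (a + w) \<in> B} - measure (?\<mu> i) {u. u + a \<in> B}\<bar> \<le> A i * norm w + D i"
      if i: "i < n" and B: "convex B" "B \<in> sets borel" for i B
    proof (intro allI)
      fix a w
      interpret prob_space "?\<mu> i" by (rule P)
      show "\<bar>measure (?\<mu> i) {u. u + (a + w) \<in> B} - measure (?\<mu> i) {u. u + a \<in> B}\<bar> \<le> A i * norm w + D i"
      proof (cases "2 * i < n")
        case True
        have "\<bar>x - y\<bar> \<le> 1" if "0 \<le> x" "x \<le> 1" "0 \<le> y" "y \<le> 1" for x y :: real using that by linarith
        then show ?thesis using True by (simp add: A_def D_def)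
      next
        case False
        then have i1: "i \<ge> 1" using n by simp
        have sq: "1 / sqrt i \<le> 2 / sqrt n"
        proof -
          have "sqrt n \<le> sqrt (4 * i)" using False by (intro real_sqrt_le_mono) linarith
          then have "sqrt n \<le> 2 * sqrt i" by (simp add: real_sqrt_mult)
          then show ?thesis using i1 n by (simp add: divide_simps)
        qed
        have hi: "harm i \<le> h" unfolding h_def using i by (intro harm_mono) simp
        have "\<bar>measure (?\<mu> i) {u. u + (a + w) \<in> B} - measure (?\<mu> i) {u. u + a \<in> B}\<bar>
          \<le> exp (1/2) / sqrt i * norm w + 2 * (D0 * moment3 \<nu> * harm i / sqrt i)"
          using i1 i by (intro gauss_modulus less.IH B) auto
        also have "\<dots> = C1 * norm w * (1 / sqrt i) + 2 * D0 * \<beta> * harm i * (1 / sqrt i)"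
          by (simp add: C1_def \<beta>_def)
        also have "\<dots> \<le> C1 * norm w * (2 / sqrt n) + 2 * D0 * \<beta> * h * (2 / sqrt n)"
          using C1 D0 \<beta> hi sq h0 by (intro add_mono mult_mono mult_nonneg_nonneg) (auto simp: harm_nonneg)
        also have "\<dots> = A i * norm w + D i" using False by (simp add: A_def D_def mult_ac)
        finally show ?thesis .
      qed
    qed
    have sum: "(\<Sum>i<n. (A i * sqrt (n - Suc i + \<tau>\<^sup>2) + D i) / sqrt (n - Suc i + \<tau>\<^sup>2) ^ 3)
      \<le> h / sqrt n * (3 + 2 * C1 + 4 * D0 / K0)"
    proof -
      let ?a = "2 * C1 / sqrt n" and ?d = "4 * D0 * \<beta> * h / sqrt n"
      have ad: "?a \<ge> 0" "?d \<ge> 0" using C1 D0 \<beta> h0 by auto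
      have "(\<Sum>i<n. (A i * sqrt (n - Suc i + \<tau>\<^sup>2) + D i) / sqrt (n - Suc i + \<tau>\<^sup>2) ^ 3)
        \<le> (\<Sum>i<n. 3 / (n * sqrt n) + 1 / real (n - i) * (?a + ?d / \<tau>))"
      proof (rule sum_mono)
        fix i assume "i \<in> {..<n}"
        then have i: "i < n" by simp
        note lt = lindeberg_term_le[OF i \<tau> ad]
        have nn: "0 \<le> 3 / (n * sqrt n)" "0 \<le> 1 / real (n - i) * (?a + ?d / \<tau>)"
          using ad \<tau> D0 \<beta> h0 C1 by (auto intro!: mult_nonneg_nonneg add_nonneg_nonneg divide_nonneg_nonneg)
        show "(A i * sqrt (n - Suc i + \<tau>\<^sup>2) + D i) / sqrt (n - Suc i + \<tau>\<^sup>2) ^ 3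
            \<le> 3 / (n * sqrt n) + 1 / real (n - i) * (?a + ?d / \<tau>)"
        proof (cases "2 * i < n")
          case True
          have "(A i * sqrt (n - Suc i + \<tau>\<^sup>2) + D i) / sqrt (n - Suc i + \<tau>\<^sup>2) ^ 3 = 1 / sqrt (n - Suc i + \<tau>\<^sup>2) ^ 3"
            using True by (simp add: A_def D_def)
          also note lt(1)[OF True]
          finally show ?thesis by (rule add_increasing2[OF nn(2)])
        next
          case False
          have "(A i * sqrt (n - Suc i + \<tau>\<^sup>2) + D i) / sqrt (n - Suc i + \<tau>\<^sup>2) ^ 3
             = (?a * sqrt (n - Suc i + \<tau>\<^sup>2) + ?d) / sqrt (n - Suc i + \<tau>\<^sup>2) ^ 3"
            using False by (simp only: A_def D_def if_False)
          also note lt(2)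
          finally show ?thesis by (rule add_increasing[OF nn(1)])
        qed
      qed
      also have "\<dots> = real n * (3 / (n * sqrt n)) + (\<Sum>i<n. 1 / real (n - i)) * (?a + ?d / \<tau>)"
        by (simp only: sum.distrib sum_distrib_right sum_constant card_lessThan)
      also have "\<dots> = 3 / sqrt n + h * (?a + ?d / \<tau>)"
        unfolding sum_inverse_rev h_def[symmetric] using n by simp
      also have "?d / \<tau> = 4 * D0 / K0 / sqrt n"
        unfolding \<tau>_def using K0 \<beta> h n by (simp add: divide_simps)
      also have "3 / sqrt n + h * (?a + 4 * D0 / K0 / sqrt n) \<le> h * (3 / sqrt n) + h * (?a + 4 * D0 / K0 / sqrt n)"
        using mult_right_mono[OF h, of "3 / sqrt n"] by simp
      also have "\<dots> = h / sqrt n * (3 + 2 * C1 + 4 * D0 / K0)"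
        using n K0 by (simp add: field_simps)
      finally show ?thesis .
    qed
    have close: "convex_close (?\<mu> n \<star> gauss (\<tau>\<^sup>2)) (gauss (real n) \<star> gauss (\<tau>\<^sup>2)) e"
      unfolding convex_close_def
    proof (intro allI impI)
      fix B :: "(real^'d) set" assume "convex B \<and> B \<in> sets borel"
      then have B: "convex B" "B \<in> sets borel" by auto
      have g: "(gauss (real n) \<star> gauss (\<tau>\<^sup>2)) = (gauss (n + \<tau>\<^sup>2) :: (real^'d) measure)"
        using n \<tau> by (intro gauss_convolution) auto
      have "\<bar>measure (?\<mu> n \<star> gauss (\<tau>\<^sup>2)) B - measure (gauss (n + \<tau>\<^sup>2)) B\<bar>
        \<le> gauss_taylor_const TYPE('d) * (\<beta> + m\<gamma>) * (\<Sum>i<n. (A i * sqrt (n - Suc i + \<tau>\<^sup>2) + D i) / sqrt (n - Suc i + \<tau>\<^sup>2) ^ 3)"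
        unfolding \<beta>_def m\<gamma>_def using \<tau> by (intro lindeberg_sum[OF \<nu> _ B] mod B) auto
      also have "\<dots> \<le> (c0 * \<beta>) * (h / sqrt n * (3 + 2 * C1 + 4 * D0 / K0))"
      proof (rule mult_mono[OF _ sum])
        have "\<beta> + m\<gamma> \<le> (1 + m\<gamma>) * \<beta>"
          using mult_left_mono[OF \<beta>, of m\<gamma>] m\<gamma> by (simp add: algebra_simps)
        then show "gauss_taylor_const TYPE('d) * (\<beta> + m\<gamma>) \<le> c0 * \<beta>"
          unfolding c0_def using gauss_taylor_const_nonneg[where 'd='d] by (simp add: mult_left_mono mult.assoc)
        show "0 \<le> c0 * \<beta>" using c0 \<beta> by simp
        show "0 \<le> (\<Sum>i<n. (A i * sqrt (n - Suc i + \<tau>\<^sup>2) + D i) / sqrt (n - Suc i + \<tau>\<^sup>2) ^ 3)"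
          using C1 D0 \<beta> h0 by (intro sum_nonneg divide_nonneg_nonneg add_nonneg_nonneg mult_nonneg_nonneg zero_le_power) (auto simp: A_def D_def)
      qed
      finally show "\<bar>measure (?\<mu> n \<star> gauss (\<tau>\<^sup>2)) B - measure (gauss (real n) \<star> gauss (\<tau>\<^sup>2)) B\<bar> \<le> e"
        unfolding g e_def .
    qed
    have R\<tau>: "0 < R * \<tau>" using R \<tau> by simp
    have "convex_close (?\<mu> n) (gauss (real n)) (2 * (e + b))"
    proof (rule smoothing[OF P sets_convpow _ sets_gauss _ sets_gauss _ R\<tau> close])
      show "measure (gauss (\<tau>\<^sup>2)) (ball (0::real^'d) (R * \<tau>)) \<ge> 3/4"
        using R(2) \<tau> by (subst gauss_ball_scale) simp_all
    next
      fix B :: "(real^'d) set" assume B: "convex B" "B \<in> sets borel"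
      show "measure (gauss (real n)) (neigh (2 * (R * \<tau>)) B - B) \<le> b"
        using gauss_neigh[OF B, of "real n" "2 * (R * \<tau>)"] n R\<tau> by (simp add: b_def cb_def)
      show "measure (gauss (real n)) (B - erode (2 * (R * \<tau>)) B) \<le> b"
        using gauss_erode[OF B, of "real n" "2 * (R * \<tau>)"] n R\<tau> by (simp add: b_def cb_def)
    qed (use n \<tau> in \<open>auto intro!: prob_space_gauss\<close>)
    moreover have "2 * (e + b) \<le> D0 * \<beta> * h / sqrt n"
    proof -
      have "2 * (e + b) = (\<beta> * h / sqrt n) * (2 * c0 * (3 + 2 * C1) + 8 * c0 / K0 * D0 + 4 * cb * R * K0)"
        unfolding e_def b_def \<tau>_def using n K0 by (simp add: field_simps)
      also have "\<dots> \<le> (\<beta> * h / sqrt n) * D0"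
      proof (rule mult_left_mono)
        have "8 * c0 / K0 \<le> 1/2" unfolding K0_def using c0 by (simp add: divide_simps)
        then have "8 * c0 / K0 * D0 \<le> 1/2 * D0" using D0 by (intro mult_right_mono) auto
        then show "2 * c0 * (3 + 2 * C1) + 8 * c0 / K0 * D0 + 4 * cb * R * K0 \<le> D0"
          unfolding D0_def by (simp add: algebra_simps)
      qed (use \<beta> h0 in auto)
      finally show ?thesis by (simp add: mult_ac)
    qed
    ultimately show ?case unfolding convex_close_def \<beta>_def[symmetric] h_def[symmetric] by force
  qed
  with D0 show ?thesis by blast
qed

section \<open>General covariance\<close>

lemma inner_matrix_sum:
  fixes G :: "real^'d^'d"
  shows "u \<bullet> (G *v v) = (\<Sum>i\<in>UNIV. \<Sum>j\<in>UNIV. u $ i * G $ i $ j * v $ j)"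
  by (simp add: inner_vec_def matrix_vector_mult_def sum_distrib_left mult.assoc)

lemma inner_sym_matrix:
  fixes G :: "real^'d^'d"
  assumes "transpose G = G"
  shows "u \<bullet> (G *v v) = v \<bullet> (G *v u)"
  by (metis assms dot_lmul_matrix inner_commute transpose_matrix_vector)

text \<open>Gram--Schmidt for the inner product \<open>u \<bullet> (G *v v)\<close>. For k below the
  dimension some vector lies outside the span of the family; positivity allows normalising its
  orthogonal component.\<close>

lemma posdef_orthonormal_family:
  fixes G :: "real^'d^'d"
  assumes sym: "transpose G = G" and pos: "\<And>u. u \<noteq> 0 \<Longrightarrow> u \<bullet> (G *v u) > 0"
    and "k \<le> CARD('d)"
  shows "\<exists>f :: nat \<Rightarrow> real^'d. \<forall>i<k. \<forall>j<k. f i \<bullet> (G *v f j) = (if i = j then 1 else 0)"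
  using \<open>k \<le> CARD('d)\<close>
proof (induction k)
  case (Suc k)
  then obtain f :: "nat \<Rightarrow> real^'d" where f: "\<And>i j. i < k \<Longrightarrow> j < k \<Longrightarrow> f i \<bullet> (G *v f j) = (if i = j then 1 else 0)"
    by auto
  have "dim (span (f ` {..<k})) \<le> card (f ` {..<k})" by (simp add: dim_le_card')
  also have "\<dots> \<le> k" using card_image_le[of "{..<k}" f] by simp
  also have "k < DIM(real^'d)" using Suc.prems by simp
  finally have "span (f ` {..<k}) \<noteq> UNIV" by (metis dim_UNIV less_irrefl)
  then obtain u where u: "u \<notin> span (f ` {..<k})" by blast
  define w where "w = u - (\<Sum>j<k. (f j \<bullet> (G *v u)) *\<^sub>R f j)"
  have "w \<noteq> 0"
  proof
    assume "w = 0"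
    then have "u = (\<Sum>j<k. (f j \<bullet> (G *v u)) *\<^sub>R f j)" by (simp add: w_def)
    also have "\<dots> \<in> span (f ` {..<k})" by (intro span_sum span_scale span_base) auto
    finally show False using u by simp
  qed
  then have N: "w \<bullet> (G *v w) > 0" by (rule pos)
  define N where "N = sqrt (w \<bullet> (G *v w))"
  have N0: "N > 0" "N * N = w \<bullet> (G *v w)" using N by (auto simp: N_def)
  have fw: "f i \<bullet> (G *v w) = 0" if "i < k" for i
  proof -
    have "G *v w = G *v u - (\<Sum>j<k. (f j \<bullet> (G *v u)) *\<^sub>R (G *v f j))"
    proof -
      have "G *v (\<Sum>j<k. (f j \<bullet> (G *v u)) *\<^sub>R f j) = (\<Sum>j<k. G *v ((f j \<bullet> (G *v u)) *\<^sub>R f j))"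
        by (rule linear_sum[OF matrix_vector_mul_linear])
      then show ?thesis
        unfolding w_def matrix_vector_mult_diff_distrib by (simp only: matrix_vector_mult_scaleR)
    qed
    then have "f i \<bullet> (G *v w) = f i \<bullet> (G *v u) - (\<Sum>j<k. (f j \<bullet> (G *v u)) * (f i \<bullet> (G *v f j)))"
      by (simp add: inner_diff_right inner_sum_right)
    also have "(\<Sum>j<k. (f j \<bullet> (G *v u)) * (f i \<bullet> (G *v f j))) = (\<Sum>j<k. if j = i then f j \<bullet> (G *v u) else 0)"
      using f that by (intro sum.cong) auto
    finally show ?thesis using that by simp
  qed
  define g where "g = f(k := (1 / N) *\<^sub>R w)"
  have "g i \<bullet> (G *v g j) = (if i = j then 1 else 0)" if "i < Suc k" "j < Suc k" for i j
  proof -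
    have "f j \<bullet> (G *v w) = 0 \<Longrightarrow> w \<bullet> (G *v f j) = 0" for j by (simp add: inner_sym_matrix[OF sym, of w])
    then show ?thesis
      using that f fw N0 by (auto simp: g_def less_Suc_eq matrix_vector_mult_scaleR)
  qed
  then show ?case by blast
qed auto

lemma matrix_conj_nth:
  fixes G :: "real^'d^'d"
  shows "(T ** G ** transpose T) $ i $ j = T $ i \<bullet> (G *v T $ j)"
  unfolding inner_matrix_sum
  by (subst sum.swap) (simp add: matrix_matrix_mult_def transpose_def sum_distrib_right mult.assoc)

text \<open>The rows of T are orthonormal for G, that is, T G T^t is the identity, and the inverse
  of T is the factor. Existence guarantees that the \<open>SOME\<close> in \<open>gaussian\<close>
  picks a genuine square root.\<close>

lemma posdef_factor:
  fixes G :: "real^'d^'d"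
  assumes sym: "transpose G = G" and pos: "\<And>u. u \<noteq> 0 \<Longrightarrow> u \<bullet> (G *v u) > 0"
  shows "\<exists>A :: real^'d^'d. A ** transpose A = G"
proof -
  obtain f :: "nat \<Rightarrow> real^'d" where f: "\<And>i j. i < CARD('d) \<Longrightarrow> j < CARD('d) \<Longrightarrow> f i \<bullet> (G *v f j) = (if i = j then 1 else 0)"
    using posdef_orthonormal_family[OF sym pos order_refl] by auto
  obtain e :: "'d \<Rightarrow> nat" where e: "bij_betw e UNIV {..<CARD('d)}"
    using ex_bij_betw_finite_nat[of "UNIV :: 'd set"] by (auto simp: atLeast0LessThan)
  then have e': "e i < CARD('d)" "e i = e j \<longleftrightarrow> i = j" for i j
    by (auto simp: bij_betw_def inj_on_def)
  define T :: "real^'d^'d" where "T = (\<chi> i. f (e i))"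
  have T: "T ** G ** transpose T = mat 1"
    by (simp add: vec_eq_iff matrix_conj_nth) (simp add: T_def f e' mat_def)
  then have inv: "invertible T"
    by (metis invertible_right_inverse matrix_mul_assoc)
  then obtain A where A: "A ** T = mat 1" "T ** A = mat 1"
    by (auto simp: invertible_def)
  have At: "transpose T ** transpose A = mat 1"
    by (metis A(1) matrix_transpose_mul transpose_mat)
  have "G = (A ** T) ** G ** (transpose T ** transpose A)" by (simp add: A At)
  also have "\<dots> = A ** (T ** G ** transpose T) ** transpose A" by (simp add: matrix_mul_assoc)
  also have "\<dots> = A ** transpose A" by (simp add: T)
  finally have "A ** transpose A = G" by simp
  then show ?thesis ..
qed

text \<open>Stated for an arbitrary factor, because the one picked by \<open>SOME\<close> in
  \<open>gaussian\<close> need not be the one constructed in \<open>posdef_factor\<close>.\<close>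

lemma posdef_factor_invertible:
  fixes A G :: "real^'d^'d"
  assumes A: "A ** transpose A = G" and pos: "\<And>u. u \<noteq> 0 \<Longrightarrow> u \<bullet> (G *v u) > 0"
  shows "invertible A"
proof -
  have "x = 0" if "transpose A *v x = 0" for x
  proof (rule ccontr)
    assume "x \<noteq> 0"
    then have "x \<bullet> (G *v x) > 0" by (rule pos)
    moreover have "G *v x = A *v (transpose A *v x)" by (simp only: A[symmetric] matrix_vector_mul_assoc)
    ultimately show False using that by simp
  qed
  then have "\<exists>B. B ** transpose A = mat 1"
    by (simp add: matrix_left_invertible_ker)
  then have "invertible (transpose A)" by (simp add: invertible_left_inverse)
  then show ?thesis using transpose_invertible[of "transpose A"] by simp
qed

lemma matrix_vector_measurable [measurable (raw)]:
  fixes T :: "real^'d^'d"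
  assumes "f \<in> borel_measurable M"
  shows "(\<lambda>x. T *v f x) \<in> borel_measurable M"
  by (rule measurable_compose[OF assms])
     (intro borel_measurable_continuous_onI linear_continuous_on matrix_vector_mul_bounded_linear)

lemma convolution_distr:
  fixes \<mu> :: "(real^'d) measure"
  assumes \<mu>: "prob_space \<mu>" "sets \<mu> = sets borel" and \<nu>: "prob_space \<nu>" "sets \<nu> = sets borel"
    and [measurable]: "f \<in> borel_measurable borel" "g \<in> borel_measurable borel" "h \<in> borel_measurable borel"
    and fgh: "\<And>x y. f x + g y = (h (x + y) :: real^'d)"
  shows "(distr \<mu> borel f \<star> distr \<nu> borel g) = distr (\<mu> \<star> \<nu>) borel h"
proof -
  note [measurable_cong] = \<mu>(2) \<nu>(2)
  interpret \<mu>: prob_space \<mu> by fact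
  interpret \<nu>: prob_space \<nu> by fact
  interpret g: prob_space "distr \<nu> borel g" by (rule \<nu>.prob_space_distr) measurable
  have "distr \<mu> borel f \<Otimes>\<^sub>M distr \<nu> borel g = distr (\<mu> \<Otimes>\<^sub>M \<nu>) (borel \<Otimes>\<^sub>M borel) (\<lambda>(x, y). (f x, g y))"
    by (rule pair_measure_distr) (auto intro: g.sigma_finite_measure_axioms)
  then show ?thesis
    unfolding convolution_def by (simp add: distr_distr o_def split_beta' fgh)
qed

lemma convpow_affine:
  fixes Q :: "(real^'d) measure" and T :: "real^'d^'d"
  assumes Q: "prob_space Q" "sets Q = sets borel"
  shows "convpow (distr Q borel (\<lambda>x. T *v (x - m))) k = distr (convpow Q k) borel (\<lambda>w. T *v (w - real k *\<^sub>R m))"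
proof (induction k)
  case 0
  have "distr (return borel 0) borel (\<lambda>w. T *v (w - real 0 *\<^sub>R m)) = return borel (T *v (0 - real 0 *\<^sub>R m))"
    by (rule distr_return) auto
  then show ?case by simp
next
  case (Suc k)
  have eq: "T *v (x - real k *\<^sub>R m) + T *v (y - m) = T *v ((x + y) - real (Suc k) *\<^sub>R m)" for x y
  proof -
    have "(x - real k *\<^sub>R m) + (y - m) = (x + y) - real (Suc k) *\<^sub>R m"
      by (simp add: algebra_simps)
    then show ?thesis by (simp only: matrix_vector_right_distrib[symmetric])
  qed
  have "(distr (convpow Q k) borel (\<lambda>w. T *v (w - real k *\<^sub>R m)) \<star> distr Q borel (\<lambda>x. T *v (x - m)))
      = distr (convpow Q k \<star> Q) borel (\<lambda>w. T *v (w - real (Suc k) *\<^sub>R m))"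
    using prob_space_convpow[OF Q, of k] sets_convpow[of Q k] Q
    by (rule convolution_distr) (use eq in auto)
  then show ?case by (simp only: convpow.simps Suc)
qed

section \<open>Whitening a law with positive definite covariance\<close>

definition mean_vec :: "(real^'d) measure \<Rightarrow> real^'d" where
  "mean_vec Q = (\<chi> i. \<integral>x. x $ i \<partial>Q)"

definition cov_mat :: "(real^'d) measure \<Rightarrow> real^'d^'d" where
  "cov_mat Q = (\<chi> i j. \<integral>x. (x $ i - mean_vec Q $ i) * (x $ j - mean_vec Q $ j) \<partial>Q)"

lemma transpose_cov_mat: "transpose (cov_mat Q) = cov_mat Q"
proof -
  have "cov_mat Q $ i $ j = cov_mat Q $ j $ i" for i j
    unfolding cov_mat_def vec_lambda_beta
    by (rule Bochner_Integration.integral_cong[OF refl]) (rule mult.commute)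
  then show ?thesis by (simp add: transpose_def vec_eq_iff)
qed

text \<open>The bound on the third moment sees T only through the lower bound c of the covariance,
  so it holds for whichever square root \<open>gaussian\<close> uses.\<close>

lemma std_law_whitened:
  fixes Q :: "(real^'d) measure" and T :: "real^'d^'d"
  assumes Q: "prob_space Q" "sets Q = sets borel" and i3: "integrable Q (\<lambda>x. norm (x - mean_vec Q) ^ 3)"
    and T: "T ** cov_mat Q ** transpose T = mat 1"
    and c: "c > 0" "\<And>u. c * (norm u)\<^sup>2 \<le> u \<bullet> (cov_mat Q *v u)"
  shows "std_law (distr Q borel (\<lambda>x. T *v (x - mean_vec Q)))"
    and "moment3 (distr Q borel (\<lambda>x. T *v (x - mean_vec Q))) \<le> (\<integral>x. norm (x - mean_vec Q) ^ 3 \<partial>Q) / sqrt c ^ 3"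
proof -
  interpret prob_space Q by fact
  note [measurable_cong] = Q(2)
  let ?m = "mean_vec Q" and ?S = "cov_mat Q"
  let ?y = "\<lambda>x. x - ?m"
  note iy = integrable_coords_of_moment3[of ?y, OF _ i3, simplified]
  have ix: "integrable Q (\<lambda>x. x $ i)" for i
    using Bochner_Integration.integrable_add[OF iy(1)[of i] integrable_const[of "?m $ i"]] by simp
  have my: "(\<integral>x. ?y x $ i \<partial>Q) = 0" for i
    using ix[of i] by (simp add: mean_vec_def prob_space)
  \<comment> \<open>Take u = T^t T x. As T whitens the covariance, c times norm u squared is at most
    the square of norm (T x); and that square equals u \<bullet> x, so Cauchy--Schwarz
    finishes.\<close>
  have nT: "norm (T *v x) \<le> norm x / sqrt c" for x
  proof -
    let ?w = "T *v x" and ?u = "transpose T *v (T *v x)"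
    have "c * (norm ?u)\<^sup>2 \<le> ?u \<bullet> (?S *v ?u)" by (rule c)
    also have "?u \<bullet> (?S *v ?u) = ?w \<bullet> (T *v (?S *v ?u))"
      by (metis dot_lmul_matrix transpose_matrix_vector)
    also have "T *v (?S *v ?u) = (T ** ?S ** transpose T) *v ?w"
      by (simp only: matrix_vector_mul_assoc matrix_mul_assoc)
    also have "?w \<bullet> \<dots> = (norm ?w)\<^sup>2" by (simp add: T power2_norm_eq_inner)
    finally have "(sqrt c * norm ?u)\<^sup>2 \<le> (norm ?w)\<^sup>2" using c(1) by (simp add: power_mult_distrib)
    then have u: "sqrt c * norm ?u \<le> norm ?w" by (rule power2_le_imp_le) simp
    have "norm ?w * norm ?w = ?u \<bullet> x"
      by (metis dot_lmul_matrix inner_commute power2_eq_square power2_norm_eq_inner transpose_matrix_vector)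
    also have "\<dots> \<le> norm ?u * norm x" by (rule norm_cauchy_schwarz)
    finally have "sqrt c * (norm ?w * norm ?w) \<le> (sqrt c * norm ?u) * norm x"
      using c(1) by (simp add: mult.assoc mult_left_mono)
    also have "\<dots> \<le> norm ?w * norm x" using u by (intro mult_right_mono) auto
    finally have "norm ?w * (sqrt c * norm ?w) \<le> norm ?w * norm x" by (simp add: mult_ac)
    then have "sqrt c * norm ?w \<le> norm x" by (cases "norm ?w = 0") auto
    then show ?thesis using c(1) by (simp add: field_simps)
  qed
  have nT3: "norm (T *v ?y x) ^ 3 \<le> norm (?y x) ^ 3 / sqrt c ^ 3" for x
    using power_mono[OF nT[of "?y x"], of 3] by (simp add: power_divide)
  have iT3: "integrable Q (\<lambda>x. norm (T *v ?y x) ^ 3)"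
    by (rule Bochner_Integration.integrable_bound[OF integrable_divide[OF i3, of "sqrt c ^ 3"]])
       (use nT3 c(1) in auto)
  have Tn: "(T *v ?y x) $ i = (\<Sum>k\<in>UNIV. T $ i $ k * ?y x $ k)" for x i
    by (simp add: matrix_vector_mult_def)
  show "std_law (distr Q borel (\<lambda>x. T *v ?y x))"
    unfolding std_law_def
  proof (intro conjI allI)
    show "prob_space (distr Q borel (\<lambda>x. T *v ?y x))" by (rule prob_space_distr) measurable
    show "integrable (distr Q borel (\<lambda>x. T *v ?y x)) (\<lambda>x. norm x ^ 3)"
      using iT3 by (subst integrable_distr_eq) auto
    show "(\<integral>x. x $ i \<partial>distr Q borel (\<lambda>x. T *v ?y x)) = 0" for i
    proof -
      have "(\<integral>x. x $ i \<partial>distr Q borel (\<lambda>x. T *v ?y x)) = (\<integral>x. (\<Sum>k\<in>UNIV. T $ i $ k * ?y x $ k) \<partial>Q)"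
        by (subst integral_distr) (auto simp: Tn simp del: vector_minus_component)
      also have "\<dots> = (\<Sum>k\<in>UNIV. T $ i $ k * (\<integral>x. ?y x $ k \<partial>Q))"
        using iy(1) by (subst Bochner_Integration.integral_sum) auto
      finally show ?thesis by (simp only: my) simp
    qed
    show "(\<integral>x. x $ i * x $ j \<partial>distr Q borel (\<lambda>x. T *v ?y x)) = (if i = j then 1 else 0)" for i j
    proof -
      have "(\<integral>x. x $ i * x $ j \<partial>distr Q borel (\<lambda>x. T *v ?y x)) = (\<integral>x. (T *v ?y x) $ i * (T *v ?y x) $ j \<partial>Q)"
        by (subst integral_distr) auto
      also have "\<dots> = (\<integral>x. (\<Sum>k\<in>UNIV. \<Sum>l\<in>UNIV. T $ i $ k * T $ j $ l * (?y x $ k * ?y x $ l)) \<partial>Q)"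
        unfolding Tn sum_product by (simp only: mult.assoc mult.left_commute)
      also have "\<dots> = (\<Sum>k\<in>UNIV. \<integral>x. (\<Sum>l\<in>UNIV. T $ i $ k * T $ j $ l * (?y x $ k * ?y x $ l)) \<partial>Q)"
        by (rule Bochner_Integration.integral_sum) (intro Bochner_Integration.integrable_sum integrable_mult_right, simp add: iy)
      also have "\<dots> = (\<Sum>k\<in>UNIV. \<Sum>l\<in>UNIV. \<integral>x. T $ i $ k * T $ j $ l * (?y x $ k * ?y x $ l) \<partial>Q)"
        by (intro sum.cong refl Bochner_Integration.integral_sum integrable_mult_right) (simp add: iy)
      also have "\<dots> = (\<Sum>k\<in>UNIV. \<Sum>l\<in>UNIV. T $ i $ k * T $ j $ l * ?S $ k $ l)"
        by (simp add: cov_mat_def)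
      also have "\<dots> = T $ i \<bullet> (?S *v T $ j)"
        unfolding inner_matrix_sum by (simp add: mult_ac)
      also have "\<dots> = (if i = j then 1 else 0)"
        unfolding matrix_conj_nth[symmetric] T by (simp add: mat_def)
      finally show ?thesis .
    qed
  qed simp
  have "moment3 (distr Q borel (\<lambda>x. T *v ?y x)) = (\<integral>x. norm (T *v ?y x) ^ 3 \<partial>Q)"
    unfolding moment3_def by (subst integral_distr) auto
  also have "\<dots> \<le> (\<integral>x. norm (?y x) ^ 3 / sqrt c ^ 3 \<partial>Q)"
    by (rule Bochner_Integration.integral_mono[OF iT3 _ nT3]) (simp add: i3)
  finally show "moment3 (distr Q borel (\<lambda>x. T *v ?y x)) \<le> (\<integral>x. norm (?y x) ^ 3 \<partial>Q) / sqrt c ^ 3" by simp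
qed

text \<open>Names one admissible constant, so that the bounds for different laws, sample sizes and
  sets share it; the type argument only records the dimension.\<close>

definition berry_esseen_const :: "'d::finite itself \<Rightarrow> real \<Rightarrow> bool" where
  "berry_esseen_const _ C \<longleftrightarrow> C > 0 \<and> (\<forall>(\<nu> :: (real^'d) measure) n. std_law \<nu> \<longrightarrow> n \<ge> 1 \<longrightarrow>
     convex_close (convpow \<nu> n) (gauss (real n)) (C * moment3 \<nu> * harm n / sqrt n))"

text \<open>The number \<open>k\<close> of summands and the scale \<open>m\<close> of the Gaussian are kept apart: besides
  \<open>k = m\<close>, the case \<open>k \<longrightarrow> \<infinity>\<close> for fixed \<open>m\<close> serves to exhibit the Gaussian measure of
  a convex set as a limit of measurable functions of the parameters.\<close>
lemma normal_approx:
  fixes Q :: "(real^'d) measure"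
  assumes C: "berry_esseen_const TYPE('d) C"
    and Q: "prob_space Q" "sets Q = sets borel" and i3: "integrable Q (\<lambda>x. norm (x - mean_vec Q) ^ 3)"
    and c: "c > 0" "\<And>u. c * (norm u)\<^sup>2 \<le> u \<bullet> (cov_mat Q *v u)"
    and m: "m > 0" and k: "k \<ge> 1" and B: "convex B" "B \<in> sets borel"
  shows "\<bar>measure (convpow Q k) {w. v + sqrt (m / real k) *\<^sub>R (w - real k *\<^sub>R mean_vec Q) \<in> B}
      - measure (gaussian v (m *\<^sub>R cov_mat Q)) B\<bar>
    \<le> C * ((\<integral>x. norm (x - mean_vec Q) ^ 3 \<partial>Q) / sqrt c ^ 3) * harm k / sqrt k"
proof -
  let ?S = "cov_mat Q" and ?\<mu> = "mean_vec Q"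
  have pos: "u \<bullet> ((m *\<^sub>R ?S) *v u) > 0" if "u \<noteq> 0" for u
  proof -
    have "0 < c * (norm u)\<^sup>2" using c(1) that by simp
    with c(2)[of u] m show ?thesis by (simp add: scaleR_matrix_vector_assoc[symmetric])
  qed
  have sym: "transpose (m *\<^sub>R ?S) = m *\<^sub>R ?S"
    using transpose_cov_mat[of Q] by (simp add: transpose_scalar)
  define A where "A = (SOME A :: real^'d^'d. A ** transpose A = m *\<^sub>R ?S)"
  have A: "A ** transpose A = m *\<^sub>R ?S"
    unfolding A_def by (rule someI_ex) (rule posdef_factor[OF sym pos])
  obtain A' where A': "A ** A' = mat 1" "A' ** A = mat 1"
    using posdef_factor_invertible[OF A pos] by (auto simp: invertible_def)
  \<comment> \<open>The factor sqrt m turns the inverse of a root of m times the covariance into a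
    whitening of the covariance itself, and it makes A T equal to sqrt m times the identity.\<close>
  define T where "T = sqrt m *\<^sub>R A'"
  have AT: "A *v (T *v x) = sqrt m *\<^sub>R x" for x
  proof -
    have "A *v (T *v x) = (A ** T) *v x" by (rule matrix_vector_mul_assoc)
    also have "A ** T = sqrt m *\<^sub>R mat 1" by (simp add: T_def matrix_scalar_ac A' flip: scalar_matrix_assoc)
    finally show ?thesis by (simp flip: scaleR_matrix_vector_assoc)
  qed
  have T: "T ** ?S ** transpose T = mat 1"
  proof -
    have "T ** ?S ** transpose T = A' ** (m *\<^sub>R ?S) ** transpose A'"
      using m by (simp add: T_def transpose_scalar matrix_scalar_ac flip: scalar_matrix_assoc)
    also have "\<dots> = (A' ** A) ** (transpose A ** transpose A')"
      unfolding A[symmetric] by (simp add: matrix_mul_assoc)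
    also have "transpose A ** transpose A' = mat 1"
      by (metis A'(2) matrix_transpose_mul transpose_mat)
    finally show ?thesis by (simp add: A')
  qed
  define \<nu> where "\<nu> = distr Q borel (\<lambda>x. T *v (x - ?\<mu>))"
  note std = std_law_whitened[OF Q i3 T c, folded \<nu>_def]
  \<comment> \<open>One convex set for both laws: under \<open>gauss (real k)\<close> the map y
    \<mapsto> v + A y / sqrt k produces exactly the law \<open>gaussian v (m *\<^sub>R ?S)\<close>,
    and under the whitened sum it produces the rescaled original sum.\<close>
  let ?B = "{y. v + (1 / sqrt k) *\<^sub>R (A *v y) \<in> B}"
  have Bm: "?B \<in> sets borel"
    using measurable_sets_borel[of "\<lambda>y. v + (1 / sqrt k) *\<^sub>R (A *v y)" borel B] B by (simp add: vimage_def)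
  have Bc: "convex ?B"
  proof -
    have "?B = (\<lambda>y. (1 / sqrt k) *\<^sub>R (A *v y)) -` {u. u + v \<in> B}" by (simp add: vimage_def add.commute)
    moreover have "linear (\<lambda>y. (1 / sqrt k) *\<^sub>R (A *v y))"
      by (intro linear_compose_scale_right matrix_vector_mul_linear)
    ultimately show ?thesis using convex_linear_vimage convex_shift_set(1)[OF B] by metis
  qed
  have 1: "measure (convpow \<nu> k) ?B = measure (convpow Q k) {w. v + sqrt (m / real k) *\<^sub>R (w - real k *\<^sub>R ?\<mu>) \<in> B}"
  proof -
    have "measure (convpow \<nu> k) ?B = measure (convpow Q k) ((\<lambda>w. T *v (w - real k *\<^sub>R ?\<mu>)) -` ?B)"
      unfolding \<nu>_def convpow_affine[OF Q] using Bm sets_eq_imp_space_eq[OF sets_convpow, of Q k]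
      by (subst measure_distr) auto
    also have "(\<lambda>w. T *v (w - real k *\<^sub>R ?\<mu>)) -` ?B = {w. v + sqrt (m / real k) *\<^sub>R (w - real k *\<^sub>R ?\<mu>) \<in> B}"
      by (simp add: vimage_def AT real_sqrt_divide)
    finally show ?thesis .
  qed
  have 2: "measure (gauss (real k)) ?B = measure (gaussian v (m *\<^sub>R ?S)) B"
  proof -
    have "measure (gauss (real k)) ?B = measure (gauss 1) ((\<lambda>z. sqrt (real k) *\<^sub>R z) -` ?B)"
      using k Bm by (subst gauss_scale[symmetric]) (auto simp: measure_distr)
    also have "(\<lambda>z. sqrt (real k) *\<^sub>R z) -` ?B = (\<lambda>z. v + A *v z) -` B"
      using k by (simp add: vimage_def matrix_vector_mult_scaleR)
    also have "measure (gauss 1) \<dots> = measure (gaussian v (m *\<^sub>R ?S)) B"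
      unfolding gaussian_def std_gaussian_eq_gauss A_def[symmetric] using B
      by (subst measure_distr) auto
    finally show ?thesis .
  qed
  have "convex_close (convpow \<nu> k) (gauss (real k)) (C * moment3 \<nu> * harm k / sqrt k)"
    using C std(1) k by (auto simp: berry_esseen_const_def)
  then have "\<bar>measure (convpow \<nu> k) ?B - measure (gauss (real k)) ?B\<bar> \<le> C * moment3 \<nu> * harm k / sqrt k"
    using Bm Bc by (simp add: convex_close_def)
  also have "\<dots> \<le> C * ((\<integral>x. norm (x - mean_vec Q) ^ 3 \<partial>Q) / sqrt c ^ 3) * harm k / sqrt k"
    using std(2) C by (intro divide_right_mono mult_right_mono mult_left_mono) (auto simp: harm_nonneg berry_esseen_const_def)
  finally show ?thesis unfolding 1 2 .
qed

section \<open>Truncation to a norm ball\<close>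

lemma (in prob_space) integral_uniform_measure:
  fixes f :: "'a \<Rightarrow> real"
  assumes [measurable]: "A \<in> sets M" "f \<in> borel_measurable M" and A: "prob A > 0"
  shows "(\<integral>x. f x \<partial>uniform_measure M A) = (\<integral>x. f x * indicator A x \<partial>M) / prob A"
    and "integrable (uniform_measure M A) f \<longleftrightarrow> integrable M (\<lambda>x. f x * indicator A x)"
proof -
  have U: "uniform_measure M A = density M (\<lambda>x. ennreal (indicator A x / prob A))"
    unfolding uniform_measure_def
    by (intro density_cong) (use A in \<open>auto simp: emeasure_eq_measure indicator_def divide_ennreal[symmetric]\<close>)
  show "(\<integral>x. f x \<partial>uniform_measure M A) = (\<integral>x. f x * indicator A x \<partial>M) / prob A"
    unfolding U using A by (subst integral_density) (auto simp: mult.commute)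
  show "integrable (uniform_measure M A) f \<longleftrightarrow> integrable M (\<lambda>x. f x * indicator A x)"
  proof -
    have "integrable (uniform_measure M A) f \<longleftrightarrow> integrable M (\<lambda>x. (1 / prob A) * (f x * indicator A x))"
      unfolding U using A by (subst integrable_density) (auto simp: mult.commute)
    also have "\<dots> \<longleftrightarrow> integrable M (\<lambda>x. f x * indicator A x)"
      using A by (subst integrable_mult_left_iff) simp
    finally show ?thesis .
  qed
qed

lemma norm_bounds:
  fixes N :: "real^'d \<Rightarrow> real"
  assumes "is_norm N"
  shows "\<exists>K>0. \<forall>x. N x \<le> K * norm x" "\<exists>K>0. \<forall>x. norm x \<le> K * N x"
    and "continuous_on UNIV N" "\<And>x. 0 \<le> N x" "\<And>x. N x = 0 \<longleftrightarrow> x = 0"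
proof -
  have sc: "N (c *\<^sub>R x) = \<bar>c\<bar> * N x" and tri: "N (x + y) \<le> N x + N y" and z: "N x = 0 \<longleftrightarrow> x = 0" for c x y
    using assms by (auto simp: is_norm_def)
  show z': "N x = 0 \<longleftrightarrow> x = 0" for x by (rule z)
  have neg: "N (- x) = N x" for x using sc[of "-1" x] by simp
  show nn: "0 \<le> N x" for x
    using tri[of x "- x"] z[of 0] neg[of x] by simp
  define K where "K = 1 + (\<Sum>i\<in>UNIV. N (axis i 1))"
  have K: "K > 0" unfolding K_def using nn by (intro add_pos_nonneg sum_nonneg) auto
  have up: "N x \<le> K * norm x" for x
  proof -
    have sum: "N (\<Sum>i\<in>I. f i) \<le> (\<Sum>i\<in>I. N (f i))" if "finite I" for I and f :: "'d \<Rightarrow> real^'d"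
      using that
    proof (induction I rule: finite_induct)
      case (insert i I)
      then show ?case using tri[of "f i" "\<Sum>i\<in>I. f i"] by simp
    qed (use z[of 0] in simp)
    have "N x = N (\<Sum>i\<in>UNIV. (x $ i) *\<^sub>R axis i 1)"
      using basis_expansion[of x] by (simp add: scalar_mult_eq_scaleR)
    also have "\<dots> \<le> (\<Sum>i\<in>UNIV. N ((x $ i) *\<^sub>R axis i 1))" by (rule sum) simp
    also have "\<dots> \<le> (\<Sum>i\<in>UNIV. norm x * N (axis i 1))"
      unfolding sc by (intro sum_mono mult_right_mono component_le_norm_cart nn)
    also have "\<dots> \<le> K * norm x" by (simp add: K_def sum_distrib_left[symmetric] algebra_simps)
    finally show ?thesis .
  qed
  then show "\<exists>K>0. \<forall>x. N x \<le> K * norm x" using K by blast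
  have lip: "\<bar>N x - N y\<bar> \<le> K * norm (x - y)" for x y
    using tri[of "x - y" y] tri[of "y - x" x] up[of "x - y"] neg[of "x - y"] by simp
  show cont: "continuous_on UNIV N"
    by (rule lipschitz_on_continuous_on[of K]) (use K lip in \<open>auto simp: lipschitz_on_def dist_norm\<close>)
  have "\<exists>x\<in>sphere 0 1. \<forall>y\<in>sphere 0 1. N x \<le> N y"
  proof (rule continuous_attains_inf)
    show "sphere (0::real^'d) 1 \<noteq> {}" using vector_choose_size[of 1, where 'a="real^'d"] by auto
    show "continuous_on (sphere 0 1) N" by (rule continuous_on_subset[OF cont]) simp
  qed simp
  then obtain x where x: "norm x = 1" "\<And>y. norm y = 1 \<Longrightarrow> N x \<le> N y" by auto
  have Nx: "N x > 0" using x(1) z[of x] nn[of x] by (cases "x = 0") auto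
  have "norm y \<le> (1 / N x) * N y" for y
  proof (cases "y = 0")
    case False
    have "N x \<le> N ((1 / norm y) *\<^sub>R y)" using False by (intro x) simp
    then show ?thesis using False Nx unfolding sc by (simp add: field_simps)
  qed (use z[of 0] in simp)
  then show "\<exists>K>0. \<forall>x. norm x \<le> K * N x" using Nx by (intro exI[of _ "1 / N x"]) auto
qed

lemma posdef_lower_bound:
  fixes G :: "real^'d^'d"
  assumes pos: "\<And>u. u \<noteq> 0 \<Longrightarrow> u \<bullet> (G *v u) > 0"
  shows "\<exists>c>0. \<forall>u. c * (norm u)\<^sup>2 \<le> u \<bullet> (G *v u)"
proof -
  have "\<exists>x\<in>sphere 0 1. \<forall>y\<in>sphere 0 1. x \<bullet> (G *v x) \<le> y \<bullet> (G *v y)"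
  proof (rule continuous_attains_inf)
    show "sphere (0::real^'d) 1 \<noteq> {}" using vector_choose_size[of 1, where 'a="real^'d"] by auto
    show "continuous_on (sphere 0 1) (\<lambda>x. x \<bullet> (G *v x))"
      by (intro continuous_on_inner continuous_on_id linear_continuous_on matrix_vector_mul_bounded_linear)
  qed simp
  then obtain x where x: "norm x = 1" "\<And>y. norm y = 1 \<Longrightarrow> x \<bullet> (G *v x) \<le> y \<bullet> (G *v y)" by auto
  have "x \<bullet> (G *v x) * (norm u)\<^sup>2 \<le> u \<bullet> (G *v u)" for u
  proof (cases "u = 0")
    case False
    have "x \<bullet> (G *v x) \<le> ((1 / norm u) *\<^sub>R u) \<bullet> (G *v ((1 / norm u) *\<^sub>R u))" using False by (intro x) simp
    then show ?thesis using False by (simp add: matrix_vector_mult_scaleR power2_eq_square field_simps)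
  qed simp
  moreover have "x \<bullet> (G *v x) > 0" using x(1) by (intro pos) auto
  ultimately show ?thesis by blast
qed

lemma cov_quadratic:
  fixes Q :: "(real^'d) measure"
  assumes Q: "prob_space Q" "sets Q = sets borel" and i3: "integrable Q (\<lambda>x. norm (x - mean_vec Q) ^ 3)"
  shows "u \<bullet> (cov_mat Q *v u) = (\<integral>x. (u \<bullet> (x - mean_vec Q))\<^sup>2 \<partial>Q)"
    and "integrable Q (\<lambda>x. (u \<bullet> (x - mean_vec Q))\<^sup>2)"
    and "integrable Q (\<lambda>x. u \<bullet> (x - mean_vec Q))"
    and "(\<integral>x. u \<bullet> (x - mean_vec Q) \<partial>Q) = 0"
proof -
  interpret prob_space Q by fact
  note [measurable_cong] = Q(2)
  let ?y = "\<lambda>x. x - mean_vec Q"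
  have iy: "integrable Q (\<lambda>x. ?y x $ i)" "integrable Q (\<lambda>x. ?y x $ i * ?y x $ j)" for i j
    using integrable_coords_of_moment3[of ?y, OF _ i3] by auto
  have ix: "integrable Q (\<lambda>x. x $ i)" for i
    using Bochner_Integration.integrable_add[OF iy(1)[of i] integrable_const[of "mean_vec Q $ i"]] by simp
  have my: "(\<integral>x. ?y x $ i \<partial>Q) = 0" for i
    using ix[of i] by (simp add: mean_vec_def prob_space)
  have e2: "(u \<bullet> ?y x)\<^sup>2 = (\<Sum>i\<in>UNIV. \<Sum>j\<in>UNIV. u $ i * u $ j * (?y x $ i * ?y x $ j))" for x
    unfolding inner_vec_def power2_eq_square sum_product by (intro sum.cong refl) (simp add: mult_ac)
  have e1: "u \<bullet> ?y x = (\<Sum>i\<in>UNIV. u $ i * ?y x $ i)" for x by (simp add: inner_vec_def)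
  show "integrable Q (\<lambda>x. (u \<bullet> ?y x)\<^sup>2)" unfolding e2
    by (intro Bochner_Integration.integrable_sum integrable_mult_right iy)
  show "integrable Q (\<lambda>x. u \<bullet> ?y x)" unfolding e1
    by (intro Bochner_Integration.integrable_sum integrable_mult_right iy)
  have "(\<integral>x. u \<bullet> ?y x \<partial>Q) = (\<Sum>i\<in>UNIV. \<integral>x. u $ i * ?y x $ i \<partial>Q)"
    unfolding e1 by (intro Bochner_Integration.integral_sum integrable_mult_right iy)
  also have "\<dots> = (\<Sum>i\<in>UNIV. u $ i * (\<integral>x. ?y x $ i \<partial>Q))"
    by (intro sum.cong refl Bochner_Integration.integral_mult_right_zero)
  finally show "(\<integral>x. u \<bullet> ?y x \<partial>Q) = 0" by (simp only: my) simp
  have "(\<integral>x. (u \<bullet> ?y x)\<^sup>2 \<partial>Q) = (\<Sum>i\<in>UNIV. \<integral>x. (\<Sum>j\<in>UNIV. u $ i * u $ j * (?y x $ i * ?y x $ j)) \<partial>Q)"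
    unfolding e2 by (intro Bochner_Integration.integral_sum Bochner_Integration.integrable_sum integrable_mult_right iy)
  also have "\<dots> = (\<Sum>i\<in>UNIV. \<Sum>j\<in>UNIV. \<integral>x. u $ i * u $ j * (?y x $ i * ?y x $ j) \<partial>Q)"
    by (intro sum.cong refl Bochner_Integration.integral_sum integrable_mult_right iy)
  also have "\<dots> = (\<Sum>i\<in>UNIV. \<Sum>j\<in>UNIV. u $ i * u $ j * cov_mat Q $ i $ j)"
    by (intro sum.cong refl) (simp add: cov_mat_def)
  also have "\<dots> = u \<bullet> (cov_mat Q *v u)"
    unfolding inner_matrix_sum by (simp add: mult_ac)
  finally show "u \<bullet> (cov_mat Q *v u) = (\<integral>x. (u \<bullet> ?y x)\<^sup>2 \<partial>Q)" ..
qed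

text \<open>The second moment of u \<bullet> x about a constant is smallest about its mean. This
  allows comparing covariances of truncations at different levels, whose means differ.\<close>

lemma cov_quadratic_le:
  fixes Q :: "(real^'d) measure"
  assumes Q: "prob_space Q" "sets Q = sets borel" and i3: "integrable Q (\<lambda>x. norm (x - mean_vec Q) ^ 3)"
  shows "u \<bullet> (cov_mat Q *v u) \<le> (\<integral>x. (u \<bullet> x - b)\<^sup>2 \<partial>Q)"
    and "integrable Q (\<lambda>x. (u \<bullet> x - b)\<^sup>2)"
proof -
  interpret prob_space Q by fact
  note q = cov_quadratic[OF Q i3, of u]
  let ?y = "\<lambda>x. u \<bullet> (x - mean_vec Q)" and ?d = "u \<bullet> mean_vec Q - b"
  have e: "(\<lambda>x. (u \<bullet> x - b)\<^sup>2) = (\<lambda>x. (?y x)\<^sup>2 + 2 * ?d * ?y x + ?d\<^sup>2)"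
    by (simp add: fun_eq_iff inner_diff_right power2_eq_square algebra_simps)
  show "integrable Q (\<lambda>x. (u \<bullet> x - b)\<^sup>2)"
    unfolding e by (intro Bochner_Integration.integrable_add integrable_mult_right q integrable_const)
  have "(\<integral>x. (u \<bullet> x - b)\<^sup>2 \<partial>Q) = (\<integral>x. (?y x)\<^sup>2 \<partial>Q) + 2 * ?d * (\<integral>x. ?y x \<partial>Q) + ?d\<^sup>2"
    unfolding e using q(2,3) prob_space by simp
  then show "u \<bullet> (cov_mat Q *v u) \<le> (\<integral>x. (u \<bullet> x - b)\<^sup>2 \<partial>Q)"
    using q(1,4) by simp
qed

text \<open>The law of one summand. \<open>atomless\<close> excludes ties for the largest norm as
  well as an atom at the origin; \<open>ball_pos\<close> and \<open>nondegenerate\<close> make every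
  truncated law a probability law with positive definite covariance.\<close>

locale norm_law =
  fixes P :: "(real^'d) measure" and N :: "real^'d \<Rightarrow> real"
  assumes prob_P: "prob_space P" and sets_P [measurable_cong, simp]: "sets P = sets borel"
    and norm_N: "is_norm N"
    and atomless: "measure P {x. N x = t} = 0"
    and ball_pos: "y > 0 \<Longrightarrow> measure P {x. N x \<le> y} > 0"
    and nondegenerate: "y > 0 \<Longrightarrow> a \<noteq> 0 \<Longrightarrow> measure P {x. N x \<le> y \<and> a \<bullet> x = b} < measure P {x. N x \<le> y}"
begin

sublocale prob_space P by (rule prob_P)

lemma space_P [simp]: "space P = UNIV"
  using sets_eq_imp_space_eq[OF sets_P] by simp

lemma N_measurable [measurable]: "N \<in> borel_measurable borel"
  using norm_bounds(3)[OF norm_N] by (rule borel_measurable_continuous_onI)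

lemma N_nonneg [simp]: "0 \<le> N x" by (rule norm_bounds(4)[OF norm_N])
lemma N_zero [simp]: "N x = 0 \<longleftrightarrow> x = 0" by (rule norm_bounds(5)[OF norm_N])
lemma N_pos: "N x > 0 \<longleftrightarrow> x \<noteq> 0" using N_nonneg[of x] N_zero[of x] by (auto simp: less_le)

definition F :: "real \<Rightarrow> real" where "F y = measure P {x. N x \<le> y}"

definition trunc :: "real \<Rightarrow> (real^'d) measure" where "trunc y = uniform_measure P {x. N x \<le> y}"

lemma F_pos: "y > 0 \<Longrightarrow> F y > 0" by (simp add: F_def ball_pos)
lemma F_le_1: "F y \<le> 1" by (simp add: F_def)
lemma F_nonneg [simp]: "0 \<le> F y" by (simp add: F_def)
lemma F_mono: "x \<le> y \<Longrightarrow> F x \<le> F y" unfolding F_def by (intro finite_measure_mono) auto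

lemma sets_trunc [simp, measurable_cong]: "sets (trunc y) = sets borel" by (simp add: trunc_def)

lemma prob_trunc: assumes "y > 0" shows "prob_space (trunc y)"
  unfolding trunc_def using ball_pos[OF assms] by (intro prob_space_uniform_measure) (auto simp: emeasure_eq_measure)

lemma integral_trunc:
  fixes f :: "real^'d \<Rightarrow> real"
  assumes "f \<in> borel_measurable borel" "y > 0"
  shows "(\<integral>x. f x \<partial>trunc y) = (\<integral>x. f x * indicator {x. N x \<le> y} x \<partial>P) / F y"
    and "integrable (trunc y) f \<longleftrightarrow> integrable P (\<lambda>x. f x * indicator {x. N x \<le> y} x)"
  unfolding trunc_def F_def using assms ball_pos[OF assms(2)] by (intro integral_uniform_measure; simp)+

lemma AE_trunc: "AE x in trunc y. N x \<le> y"
  unfolding trunc_def by (intro AE_uniform_measureI) auto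

lemma trunc_integrable_moment3:
  assumes y: "y > 0" shows "integrable (trunc y) (\<lambda>x. norm (x - m) ^ 3)"
proof -
  interpret t: prob_space "trunc y" by (rule prob_trunc[OF y])
  obtain K where K: "K > 0" "\<And>x. norm x \<le> K * N x" using norm_bounds(2)[OF norm_N] by blast
  show ?thesis
  proof (rule t.integrable_const_bound[where B="(K * y + norm m) ^ 3"])
    have "norm (x - m) \<le> K * y + norm m" if "N x \<le> y" for x
      using norm_triangle_ineq4[of x m] K(2)[of x] mult_left_mono[OF that, of K] K(1) by linarith
    then show "AE x in trunc y. norm (norm (x - m) ^ 3) \<le> (K * y + norm m) ^ 3"
      using AE_trunc[of y] by (auto intro!: power_mono elim!: eventually_mono)
  qed measurable
qed

lemmas trunc_cov = cov_quadratic[OF prob_trunc sets_trunc trunc_integrable_moment3]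
lemmas trunc_cov_le = cov_quadratic_le[OF prob_trunc sets_trunc trunc_integrable_moment3]

text \<open>A vanishing variance in direction u would put the truncated law on a hyperplane
  orthogonal to u.\<close>

lemma trunc_cov_pos:
  assumes y: "y > 0" and u: "u \<noteq> 0"
  shows "u \<bullet> (cov_mat (trunc y) *v u) > 0"
proof (rule ccontr)
  let ?m = "mean_vec (trunc y)"
  assume "\<not> ?thesis"
  moreover have "(\<integral>x. (u \<bullet> (x - ?m))\<^sup>2 \<partial>trunc y) \<ge> 0" by (rule Bochner_Integration.integral_nonneg) simp
  ultimately have "(\<integral>x. (u \<bullet> (x - ?m))\<^sup>2 \<partial>trunc y) = 0" using trunc_cov(1)[OF y y, of u] by simp
  then have "AE x in trunc y. (u \<bullet> (x - ?m))\<^sup>2 = 0"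
    using integral_nonneg_eq_0_iff_AE[OF trunc_cov(2)[OF y y, of u]] by simp
  then have "AE x in trunc y. x \<in> {x. u \<bullet> x = u \<bullet> ?m}" by eventually_elim (simp add: inner_diff_right)
  then have "measure (trunc y) {x. u \<bullet> x = u \<bullet> ?m} = 1"
    by (intro prob_space.prob_eq_1[OF prob_trunc[OF y], THEN iffD2]) auto
  then have "measure P ({x. N x \<le> y} \<inter> {x. u \<bullet> x = u \<bullet> ?m}) = measure P {x. N x \<le> y}"
    unfolding trunc_def using ball_pos[OF y] by (subst (asm) measure_uniform_measure) (auto simp: emeasure_eq_measure divide_simps)
  then show False
    using nondegenerate[OF y u, of "u \<bullet> ?m"] by (simp add: Collect_conj_eq)
qed

lemma trunc_cov_lower:
  assumes "y > 0" shows "\<exists>c>0. \<forall>u. c * (norm u)\<^sup>2 \<le> u \<bullet> (cov_mat (trunc y) *v u)"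
  by (rule posdef_lower_bound) (rule trunc_cov_pos[OF assms])

text \<open>The variance at level y, an integral over a ball containing the unit ball and divided by
  F y \<le> 1, is at least F 1 times a second moment of \<open>trunc 1\<close>, hence at least F 1
  times the variance at level 1. Down to y = 0 no such bound can hold, as truncation shrinks the
  covariance.\<close>

lemma trunc_cov_lower_uniform:
  "\<exists>c>0. \<forall>y\<ge>1. \<forall>u. c * (norm u)\<^sup>2 \<le> u \<bullet> (cov_mat (trunc y) *v u)"
proof -
  obtain c where c: "c > 0" "\<And>u. c * (norm u)\<^sup>2 \<le> u \<bullet> (cov_mat (trunc 1) *v u)"
    using trunc_cov_lower[of 1] by auto
  have "F 1 * c * (norm u)\<^sup>2 \<le> u \<bullet> (cov_mat (trunc y) *v u)" if y: "y \<ge> 1" for y u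
  proof -
    have y0: "y > 0" using y by simp
    let ?f = "\<lambda>x. (u \<bullet> (x - mean_vec (trunc y)))\<^sup>2"
    let ?I = "\<lambda>y x. ?f x * indicator {x. N x \<le> y} x"
    have f: "?f \<in> borel_measurable borel" by measurable
    have e: "?f x = (u \<bullet> x - u \<bullet> mean_vec (trunc y))\<^sup>2" for x by (simp add: inner_diff_right)
    have i1: "integrable P (?I 1)"
      using trunc_cov_le(2)[of 1 u "u \<bullet> mean_vec (trunc y)"] integral_trunc(2)[OF f, of 1] by (simp add: e)
    have iy: "integrable P (?I y)"
      using trunc_cov(2)[OF y0 y0, of u] integral_trunc(2)[OF f y0] by simp
    have "F 1 * (c * (norm u)\<^sup>2) \<le> F 1 * (u \<bullet> (cov_mat (trunc 1) *v u))"
      using c by (intro mult_left_mono) auto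
    also have "\<dots> \<le> F 1 * (\<integral>x. ?f x \<partial>trunc 1)"
      unfolding e by (intro mult_left_mono trunc_cov_le(1)) auto
    also have "\<dots> = (\<integral>x. ?I 1 x \<partial>P)"
      using integral_trunc(1)[OF f, of 1] F_pos[of 1] by simp
    also have "\<dots> \<le> (\<integral>x. ?I y x \<partial>P)"
      using y by (intro Bochner_Integration.integral_mono i1 iy) (auto simp: indicator_def)
    also have "\<dots> = F y * (\<integral>x. ?f x \<partial>trunc y)"
      using integral_trunc(1)[OF f y0] F_pos[OF y0] by simp
    also have "\<dots> \<le> 1 * (\<integral>x. ?f x \<partial>trunc y)"
      by (intro mult_right_mono F_le_1 Bochner_Integration.integral_nonneg) simp
    also have "\<dots> = u \<bullet> (cov_mat (trunc y) *v u)" using trunc_cov(1)[OF y0 y0] by simp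
    finally show ?thesis by (simp add: mult.assoc)
  qed
  moreover have "F 1 * c > 0" using c F_pos[of 1] by simp
  ultimately show ?thesis by blast
qed

lemma trunc_moment_le:
  assumes f: "f \<in> borel_measurable borel" "\<And>x. 0 \<le> f x" and i: "integrable P f" and y: "y \<ge> 1"
  shows "(\<integral>x. f x \<partial>trunc y) \<le> (\<integral>x. f x \<partial>P) / F 1" "integrable (trunc y) f"
proof -
  have y0: "y > 0" using y by simp
  have ii: "integrable P (\<lambda>x. f x * indicator {x. N x \<le> y} x)"
    by (rule Bochner_Integration.integrable_bound[OF i]) (use f in \<open>auto simp: indicator_def\<close>)
  then show "integrable (trunc y) f" using integral_trunc(2)[OF f(1) y0] by simp
  have "(\<integral>x. f x \<partial>trunc y) = (\<integral>x. f x * indicator {x. N x \<le> y} x \<partial>P) / F y"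
    by (rule integral_trunc(1)[OF f(1) y0])
  also have "\<dots> \<le> (\<integral>x. f x \<partial>P) / F 1"
  proof (rule frac_le)
    show "(\<integral>x. f x * indicator {x. N x \<le> y} x \<partial>P) \<le> (\<integral>x. f x \<partial>P)"
      by (intro Bochner_Integration.integral_mono ii i) (use f in \<open>auto simp: indicator_def\<close>)
  qed (use f F_pos[of 1] F_mono[OF y] in \<open>auto intro!: Bochner_Integration.integral_nonneg\<close>)
  finally show "(\<integral>x. f x \<partial>trunc y) \<le> (\<integral>x. f x \<partial>P) / F 1" .
qed

text \<open>The cube is split into exponents 3 - p and p: the first factor is at most a multiple of
  y on the truncation ball, the second has a bounded integral. The truncated mean therefore needs
  two bounds, one linear in y and one constant.\<close>

lemma trunc_moment3_growth:
  assumes p: "1 \<le> p" "p \<le> 3" and ip: "integrable P (\<lambda>x. N x powr p)"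
  shows "\<exists>C\<ge>0. \<forall>y\<ge>1. (\<integral>x. norm (x - mean_vec (trunc y)) ^ 3 \<partial>trunc y) \<le> C * y powr (3 - p)"
proof -
  obtain K where K: "K > 0" "\<And>x. norm x \<le> K * N x" using norm_bounds(2)[OF norm_N] by blast
  have iN: "integrable P N"
  proof (rule Bochner_Integration.integrable_bound[of _ "\<lambda>x. 1 + N x powr p"])
    have "N x \<le> 1 + N x powr p" for x
    proof (cases "N x \<le> 1")
      case False
      then have "N x powr 1 \<le> N x powr p" using p by (intro powr_mono) auto
      then show ?thesis using False by simp
    qed (simp add: add_increasing2)
    then show "AE x in P. norm (N x) \<le> norm (1 + N x powr p)" by simp
  qed (use ip in auto)
  define m1 where "m1 = CARD('d) * K * (\<integral>x. N x \<partial>P) / F 1"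
  define mp where "mp = (\<integral>x. N x powr p \<partial>P) / F 1"
  have mp0: "mp \<ge> 0" unfolding mp_def by (intro divide_nonneg_nonneg Bochner_Integration.integral_nonneg) auto
  have m10: "m1 \<ge> 0" unfolding m1_def using K by (intro divide_nonneg_nonneg mult_nonneg_nonneg Bochner_Integration.integral_nonneg) auto
  define C where "C = ((1 + CARD('d)) * K) powr (3 - p) * (2 powr p * (K powr p * mp + m1 powr p))"
  have C0: "C \<ge> 0" unfolding C_def using mp0 by (intro mult_nonneg_nonneg add_nonneg_nonneg) auto
  have "(\<integral>x. norm (x - mean_vec (trunc y)) ^ 3 \<partial>trunc y) \<le> C * y powr (3 - p)" if y: "y \<ge> 1" for y
  proof -
    have y0: "y > 0" using y by simp
    interpret t: prob_space "trunc y" by (rule prob_trunc[OF y0])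
    let ?m = "mean_vec (trunc y)"
    have iNt: "integrable (trunc y) N" "integrable (trunc y) (\<lambda>x. N x powr p)"
      using trunc_moment_le(2)[OF _ _ _ y] iN ip by auto
    have mi: "\<bar>?m $ i\<bar> \<le> K * (\<integral>x. N x \<partial>trunc y)" for i
    proof -
      have "\<bar>?m $ i\<bar> \<le> (\<integral>x. \<bar>x $ i\<bar> \<partial>trunc y)"
        unfolding mean_vec_def vec_lambda_beta by (rule integral_abs_bound)
      also have "\<dots> \<le> (\<integral>x. K * N x \<partial>trunc y)"
        by (rule integral_mono') (use iNt K in \<open>auto intro: order_trans[OF component_le_norm_cart]\<close>)
      finally show ?thesis by simp
    qed
    have nm: "norm ?m \<le> CARD('d) * (K * (\<integral>x. N x \<partial>trunc y))"
      using norm_le_l1_cart[of ?m] sum_bounded_above[of UNIV "\<lambda>i. \<bar>?m $ i\<bar>", OF mi] by simp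
    have nm1: "norm ?m \<le> m1"
    proof -
      note nm
      also have "CARD('d) * (K * (\<integral>x. N x \<partial>trunc y)) \<le> CARD('d) * (K * ((\<integral>x. N x \<partial>P) / F 1))"
        using trunc_moment_le(1)[OF _ _ iN y] K(1) by (intro mult_left_mono) auto
      finally show ?thesis by (simp add: m1_def mult.assoc)
    qed
    have nmy: "norm ?m \<le> CARD('d) * K * y"
    proof -
      have "(\<integral>x. N x \<partial>trunc y) \<le> (\<integral>x. y \<partial>trunc y)"
        by (rule integral_mono_AE) (use iNt AE_trunc[of y] in auto)
      also have "\<dots> = y" using t.prob_space by simp
      finally have "K * (\<integral>x. N x \<partial>trunc y) \<le> K * y" using K(1) by (intro mult_left_mono) simp_all
      then have "CARD('d) * (K * (\<integral>x. N x \<partial>trunc y)) \<le> CARD('d) * (K * y)" by (rule mult_left_mono) simp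
      from order_trans[OF nm this] show ?thesis by (simp add: mult.assoc)
    qed
    let ?c = "((1 + CARD('d)) * K * y) powr (3 - p)"
    have pw: "norm (x - ?m) ^ 3 \<le> ?c * (2 powr p * (K powr p * N x powr p + m1 powr p))" if Nx: "N x \<le> y" for x
    proof (cases "x = ?m")
      case True
      then show ?thesis by (simp add: add_nonneg_nonneg)
    next
      case False
      have le1: "norm (x - ?m) \<le> (1 + CARD('d)) * K * y"
      proof -
        have "K * N x \<le> K * y" using Nx K(1) by (intro mult_left_mono) auto
        then have "norm (x - ?m) \<le> K * y + CARD('d) * K * y"
          using norm_triangle_ineq4[of x ?m] K(2)[of x] nmy by linarith
        then show ?thesis by (simp add: algebra_simps)
      qed
      have "norm (x - ?m) \<le> norm x + norm ?m" by (rule norm_triangle_ineq4)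
      also have "\<dots> \<le> 2 * max (norm x) (norm ?m)" by simp
      finally have "norm (x - ?m) powr p \<le> (2 * max (norm x) (norm ?m)) powr p"
        using p by (intro powr_mono2) auto
      also have "\<dots> = 2 powr p * max (norm x) (norm ?m) powr p" by (simp add: powr_mult)
      also have "max (norm x) (norm ?m) powr p \<le> norm x powr p + norm ?m powr p"
        by (cases "norm x \<le> norm ?m") (simp_all add: max_def)
      also have "norm x powr p + norm ?m powr p \<le> (K * N x) powr p + m1 powr p"
        using p K nm1 by (intro add_mono powr_mono2) auto
      also have "(K * N x) powr p = K powr p * N x powr p" using K(1) by (simp add: powr_mult)
      finally have 2: "norm (x - ?m) powr p \<le> 2 powr p * (K powr p * N x powr p + m1 powr p)"
        by simp
      have "norm (x - ?m) ^ 3 = norm (x - ?m) powr (3 - p) * norm (x - ?m) powr p"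
        using False powr_realpow[of "norm (x - ?m)" 3] by (simp flip: powr_add)
      also have "\<dots> \<le> ?c * (2 powr p * (K powr p * N x powr p + m1 powr p))"
        using 2 p le1 by (intro mult_mono powr_mono2) auto
      finally show ?thesis .
    qed
    have "(\<integral>x. norm (x - ?m) ^ 3 \<partial>trunc y) \<le> (\<integral>x. ?c * (2 powr p * (K powr p * N x powr p + m1 powr p)) \<partial>trunc y)"
    proof (rule integral_mono_AE)
      show "AE x in trunc y. norm (x - ?m) ^ 3 \<le> ?c * (2 powr p * (K powr p * N x powr p + m1 powr p))"
        using AE_trunc[of y] by eventually_elim (rule pw)
    qed (use iNt trunc_integrable_moment3[OF y0] in auto)
    also have "\<dots> = ?c * (2 powr p * (K powr p * (\<integral>x. N x powr p \<partial>trunc y) + m1 powr p))"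
      using iNt t.prob_space by simp
    also have "\<dots> \<le> ?c * (2 powr p * (K powr p * mp + m1 powr p))"
      unfolding mp_def using trunc_moment_le(1)[OF _ _ ip y] by (intro mult_left_mono add_right_mono) auto
    also have "\<dots> = C * y powr (3 - p)"
      unfolding C_def using K(1) y0 by (simp add: powr_mult mult_ac)
    finally show ?thesis .
  qed
  with C0 show ?thesis by blast
qed

end

section \<open>Splitting off the largest summand\<close>

context norm_law
begin

abbreviation iid :: "'i set \<Rightarrow> ('i \<Rightarrow> real^'d) measure" where
  "iid J \<equiv> PiM J (\<lambda>_. P)"

text \<open>A product of indicators, so that Fubini can peel off one coordinate at a time.\<close>

abbreviation below :: "real \<Rightarrow> 'i set \<Rightarrow> ('i \<Rightarrow> real^'d) \<Rightarrow> real" where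
  "below y J w \<equiv> (\<Prod>j\<in>J. indicator {x. N x \<le> y} (w j))"

lemma indicator_le_eq: "indicator {x. N x \<le> y} v = (if N v \<le> y then 1 else 0 :: real)"
  by (simp add: indicator_def)

lemma below_bounds: "0 \<le> below y J w" "below y J w \<le> 1"
  by (auto intro!: prod_nonneg prod_le_1 simp: indicator_def)

lemma prob_PJ: "prob_space (iid J)"
  by (rule prob_space_PiM) (rule prob_P)

text \<open>Restricting P to the ball gives \<open>F y\<close> times \<open>trunc y\<close>, and the
  restriction of a product law to a product set is again a product. The sum of the coordinates is
  thus distributed as a convolution power, with one factor \<open>F y\<close> for each
  coordinate.\<close>

lemma nn_integral_below:
  fixes f :: "real^'d \<Rightarrow> ennreal" and J :: "'i set"
  assumes "finite J" and y: "y > 0" and "f \<in> borel_measurable borel"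
  shows "(\<integral>\<^sup>+w. f (\<Sum>j\<in>J. w j) * ennreal (below y J w) \<partial>iid J)
    = ennreal (F y) ^ card J * (\<integral>\<^sup>+s. f s \<partial>convpow (trunc y) (card J))"
  using \<open>finite J\<close> \<open>f \<in> borel_measurable borel\<close>
proof (induction J arbitrary: f rule: finite_induct)
  case empty
  interpret product_sigma_finite "\<lambda>_::'i. P" by standard
  show ?case using empty using prob_space.emeasure_space_1[OF prob_PJ[of "{} :: 'i set"]] by (simp add: nn_integral_empty nn_integral_return)
next
  case (insert j J)
  interpret product_sigma_finite "\<lambda>_::'i. P" by standard
  interpret t: prob_space "trunc y" by (rule prob_trunc[OF y])
  note [measurable] = insert.prems
  let ?A = "{x. N x \<le> y}"
  define g where "g s = (\<integral>\<^sup>+x. f (s + x) \<partial>trunc y)" for s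
  have g[measurable]: "g \<in> borel_measurable borel"
    unfolding g_def by measurable
  have gA: "(\<integral>\<^sup>+x. f (s + x) * indicator ?A x \<partial>P) = ennreal (F y) * g s" for s
  proof -
    have "g s = (\<integral>\<^sup>+x. f (s + x) * indicator ?A x \<partial>P) / ennreal (F y)"
      unfolding g_def trunc_def F_def
      by (subst nn_integral_uniform_measure) (auto simp: emeasure_eq_measure)
    then show ?thesis
      using F_pos[OF y] by (simp add: ennreal_times_divide mult.commute ennreal_mult_divide_eq flip: ennreal_times_divide)
         (metis ennreal_eq_0_iff ennreal_mult_divide_eq ennreal_neq_top ennreal_times_divide linorder_not_le mult.commute)
  qed
  have "(\<integral>\<^sup>+w. f (\<Sum>j\<in>insert j J. w j) * ennreal (below y (insert j J) w) \<partial>iid (insert j J))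
    = (\<integral>\<^sup>+w. \<integral>\<^sup>+x. f (\<Sum>k\<in>insert j J. (w(j := x)) k) * ennreal (below y (insert j J) (w(j := x))) \<partial>P \<partial>iid J)"
    using insert.hyps by (subst product_nn_integral_insert) auto
  also have "\<dots> = (\<integral>\<^sup>+w. \<integral>\<^sup>+x. (f ((\<Sum>k\<in>J. w k) + x) * indicator ?A x) * ennreal (below y J w) \<partial>P \<partial>iid J)"
  proof (intro nn_integral_cong)
    fix w :: "'i \<Rightarrow> real^'d" and x :: "real^'d"
    have s: "(\<Sum>k\<in>J. (w(j := x)) k) = (\<Sum>k\<in>J. w k)"
      using insert.hyps by (intro sum.cong) auto
    have p: "below y J (w(j := x)) = below y J w"
      using insert.hyps by (intro prod.cong) auto
    have "(\<Sum>k\<in>insert j J. (w(j := x)) k) = (\<Sum>k\<in>J. w k) + x"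
      using insert.hyps s by (simp add: add.commute)
    moreover have "below y (insert j J) (w(j := x)) = indicator ?A x * below y J w"
      using insert.hyps p by simp
    ultimately show "f (\<Sum>k\<in>insert j J. (w(j := x)) k) * ennreal (below y (insert j J) (w(j := x)))
      = (f ((\<Sum>k\<in>J. w k) + x) * indicator ?A x) * ennreal (below y J w)"
      by (simp add: indicator_def)
  qed
  also have "\<dots> = (\<integral>\<^sup>+w. (ennreal (F y) * g (\<Sum>k\<in>J. w k)) * ennreal (below y J w) \<partial>iid J)"
    by (intro nn_integral_cong) (subst nn_integral_multc, auto simp: gA)
  also have "\<dots> = ennreal (F y) * (\<integral>\<^sup>+w. g (\<Sum>k\<in>J. w k) * ennreal (below y J w) \<partial>iid J)"
    by (subst nn_integral_cmult[symmetric]) (auto simp: mult.assoc)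
  also have "\<dots> = ennreal (F y) * (ennreal (F y) ^ card J * (\<integral>\<^sup>+s. g s \<partial>convpow (trunc y) (card J)))"
    by (subst insert.IH) auto
  also have "(\<integral>\<^sup>+s. g s \<partial>convpow (trunc y) (card J)) = (\<integral>\<^sup>+s. f s \<partial>convpow (trunc y) (card (insert j J)))"
    unfolding g_def using insert.hyps prob_space_convpow[OF prob_trunc[OF y] sets_trunc]
    by (simp add: nn_integral_convolution prob_space.finite_measure t.finite_measure_axioms)
  finally show ?case using insert.hyps by (simp add: mult.assoc)
qed

lemma integral_below:
  fixes f :: "real^'d \<Rightarrow> real" and J :: "'i set"
  assumes J: "finite J" and y: "y > 0" and [measurable]: "f \<in> borel_measurable borel" and f: "\<And>x. 0 \<le> f x" "\<And>x. f x \<le> 1"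
  shows "(\<integral>w. f (\<Sum>j\<in>J. w j) * below y J w \<partial>iid J)
    = F y ^ card J * (\<integral>s. f s \<partial>convpow (trunc y) (card J))"
proof -
  interpret c: prob_space "convpow (trunc y) (card J)" by (rule prob_space_convpow[OF prob_trunc[OF y] sets_trunc])
  have ic: "integrable (convpow (trunc y) (card J)) f"
    by (rule c.integrable_const_bound[where B=1]) (use f in auto)
  have "(\<integral>\<^sup>+w. ennreal (f (\<Sum>j\<in>J. w j) * below y J w) \<partial>iid J) = ennreal (F y ^ card J * (\<integral>s. f s \<partial>convpow (trunc y) (card J)))"
    using nn_integral_below[OF J y, of "\<lambda>x. ennreal (f x)"] f
    by (simp add: ennreal_mult' ennreal_power nn_integral_eq_integral[OF ic] below_bounds ennreal_mult Bochner_Integration.integral_nonneg)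
  then show ?thesis
    by (subst integral_eq_nn_integral)
       (auto simp: f below_bounds Bochner_Integration.integral_nonneg intro!: mult_nonneg_nonneg AE_I2)
qed

end

locale norm_sample = norm_law P N + M: prob_space M
  for P :: "(real^'d) measure" and N :: "real^'d \<Rightarrow> real" and M :: "'b measure" +
  fixes X :: "nat \<Rightarrow> 'b \<Rightarrow> real^'d"
  assumes indep: "M.indep_vars (\<lambda>_. borel) X UNIV"
    and law: "\<And>i. distr M borel (X i) = P"
begin

lemma X_measurable [measurable]: "X i \<in> borel_measurable M"
  using indep by (simp add: M.indep_vars_def)

lemma joint_law:
  assumes "n \<ge> 1"
  shows "distr M (PiM {..<n} (\<lambda>_. borel)) (\<lambda>\<omega>. \<lambda>i\<in>{..<n}. X i \<omega>) = PiM {..<n} (\<lambda>_. P)"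
proof -
  have "M.indep_vars (\<lambda>_. borel) X {..<n}"
    by (rule M.indep_vars_subset[OF indep]) simp
  then show ?thesis
    using assms by (subst (asm) M.indep_vars_iff_distr_eq_PiM') (auto simp: law lessThan_empty_iff)
qed

lemma nn_integral_sample:
  assumes i: "i < n" and G: "G \<in> borel_measurable (PiM {..<n} (\<lambda>_. borel))"
  shows "(\<integral>\<^sup>+\<omega>. G (\<lambda>i\<in>{..<n}. X i \<omega>) \<partial>M)
    = (\<integral>\<^sup>+y. \<integral>\<^sup>+w. G (w(i := y)) \<partial>PiM ({..<n} - {i}) (\<lambda>_. P) \<partial>P)"
proof -
  interpret product_sigma_finite "\<lambda>_::nat. P" by standard
  have ins: "{..<n} = insert i ({..<n} - {i})" using i by auto
  have sets: "sets (PiM {..<n} (\<lambda>_. P)) = sets (PiM {..<n} (\<lambda>_. borel))"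
    by (intro sets_PiM_cong) auto
  have G': "G \<in> borel_measurable (PiM {..<n} (\<lambda>_. P))"
    using G measurable_cong_sets[OF sets refl, of "borel :: ennreal measure"] by simp
  have "(\<integral>\<^sup>+\<omega>. G (\<lambda>i\<in>{..<n}. X i \<omega>) \<partial>M) = (\<integral>\<^sup>+w. G w \<partial>distr M (PiM {..<n} (\<lambda>_. borel)) (\<lambda>\<omega>. \<lambda>i\<in>{..<n}. X i \<omega>))"
    using G by (subst nn_integral_distr) auto
  also have "\<dots> = (\<integral>\<^sup>+w. G w \<partial>PiM (insert i ({..<n} - {i})) (\<lambda>_. P))"
    using i joint_law[of n] ins by simp
  also have "\<dots> = (\<integral>\<^sup>+y. \<integral>\<^sup>+w. G (w(i := y)) \<partial>PiM ({..<n} - {i}) (\<lambda>_. P) \<partial>P)"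
    using G' ins by (intro product_nn_integral_insert_rev) auto
  finally show ?thesis .
qed

text \<open>The weak inequality makes these events cover the space; they overlap only in ties, which
  \<open>no_ties\<close> shows to be null.\<close>

definition max_at :: "nat \<Rightarrow> nat \<Rightarrow> 'b set" where
  "max_at n i = {\<omega>\<in>space M. \<forall>j<n. N (X j \<omega>) \<le> N (X i \<omega>)}"

lemma max_at_measurable [measurable]: "max_at n i \<in> sets M"
  unfolding max_at_def by measurable

lemma P_not_0: "AE y in P. y \<noteq> 0"
proof -
  have "measure P {x. N x = 0} = 0" by (rule atomless)
  then have "emeasure P {0} = 0" by (simp add: emeasure_eq_measure)
  then show ?thesis by (subst AE_iff_measurable[of "{0}"]) auto
qed

text \<open>The contribution of summand i being largest with value y, where \<open>\<phi>\<close>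
  takes the maximum and the sum of the others. Keeping the fixed product law, instead of the
  convolution power of \<open>trunc (N y)\<close> from \<open>inner_part_eq\<close>, makes
  measurability in y immediate.\<close>

definition inner_part :: "nat \<Rightarrow> nat \<Rightarrow> (real^'d \<Rightarrow> real^'d \<Rightarrow> real) \<Rightarrow> real^'d \<Rightarrow> real" where
  "inner_part n i \<phi> y = (\<integral>w. \<phi> y (\<Sum>j\<in>{..<n} - {i}. w j) * below (N y) ({..<n} - {i}) w \<partial>iid ({..<n} - {i}))"

lemma inner_part_measurable [measurable]:
  assumes [measurable]: "case_prod \<phi> \<in> borel_measurable (borel \<Otimes>\<^sub>M borel)"
  shows "inner_part n i \<phi> \<in> borel_measurable borel"
proof -
  interpret p: prob_space "iid ({..<n} - {i})" by (rule prob_PJ)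
  show ?thesis unfolding inner_part_def indicator_le_eq by measurable
qed

lemma inner_part_eq:
  assumes [measurable]: "case_prod \<phi> \<in> borel_measurable (borel \<Otimes>\<^sub>M borel)"
    and f: "\<And>x y. 0 \<le> \<phi> x y" "\<And>x y. \<phi> x y \<le> 1" and i: "i < n" and y: "y \<noteq> 0"
  shows "inner_part n i \<phi> y = F (N y) ^ (n - 1) * (\<integral>s. \<phi> y s \<partial>convpow (trunc (N y)) (n - 1))"
proof -
  have c: "card ({..<n} - {i}) = n - 1" using i by simp
  have "\<phi> y \<in> borel_measurable borel" by measurable
  from integral_below[of "{..<n} - {i}", OF _ _ this] f y show ?thesis
    unfolding inner_part_def by (simp add: c N_pos)
qed

text \<open>By independence the coordinate i can be integrated last; with its value y fixed, being
  maximal is the condition \<open>below (N y)\<close> on the others.\<close>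

lemma integral_max_at:
  assumes [measurable]: "case_prod \<phi> \<in> borel_measurable (borel \<Otimes>\<^sub>M borel)"
    and f: "\<And>x y. 0 \<le> \<phi> x y" "\<And>x y. \<phi> x y \<le> 1" and i: "i < n"
  shows "(\<integral>\<omega>. \<phi> (X i \<omega>) (\<Sum>j\<in>{..<n} - {i}. X j \<omega>) * indicator (max_at n i) \<omega> \<partial>M) = (\<integral>y. inner_part n i \<phi> y \<partial>P)"
    and "integrable P (inner_part n i \<phi>)"
    and "\<And>y. 0 \<le> inner_part n i \<phi> y"
proof -
  let ?I = "{..<n} - {i}"
  interpret p: prob_space "iid ?I" by (rule prob_PJ)
  define G where "G w = ennreal (\<phi> (w i) (\<Sum>j\<in>?I. w j) * below (N (w i)) ?I w)" for w :: "nat \<Rightarrow> real^'d"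
  have sub: "(\<lambda>w. w j) \<in> borel_measurable (PiM {..<n} (\<lambda>_. borel :: (real^'d) measure))" if "j < n" for j
    using that by (intro measurable_component_singleton) simp
  have Gm: "G \<in> borel_measurable (PiM {..<n} (\<lambda>_. borel))"
  proof -
    have "(\<lambda>w. below (N (w i)) ?I w) \<in> borel_measurable (PiM {..<n} (\<lambda>_. borel))"
    proof (rule borel_measurable_prod)
      fix j assume "j \<in> ?I"
      then have "j < n" by simp
      show "(\<lambda>w. indicator {x. N x \<le> N (w i)} (w j) :: real) \<in> borel_measurable (PiM {..<n} (\<lambda>_. borel))"
        unfolding indicator_le_eq
        by (intro measurable_If borel_measurable_le measurable_compose[OF sub N_measurable] \<open>j < n\<close> i) auto
    qed
    moreover have "(\<lambda>w. \<Sum>j\<in>?I. w j) \<in> borel_measurable (PiM {..<n} (\<lambda>_. borel :: (real^'d) measure))"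
      by (intro borel_measurable_sum sub) simp
    moreover note [measurable] = sub[OF i]
    ultimately show ?thesis unfolding G_def by measurable
  qed
  have below_le: "\<phi> a b * below y J w \<le> 1" "0 \<le> \<phi> a b * below y J w" for a b y and J :: "nat set" and w
    using f below_bounds[of y w J] by (auto intro: mult_le_one mult_nonneg_nonneg)
  have ii: "integrable (iid ?I) (\<lambda>w. \<phi> y (\<Sum>j\<in>?I. w j) * below (N y) ?I w)" for y
  proof (rule p.integrable_const_bound[where B=1])
    show "(\<lambda>w. \<phi> y (\<Sum>j\<in>?I. w j) * below (N y) ?I w) \<in> borel_measurable (iid ?I)"
      unfolding indicator_le_eq by measurable
    show "AE w in iid ?I. norm (\<phi> y (\<Sum>j\<in>?I. w j) * below (N y) ?I w) \<le> 1"
      by (intro AE_I2) (simp only: real_norm_def abs_of_nonneg[OF below_le(2)] below_le(1))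
  qed
  show nn: "0 \<le> inner_part n i \<phi> y" for y
    unfolding inner_part_def by (intro Bochner_Integration.integral_nonneg below_le)
  have le1: "inner_part n i \<phi> y \<le> 1" for y
  proof -
    have "inner_part n i \<phi> y \<le> (\<integral>w. 1 \<partial>iid ?I)"
      unfolding inner_part_def by (intro Bochner_Integration.integral_mono ii below_le) auto
    then show ?thesis using p.prob_space by simp
  qed
  show ip: "integrable P (inner_part n i \<phi>)"
    by (rule integrable_const_bound[where B=1]) (use nn le1 in auto)
  have "(\<integral>\<^sup>+\<omega>. ennreal (\<phi> (X i \<omega>) (\<Sum>j\<in>?I. X j \<omega>) * indicator (max_at n i) \<omega>) \<partial>M) = (\<integral>\<^sup>+\<omega>. G (\<lambda>i\<in>{..<n}. X i \<omega>) \<partial>M)"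
  proof (rule nn_integral_cong)
    fix \<omega> assume \<omega>: "\<omega> \<in> space M"
    let ?w = "\<lambda>i\<in>{..<n}. X i \<omega>"
    have "indicator (max_at n i) \<omega> = below (N (X i \<omega>)) ?I (\<lambda>j. X j \<omega>)"
    proof (cases "\<omega> \<in> max_at n i")
      case True
      then show ?thesis by (auto simp: max_at_def intro!: prod.neutral[symmetric])
    next
      case False
      then obtain j where "j < n" "\<not> N (X j \<omega>) \<le> N (X i \<omega>)" using \<omega> by (auto simp: max_at_def)
      moreover from this have "j \<noteq> i" by auto
      ultimately have "below (N (X i \<omega>)) ?I (\<lambda>j. X j \<omega>) = 0"
        by (intro prod_zero bexI[of _ j]) auto
      then show ?thesis using False by simp
    qed
    also have "\<dots> = below (N (?w i)) ?I ?w" using i by (intro prod.cong) auto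
    finally have e: "indicator (max_at n i) \<omega> = below (N (?w i)) ?I ?w" .
    have s: "(\<Sum>j\<in>?I. X j \<omega>) = (\<Sum>j\<in>?I. ?w j)" by (intro sum.cong) auto
    show "ennreal (\<phi> (X i \<omega>) (\<Sum>j\<in>?I. X j \<omega>) * indicator (max_at n i) \<omega>) = G ?w"
      unfolding G_def e s using i by simp
  qed
  also have "\<dots> = (\<integral>\<^sup>+y. \<integral>\<^sup>+w. G (w(i := y)) \<partial>iid ?I \<partial>P)"
    by (rule nn_integral_sample[OF i Gm])
  also have "\<dots> = (\<integral>\<^sup>+y. ennreal (inner_part n i \<phi> y) \<partial>P)"
  proof (rule nn_integral_cong)
    fix y
    have "G (w(i := y)) = ennreal (\<phi> y (\<Sum>j\<in>?I. w j) * below (N y) ?I w)" for w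
    proof -
      have "(\<Sum>j\<in>?I. (w(i := y)) j) = (\<Sum>j\<in>?I. w j)" by (intro sum.cong) auto
      moreover have "below (N y) ?I (w(i := y)) = below (N y) ?I w" by (intro prod.cong) auto
      ultimately show ?thesis unfolding G_def by simp
    qed
    then show "(\<integral>\<^sup>+w. G (w(i := y)) \<partial>iid ?I) = ennreal (inner_part n i \<phi> y)"
      unfolding inner_part_def by (simp add: nn_integral_eq_integral[OF ii] below_le)
  qed
  also have "\<dots> = ennreal (\<integral>y. inner_part n i \<phi> y \<partial>P)"
    by (rule nn_integral_eq_integral[OF ip]) (simp add: nn)
  finally show "(\<integral>\<omega>. \<phi> (X i \<omega>) (\<Sum>j\<in>?I. X j \<omega>) * indicator (max_at n i) \<omega> \<partial>M) = (\<integral>y. inner_part n i \<phi> y \<partial>P)"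
    by (subst integral_eq_nn_integral) (auto simp: f nn Bochner_Integration.integral_nonneg intro!: AE_I2)
qed

text \<open>Conditionally on the other coordinates, a tie forces the norm of one summand to hit a
  fixed value, which has probability 0 by \<open>atomless\<close>.\<close>

lemma no_ties:
  assumes ij: "i < n" "j < n" "i \<noteq> j"
  shows "AE \<omega> in M. N (X i \<omega>) \<noteq> N (X j \<omega>)"
proof -
  let ?G = "\<lambda>w :: nat \<Rightarrow> real^'d. (if N (w i) = N (w j) then 1 else 0) :: ennreal"
  have sub: "(\<lambda>w. w j) \<in> borel_measurable (PiM {..<n} (\<lambda>_. borel :: (real^'d) measure))"
    "(\<lambda>w. w i) \<in> borel_measurable (PiM {..<n} (\<lambda>_. borel :: (real^'d) measure))"
    using ij by (auto intro: measurable_component_singleton)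
  note [measurable] = sub
  interpret product_sigma_finite "\<lambda>_::nat. P" by standard
  interpret p: prob_space "iid ({..<n} - {i})" by (rule prob_PJ)
  interpret pair_sigma_finite P "iid ({..<n} - {i})" ..
  have "(\<integral>\<^sup>+\<omega>. ?G (\<lambda>i\<in>{..<n}. X i \<omega>) \<partial>M) = (\<integral>\<^sup>+y. \<integral>\<^sup>+w. ?G (w(i := y)) \<partial>PiM ({..<n} - {i}) (\<lambda>_. P) \<partial>P)"
    by (rule nn_integral_sample[OF ij(1)]) measurable
  also have "\<dots> = (\<integral>\<^sup>+w. \<integral>\<^sup>+y. (if N y = N (w j) then 1 else 0) \<partial>P \<partial>iid ({..<n} - {i}))"
    using ij by (subst Fubini') (auto intro!: nn_integral_cong)
  also have "\<dots> = 0"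
  proof -
    have "(\<integral>\<^sup>+y. (if N y = t then 1 else 0) \<partial>P) = (\<integral>\<^sup>+y. indicator {x. N x = t} y \<partial>P)" for t
      by (intro nn_integral_cong) simp
    then show ?thesis using atomless by (simp add: emeasure_eq_measure)
  qed
  finally have "(\<integral>\<^sup>+\<omega>. ?G (\<lambda>i\<in>{..<n}. X i \<omega>) \<partial>M) = 0" .
  then have "AE \<omega> in M. ?G (\<lambda>i\<in>{..<n}. X i \<omega>) = 0"
    by (subst (asm) nn_integral_0_iff_AE) measurable
  then show ?thesis using ij by (auto simp: indicator_def elim!: eventually_mono)
qed

lemma max_at_unique:
  assumes "n \<ge> 1"
  shows "AE \<omega> in M. \<exists>i<n. \<forall>k<n. \<omega> \<in> max_at n k \<longleftrightarrow> k = i"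
proof -
  have "AE \<omega> in M. \<forall>i\<in>{..<n}. \<forall>j\<in>{..<n}. i \<noteq> j \<longrightarrow> N (X i \<omega>) \<noteq> N (X j \<omega>)"
    using no_ties by (intro AE_finite_allI) auto
  then show ?thesis
  proof (rule AE_mp, intro AE_I2 impI)
    fix \<omega> assume \<omega>: "\<omega> \<in> space M" and ne: "\<forall>i\<in>{..<n}. \<forall>j\<in>{..<n}. i \<noteq> j \<longrightarrow> N (X i \<omega>) \<noteq> N (X j \<omega>)"
    have "Max ((\<lambda>i. N (X i \<omega>)) ` {..<n}) \<in> (\<lambda>i. N (X i \<omega>)) ` {..<n}"
      using assms by (intro Max_in) (auto simp: lessThan_empty_iff)
    then obtain i where i: "i < n" "Max ((\<lambda>i. N (X i \<omega>)) ` {..<n}) = N (X i \<omega>)" by auto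
    then have mx: "N (X k \<omega>) \<le> N (X i \<omega>)" if "k < n" for k
      using that by (metis Max_ge finite_imageI finite_lessThan imageI lessThan_iff)
    have "k = i" if "k < n" "\<omega> \<in> max_at n k" for k
    proof (rule ccontr)
      assume "k \<noteq> i"
      then have "N (X k \<omega>) \<noteq> N (X i \<omega>)" using ne that i by auto
      moreover have "N (X i \<omega>) \<le> N (X k \<omega>)" using that i by (auto simp: max_at_def)
      ultimately show False using mx[OF that(1)] by simp
    qed
    moreover have "\<omega> \<in> max_at n i" using mx \<omega> by (auto simp: max_at_def)
    ultimately show "\<exists>i<n. \<forall>k<n. \<omega> \<in> max_at n k \<longleftrightarrow> k = i" using i by blast
  qed
qed

end

section \<open>The normal part of the Normex law\<close>

lemma prob_space_gaussian: "prob_space (gaussian v \<Gamma> :: (real^'d) measure)"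
proof -
  have "prob_space (std_gaussian :: (real^'d) measure)"
    unfolding std_gaussian_eq_gauss by (rule prob_space_gauss) simp
  then show ?thesis
    unfolding gaussian_def by (rule prob_space.prob_space_distr) (simp add: std_gaussian_eq_gauss)
qed

lemma harm_le_ln: "n \<ge> 1 \<Longrightarrow> harm n \<le> 1 + ln (real n)"
proof (induction n rule: nat_induct_at_least)
  case (Suc n)
  have "ln (real n / real (Suc n)) \<le> real n / real (Suc n) - 1" using Suc.hyps by (intro ln_le_minus_one) auto
  also have "\<dots> = - (1 / real (Suc n))" by (simp add: field_simps)
  also have "ln (real n / real (Suc n)) = ln (real n) - ln (real (Suc n))" using Suc.hyps by (subst ln_divide_pos) simp_all
  finally have "1 / real (Suc n) \<le> ln (real (Suc n)) - ln (real n)" by simp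
  with Suc.IH show ?case by (simp add: harm_Suc divide_inverse)
qed (simp add: harm_def)

lemma harm_le_powr:
  assumes "\<eta> > 0" "n \<ge> 1"
  shows "harm n \<le> (1 + 1 / \<eta>) * real n powr \<eta>"
proof -
  have "1 \<le> real n powr \<eta>" using assms by (intro ge_one_powr_ge_zero) auto
  moreover have "ln (real n) \<le> real n powr \<eta> / \<eta>" using assms by (intro ln_powr_bound) auto
  ultimately show ?thesis using harm_le_ln[OF assms(2)] by (simp add: algebra_simps)
qed

lemma harm_div_sqrt_tendsto_0: "(\<lambda>k. harm k / sqrt (real k)) \<longlonglongrightarrow> 0"
proof (rule tendsto_sandwich[of "\<lambda>_. 0" _ _ "\<lambda>k. 5 * real k powr (- (1/4))"])
  show "\<forall>\<^sub>F k in sequentially. harm k / sqrt (real k) \<le> 5 * real k powr (- (1/4))"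
    using eventually_ge_at_top[of 1]
  proof eventually_elim
    case (elim k)
    have "harm k / sqrt (real k) \<le> (5 * real k powr (1/4)) / real k powr (1/2)"
      using harm_le_powr[of "1/4" k] elim by (simp add: powr_half_sqrt divide_right_mono)
    also have "\<dots> = 5 * (real k powr (1/4) / real k powr (1/2))" by simp
    also have "real k powr (1/4) / real k powr (1/2) = real k powr (- (1/4))"
      using elim by (simp add: powr_diff[symmetric])
    finally show ?case .
  qed
  have "(\<lambda>k. real k powr (- (1/4))) \<longlonglongrightarrow> 0"
    by (intro tendsto_neg_powr filterlim_real_sequentially) simp
  then show "(\<lambda>k. 5 * real k powr (- (1/4))) \<longlonglongrightarrow> 0" by (rule tendsto_mult_right_zero)
qed (auto simp: harm_nonneg)

context norm_law
begin

text \<open>The integrand of \<open>normex\<close> with its parameters read off P; the two agree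
  away from the origin.\<close>

definition normal_part :: "nat \<Rightarrow> (real^'d) set \<Rightarrow> real^'d \<Rightarrow> real" where
  "normal_part m B x = measure (gaussian (real m *\<^sub>R mean_vec (trunc (N x))) (real m *\<^sub>R cov_mat (trunc (N x)))) {u. u + x \<in> B}"

lemma normal_part_approx:
  assumes C: "berry_esseen_const TYPE('d) C" and x: "x \<noteq> 0"
    and c: "c > 0" "\<And>u. c * (norm u)\<^sup>2 \<le> u \<bullet> (cov_mat (trunc (N x)) *v u)"
    and m: "m \<ge> 1" and k: "k \<ge> 1" and B: "convex B" "B \<in> sets borel"
  defines "\<mu> \<equiv> mean_vec (trunc (N x))"
  shows "\<bar>measure (convpow (trunc (N x)) k) {w. real m *\<^sub>R \<mu> + sqrt (real m / real k) *\<^sub>R (w - real k *\<^sub>R \<mu>) + x \<in> B} - normal_part m B x\<bar>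
    \<le> C * ((\<integral>z. norm (z - \<mu>) ^ 3 \<partial>trunc (N x)) / sqrt c ^ 3) * harm k / sqrt k"
proof -
  have y: "N x > 0" using x by (simp add: N_pos)
  show ?thesis
    unfolding \<mu>_def normal_part_def
    using normal_approx[OF C prob_trunc[OF y] sets_trunc trunc_integrable_moment3[OF y] c _ k convex_shift_set[OF B, of x], of "real m" "real m *\<^sub>R mean_vec (trunc (N x))"] m
    by simp
qed

lemma normal_part_bounds: "0 \<le> normal_part m B x" "normal_part m B x \<le> 1"
proof -
  show "0 \<le> normal_part m B x" by (simp add: normal_part_def)
  show "normal_part m B x \<le> 1"
    unfolding normal_part_def by (rule prob_space.prob_le_1[OF prob_space_gaussian])
qed

text \<open>The truncated mean as a parameter integral against the fixed law P, a form in which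
  measurability in x is evident.\<close>

definition mean_fun :: "real^'d \<Rightarrow> real^'d" where
  "mean_fun x = (\<chi> i. (\<integral>z. z $ i * (if N z \<le> N x then 1 else 0) \<partial>P) / F (N x))"

lemma F_N_measurable [measurable]: "(\<lambda>x. F (N x)) \<in> borel_measurable borel"
proof -
  have "mono F" by (intro monoI F_mono)
  then have [measurable]: "F \<in> borel_measurable borel" by (rule borel_measurable_mono)
  show ?thesis by measurable
qed

lemma vec_lambda_measurable:
  fixes f :: "'a \<Rightarrow> real^'d"
  assumes "\<And>i. (\<lambda>x. f x $ i) \<in> borel_measurable M"
  shows "f \<in> borel_measurable M"
proof -
  have "(\<lambda>x. \<Sum>i\<in>UNIV. (f x $ i) *\<^sub>R (axis i 1 :: real^'d)) \<in> borel_measurable M"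
    by (intro borel_measurable_sum borel_measurable_scaleR assms measurable_const) simp
  moreover have "(\<Sum>i\<in>UNIV. (f x $ i) *\<^sub>R axis i 1) = f x" for x
    using basis_expansion[of "f x"] by (simp add: scalar_mult_eq_scaleR)
  ultimately show ?thesis by simp
qed

lemma mean_fun_measurable [measurable]: "mean_fun \<in> borel_measurable borel"
proof (rule vec_lambda_measurable)
  fix i
  show "(\<lambda>x. mean_fun x $ i) \<in> borel_measurable borel"
    unfolding mean_fun_def vec_lambda_beta by measurable
qed

lemma mean_fun_eq: assumes "x \<noteq> 0" shows "mean_fun x = mean_vec (trunc (N x))"
proof -
  have y: "N x > 0" using assms by (simp add: N_pos)
  have "(\<integral>z. z $ i * (if N z \<le> N x then 1 else 0) \<partial>P) = (\<integral>z. z $ i * indicator {z. N z \<le> N x} z \<partial>P)" for i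
    by (simp add: indicator_le_eq)
  then show ?thesis
    using integral_trunc(1)[OF _ y] by (simp add: mean_fun_def mean_vec_def vec_eq_iff)
qed

end

context norm_sample
begin

text \<open>The covariance enters the Gaussian only through an unspecified square root; measurability is
  obtained from the central limit theorem instead of from an explicit density.\<close>
lemma normal_part_measurable:
  assumes BE: "berry_esseen_const TYPE('d) C" and m: "m \<ge> 1" and B: "convex B" and [measurable]: "B \<in> sets borel"
  shows "normal_part m B \<in> borel_measurable borel"
proof -
  \<comment> \<open>The k-fold sum, centred, rescaled from k to m units of variance and recentred,
    tested against B: by \<open>normal_part_approx\<close> its probabilities converge to the normal
    part as k grows with m fixed.\<close>
  define \<phi> where "\<phi> k x w = indicat_real B (real m *\<^sub>R mean_fun x + sqrt (real m / real k) *\<^sub>R (w - real k *\<^sub>R mean_fun x) + x)" for k :: nat and x w :: "real^'d"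
  have \<phi>m [measurable]: "case_prod (\<phi> k) \<in> borel_measurable (borel \<Otimes>\<^sub>M borel)" for k
    unfolding \<phi>_def by measurable
  have \<phi>b: "0 \<le> \<phi> k x w" "\<phi> k x w \<le> 1" for k x w by (simp_all add: \<phi>_def indicator_le_1)
  \<comment> \<open>With Suc k summands the sum of the others has exactly k terms, and dividing by
    the k-th power of F undoes the restriction. The origin, where the truncated law is degenerate,
    simply receives the limit value.\<close>
  define u where "u k x = (if x = 0 then normal_part m B 0 else inner_part (Suc k) k (\<phi> k) x / F (N x) ^ k)" for k x
  show ?thesis
  proof (rule borel_measurable_LIMSEQ_real)
    show "u k \<in> borel_measurable borel" for k unfolding u_def by measurable
    fix x :: "real^'d"
    show "(\<lambda>k. u k x) \<longlonglongrightarrow> normal_part m B x"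
    proof (cases "x = 0")
      case False
      then have y: "N x > 0" by (simp add: N_pos)
      let ?\<mu> = "mean_vec (trunc (N x))"
      obtain c where c: "c > 0" "\<And>u. c * (norm u)\<^sup>2 \<le> u \<bullet> (cov_mat (trunc (N x)) *v u)"
        using trunc_cov_lower[OF y] by blast
      let ?K = "C * ((\<integral>z. norm (z - ?\<mu>) ^ 3 \<partial>trunc (N x)) / sqrt c ^ 3)"
      have "u k x = measure (convpow (trunc (N x)) k) {w. real m *\<^sub>R ?\<mu> + sqrt (real m / real k) *\<^sub>R (w - real k *\<^sub>R ?\<mu>) + x \<in> B}" for k
      proof -
        let ?S = "{w. real m *\<^sub>R ?\<mu> + sqrt (real m / real k) *\<^sub>R (w - real k *\<^sub>R ?\<mu>) + x \<in> B}"
        have S: "?S \<in> sets borel"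
          using measurable_sets_borel[of "\<lambda>w. real m *\<^sub>R ?\<mu> + sqrt (real m / real k) *\<^sub>R (w - real k *\<^sub>R ?\<mu>) + x" borel B]
          by (simp add: vimage_def)
        have "u k x = (\<integral>s. \<phi> k x s \<partial>convpow (trunc (N x)) k)"
          using inner_part_eq[OF \<phi>m \<phi>b _ False, of k "Suc k" k] False F_pos[OF y] by (simp add: u_def)
        also have "\<dots> = (\<integral>s. indicator ?S s \<partial>convpow (trunc (N x)) k)"
          by (simp add: \<phi>_def mean_fun_eq[OF False] indicator_def)
        also have "\<dots> = measure (convpow (trunc (N x)) k) ?S"
          using S sets_eq_imp_space_eq[OF sets_convpow, of "trunc (N x)" k] by simp
        finally show ?thesis .
      qed
      then have "\<forall>\<^sub>F k in sequentially. norm (u k x - normal_part m B x) \<le> ?K * (harm k / sqrt k)"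
        using normal_part_approx[OF BE False c m _ B] by (intro eventually_sequentiallyI[of 1]) auto
      moreover have "(\<lambda>k. ?K * (harm k / sqrt (real k))) \<longlonglongrightarrow> 0"
        by (rule tendsto_mult_right_zero[OF harm_div_sqrt_tendsto_0])
      ultimately have "(\<lambda>k. u k x - normal_part m B x) \<longlonglongrightarrow> 0"
        by (rule Lim_null_comparison)
      then show ?thesis by (rule LIM_zero_cancel)
    qed (simp add: u_def)
  qed
qed

text \<open>The chosen index is a fixed function of the random finite set of maximisers, so each
  preimage is a finite union, over subsets S of the index set, of events that S is that set.\<close>

lemma argmax_measurable: "(\<lambda>\<omega>. ARG_MAX (\<lambda>i. N (X i \<omega>)) i. i < n) \<in> measurable M (count_space UNIV)"
proof (subst measurable_count_space_eq2_countable, intro conjI ballI)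
  fix a :: nat
  define J where "J \<omega> = {i\<in>{..<n}. \<forall>j\<in>{..<n}. \<not> N (X j \<omega>) > N (X i \<omega>)}" for \<omega>
  have "(ARG_MAX (\<lambda>i. N (X i \<omega>)) i. i < n) = (SOME i. i \<in> J \<omega>)" for \<omega>
    unfolding arg_max_def is_arg_max_def J_def by (rule arg_cong[of _ _ Eps]) auto
  moreover have "(SOME i. i \<in> J \<omega>) = a \<longleftrightarrow> (\<exists>S\<in>Pow {..<n}. (SOME i. i \<in> S) = a \<and> (\<forall>i\<in>{..<n}. i \<in> S \<longleftrightarrow> (\<forall>j\<in>{..<n}. \<not> N (X j \<omega>) > N (X i \<omega>))))"
    (is "_ \<longleftrightarrow> ?R") for \<omega>
  proof
    show ?R if "(SOME i. i \<in> J \<omega>) = a"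
      using that by (intro bexI[of _ "J \<omega>"]) (auto simp: J_def)
    assume ?R
    then obtain S where S: "S \<subseteq> {..<n}" "(SOME i. i \<in> S) = a" "\<forall>i\<in>{..<n}. i \<in> S \<longleftrightarrow> (\<forall>j\<in>{..<n}. \<not> N (X j \<omega>) > N (X i \<omega>))"
      by auto
    then have "S = J \<omega>" unfolding J_def by blast
    then show "(SOME i. i \<in> J \<omega>) = a" using S by simp
  qed
  ultimately have "(\<lambda>\<omega>. ARG_MAX (\<lambda>i. N (X i \<omega>)) i. i < n) -` {a} \<inter> space M
    = {\<omega>\<in>space M. \<exists>S\<in>Pow {..<n}. (SOME i. i \<in> S) = a \<and> (\<forall>i\<in>{..<n}. i \<in> S \<longleftrightarrow> (\<forall>j\<in>{..<n}. \<not> N (X j \<omega>) > N (X i \<omega>)))}"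
    by (simp add: vimage_def Int_def conj_commute)
  also have "\<dots> \<in> sets M" by measurable
  finally show "(\<lambda>\<omega>. ARG_MAX (\<lambda>i. N (X i \<omega>)) i. i < n) -` {a} \<inter> space M \<in> sets M" .
qed auto

lemma max_summand_measurable: "max_summand X N n \<in> borel_measurable M"
  unfolding max_summand_def[abs_def]
  by (rule measurable_compose_countable[OF _ argmax_measurable]) measurable

lemma max_summand_eq:
  assumes "\<omega> \<in> space M" "i < n" "\<forall>k<n. \<omega> \<in> max_at n k \<longleftrightarrow> k = i"
  shows "max_summand X N n \<omega> = X i \<omega>"
proof -
  have "(ARG_MAX (\<lambda>i. N (X i \<omega>)) i. i < n) = i"
    unfolding arg_max_def
  proof (rule some_equality)
    show "is_arg_max (\<lambda>i. N (X i \<omega>)) (\<lambda>i. i < n) i"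
      using assms by (auto simp: is_arg_max_linorder max_at_def)
    show "k = i" if "is_arg_max (\<lambda>i. N (X i \<omega>)) (\<lambda>i. i < n) k" for k
      using that assms by (auto simp: is_arg_max_linorder max_at_def)
  qed
  then show ?thesis by (simp add: max_summand_def)
qed

lemma trunc_params:
  assumes "y > 0"
  shows "trunc_mean M (X 0) N y = mean_vec (trunc y)" "trunc_cov M (X 0) N y = cov_mat (trunc y)"
proof -
  have F: "measure M (trunc_event M (X 0) N y) = F y"
  proof -
    have "measure (distr M borel (X 0)) {x. N x \<le> y} = measure M (trunc_event M (X 0) N y)"
      unfolding trunc_event_def by (subst measure_distr) (auto simp: vimage_def Int_def conj_commute)
    then show ?thesis by (simp add: law F_def)
  qed
  have I: "(\<integral>\<omega>. f (X 0 \<omega>) * indicator (trunc_event M (X 0) N y) \<omega> \<partial>M) = (\<integral>x. f x * indicator {x. N x \<le> y} x \<partial>P)"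
    if [measurable]: "f \<in> borel_measurable borel" for f :: "real^'d \<Rightarrow> real"
  proof -
    have "(\<integral>x. f x * indicator {x. N x \<le> y} x \<partial>distr M borel (X 0)) = (\<integral>\<omega>. f (X 0 \<omega>) * indicator {x. N x \<le> y} (X 0 \<omega>) \<partial>M)"
      by (subst integral_distr) auto
    also have "\<dots> = (\<integral>\<omega>. f (X 0 \<omega>) * indicator (trunc_event M (X 0) N y) \<omega> \<partial>M)"
      by (intro Bochner_Integration.integral_cong refl) (simp add: trunc_event_def indicator_def)
    finally show ?thesis by (simp add: law)
  qed
  show m: "trunc_mean M (X 0) N y = mean_vec (trunc y)"
    unfolding trunc_mean_def mean_vec_def F using I[of "\<lambda>x. x $ i" for i] integral_trunc(1)[OF _ assms]
    by (simp add: vec_eq_iff)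
  show "trunc_cov M (X 0) N y = cov_mat (trunc y)"
    unfolding trunc_cov_def cov_mat_def F m
    using I[of "\<lambda>x. (x $ i - mean_vec (trunc y) $ i) * (x $ j - mean_vec (trunc y) $ j)" for i j] integral_trunc(1)[OF _ assms]
    by (simp add: vec_eq_iff)
qed

text \<open>The two integrands differ at most at x = 0, which the largest summand almost surely
  avoids. This passes through an almost-everywhere equality of integrals, so both need to be
  measurable.\<close>

lemma normex_eq:
  assumes BE: "berry_esseen_const TYPE('d) C" and n: "n \<ge> 2" and B: "convex B" "B \<in> sets borel"
  shows "normex M X N n B = (\<integral>\<omega>. normal_part (n - 1) B (max_summand X N n \<omega>) \<partial>M)"
    and "(\<lambda>\<omega>. normal_part (n - 1) B (max_summand X N n \<omega>)) \<in> borel_measurable M"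
proof -
  let ?h = "\<lambda>x. measure (gaussian (real (n - 1) *\<^sub>R trunc_mean M (X 0) N (N x)) (real (n - 1) *\<^sub>R trunc_cov M (X 0) N (N x))) ((\<lambda>b. b - x) ` B)"
  have np [measurable]: "normal_part (n - 1) B \<in> borel_measurable borel"
    using normal_part_measurable[OF BE _ B] n by simp
  note [measurable] = max_summand_measurable
  show "(\<lambda>\<omega>. normal_part (n - 1) B (max_summand X N n \<omega>)) \<in> borel_measurable M" by measurable
  have h: "?h x = normal_part (n - 1) B x" if "x \<noteq> 0" for x
  proof -
    have "(\<lambda>b. b - x) ` B = {u. u + x \<in> B}" by (force simp: image_def)
    then show ?thesis using that by (simp add: normal_part_def trunc_params N_pos)
  qed
  \<comment> \<open>Whatever value the definition yields at the origin, changing a measurable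
    function at a single point preserves measurability.\<close>
  have hm: "?h \<in> borel_measurable borel"
  proof -
    have "?h = (\<lambda>x. if x = 0 then ?h 0 else normal_part (n - 1) B x)" using h by auto
    also have "\<dots> \<in> borel_measurable borel" by measurable
    finally show ?thesis .
  qed
  have "AE \<omega> in M. \<forall>i\<in>{..<n}. X i \<omega> \<noteq> 0"
  proof (rule AE_finite_allI)
    fix i
    have "AE y in distr M borel (X i). y \<noteq> 0" unfolding law by (rule P_not_0)
    then show "AE \<omega> in M. X i \<omega> \<noteq> 0" by (subst (asm) AE_distr_iff) auto
  qed simp
  moreover have "AE \<omega> in M. \<exists>i<n. \<forall>k<n. \<omega> \<in> max_at n k \<longleftrightarrow> k = i"
    using n by (intro max_at_unique) simp
  ultimately have "AE \<omega> in M. max_summand X N n \<omega> \<noteq> 0"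
    using AE_space[of M]
  proof eventually_elim
    case (elim \<omega>)
    then show ?case using max_summand_eq[of \<omega>] by fastforce
  qed
  then have "(\<integral>\<omega>. ?h (max_summand X N n \<omega>) \<partial>M) = (\<integral>\<omega>. normal_part (n - 1) B (max_summand X N n \<omega>) \<partial>M)"
  proof (intro integral_cong_AE)
    assume ae: "AE \<omega> in M. max_summand X N n \<omega> \<noteq> 0"
    show "(\<lambda>\<omega>. ?h (max_summand X N n \<omega>)) \<in> borel_measurable M"
      by (rule measurable_compose[OF max_summand_measurable hm])
    show "AE \<omega> in M. ?h (max_summand X N n \<omega>) = normal_part (n - 1) B (max_summand X N n \<omega>)"
      using ae by eventually_elim (rule h)
  qed measurable
  then show "normex M X N n B = (\<integral>\<omega>. normal_part (n - 1) B (max_summand X N n \<omega>) \<partial>M)"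
    by (simp add: normex_def Let_def)
qed

end

section \<open>Rate of convergence\<close>

text \<open>An infimum of affine functions whose slopes tend to 0 grows sublinearly, and scaling
  each function by 1 + h / x gives \<psi> (x + h) \<le> (1 + h / x) \<psi> x. An increment is thus
  at most h \<psi> x / x, which tends to 0. The \<open>max\<close> only extends \<psi> to negative
  arguments.\<close>

lemma inf_affine_shift_tendsto_0:
  fixes c :: "nat \<Rightarrow> real"
  assumes c: "\<And>k. c k \<ge> 0"
  defines "\<psi> \<equiv> \<lambda>x. INF k. c k + max x 0 / real (Suc k)"
  shows "((\<lambda>y. \<psi> (y + h) - \<psi> y) \<longlongrightarrow> 0) at_top"
proof -
  have bdd: "bdd_below (range (\<lambda>k. c k + max x 0 / real (Suc k)))" for x
    using c by (intro bdd_belowI2[of _ 0]) auto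
  have le: "\<psi> x \<le> c k + max x 0 / real (Suc k)" for x k
    unfolding \<psi>_def by (rule cINF_lower[OF bdd]) simp
  have mono: "\<psi> x \<le> \<psi> y" if "x \<le> y" for x y
  proof -
    have "\<psi> x \<le> (INF k. c k + max y 0 / real (Suc k))"
    proof (rule cINF_greatest)
      fix k
      have "max x 0 / real (Suc k) \<le> max y 0 / real (Suc k)" using that by (intro divide_right_mono) auto
      with le[of x k] show "\<psi> x \<le> c k + max y 0 / real (Suc k)" by linarith
    qed simp
    then show ?thesis by (simp add: \<psi>_def)
  qed
  have nonneg: "\<psi> x \<ge> 0" for x
    unfolding \<psi>_def using c by (intro cINF_greatest) auto
  have grow: "\<psi> (x + h) \<le> (1 + h / x) * \<psi> x" if x: "x > 0" and h: "h \<ge> 0" for x h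
  proof -
    have "\<psi> (x + h) / (1 + h / x) \<le> (INF k. c k + max x 0 / real (Suc k))"
    proof (rule cINF_greatest)
      fix k
      have "\<psi> (x + h) \<le> c k + (x + h) / real (Suc k)"
        using le[of "x + h" k] x h by simp
      also have "\<dots> \<le> c k * (1 + h / x) + x / real (Suc k) * (1 + h / x)"
      proof (rule add_mono)
        show "c k \<le> c k * (1 + h / x)"
          using mult_left_mono[of 1 "1 + h / x" "c k"] c[of k] x h by simp
        have "x * (1 + h / x) = x + h" using x by (simp add: distrib_left)
        then show "(x + h) / real (Suc k) \<le> x / real (Suc k) * (1 + h / x)" by (simp only: times_divide_eq_left)
      qed
      also have "\<dots> = (c k + max x 0 / real (Suc k)) * (1 + h / x)"
        using x by (simp add: algebra_simps)
      finally show "\<psi> (x + h) / (1 + h / x) \<le> c k + max x 0 / real (Suc k)"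
        using x h by (simp add: divide_le_eq add_pos_nonneg)
    qed simp
    then have "\<psi> (x + h) / (1 + h / x) \<le> \<psi> x" by (simp add: \<psi>_def)
    then show ?thesis using x h by (simp add: divide_le_eq add_pos_nonneg mult.commute)
  qed
  have sub: "((\<lambda>x. \<psi> x / x) \<longlongrightarrow> 0) at_top"
  proof (rule order_tendstoI)
    fix a :: real assume "a < 0"
    then show "\<forall>\<^sub>F x in at_top. a < \<psi> x / x"
      by (intro eventually_mono[OF eventually_gt_at_top[of 0]]) (auto intro!: less_le_trans[OF _ divide_nonneg_nonneg] nonneg)
  next
    fix a :: real assume "0 < a"
    then obtain k where k: "inverse (real (Suc k)) < a" using reals_Archimedean by blast
    have "((\<lambda>x. c k / x + 1 / real (Suc k)) \<longlongrightarrow> 0 + 1 / real (Suc k)) at_top"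
      by (intro tendsto_intros tendsto_divide_0[OF tendsto_const] filterlim_at_top_imp_at_infinity filterlim_ident)
    then have "\<forall>\<^sub>F x in at_top. c k / x + 1 / real (Suc k) < a"
      using k by (intro order_tendstoD(2)) (auto simp: divide_inverse)
    then show "\<forall>\<^sub>F x in at_top. \<psi> x / x < a"
      using eventually_gt_at_top[of 0]
    proof eventually_elim
      case (elim x)
      then have "\<psi> x / x \<le> (c k + x / real (Suc k)) / x"
        using le[of x k] by (intro divide_right_mono) auto
      also have "\<dots> = c k / x + 1 / real (Suc k)" using elim by (simp add: add_divide_distrib)
      finally show ?case using elim by simp
    qed
  qed
  have pos: "((\<lambda>y. \<psi> (y + h) - \<psi> y) \<longlongrightarrow> 0) at_top" if h: "h \<ge> 0" for h
  proof (rule tendsto_sandwich[of "\<lambda>_. 0" _ _ "\<lambda>x. h * (\<psi> x / x)"])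
    show "((\<lambda>x. h * (\<psi> x / x)) \<longlongrightarrow> 0) at_top"
      using tendsto_mult_right_zero[OF sub] by blast
    show "\<forall>\<^sub>F y in at_top. \<psi> (y + h) - \<psi> y \<le> h * (\<psi> y / y)"
      by (rule eventually_mono[OF eventually_gt_at_top[of 0]]) (use grow[OF _ h] in \<open>simp add: algebra_simps\<close>)
  qed (use mono h in auto)
  show ?thesis
  proof (cases "h \<ge> 0")
    case False
    have "((\<lambda>y. \<psi> ((h + y) + (- h)) - \<psi> (h + y)) \<longlongrightarrow> 0) at_top"
      using False by (intro filterlim_compose[OF pos[of "- h"] filterlim_tendsto_add_at_top[OF tendsto_const filterlim_ident]]) auto
    then have "((\<lambda>y. - (\<psi> y - \<psi> (h + y))) \<longlongrightarrow> - 0) at_top"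
      by (intro tendsto_minus) simp
    then show ?thesis by (simp add: add.commute)
  qed (rule pos)
qed

text \<open>The majorant is the lower envelope of C k * t powr (1 / (k + 1)) over all k. On the
  logarithmic scale it is an infimum of affine functions, and slow variation says precisely that its
  increments vanish at infinity.\<close>

lemma slowly_varying_majorant:
  fixes a :: "nat \<Rightarrow> real"
  assumes a: "\<And>\<eta>. \<eta> > 0 \<Longrightarrow> \<exists>C. \<forall>n\<ge>1. a n \<le> C * real n powr \<eta>"
  shows "\<exists>L. slowly_varying L \<and> (\<forall>n\<ge>1. a n \<le> L (real n))"
proof -
  have "\<exists>C. \<forall>n\<ge>1. a n \<le> C * real n powr (1 / real (Suc k))" for k by (rule a) simp
  then obtain C where C: "\<And>k n. n \<ge> 1 \<Longrightarrow> a n \<le> C k * real n powr (1 / real (Suc k))" by metis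
  \<comment> \<open>Raising the constants to at least 1 makes the intercepts nonnegative, as the
    envelope lemma requires.\<close>
  define c where "c k = ln (max 1 (C k))" for k
  have c0: "c k \<ge> 0" for k by (simp add: c_def)
  define \<psi> where "\<psi> x = (INF k. c k + max x 0 / real (Suc k))" for x
  let ?L = "\<lambda>t. exp (\<psi> (ln t))"
  have "slowly_varying ?L"
    unfolding slowly_varying_def
  proof (intro conjI allI impI)
    fix x :: real assume x: "x > 0"
    have "((\<lambda>t. exp (\<psi> (ln t + ln x) - \<psi> (ln t))) \<longlongrightarrow> exp 0) at_top"
      using inf_affine_shift_tendsto_0[OF c0, where h="ln x"] unfolding \<psi>_def
      by (intro tendsto_exp) (rule filterlim_compose[OF _ ln_at_top])
    moreover have "\<forall>\<^sub>F t in at_top. exp (\<psi> (ln t + ln x) - \<psi> (ln t)) = ?L (t * x) / ?L t"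
      by (rule eventually_mono[OF eventually_gt_at_top[of 0]]) (use x in \<open>simp add: ln_mult exp_diff\<close>)
    ultimately show "((\<lambda>t. ?L (t * x) / ?L t) \<longlongrightarrow> 1) at_top"
      by (auto intro: Lim_transform_eventually)
  qed simp
  moreover have "a n \<le> ?L (real n)" if n: "n \<ge> 1" for n
  proof (cases "a n \<le> 0")
    case True then show ?thesis by (rule order_trans) simp
  next
    case False
    have "ln (a n) \<le> c k + max (ln (real n)) 0 / real (Suc k)" for k
    proof -
      have "a n \<le> C k * real n powr (1 / real (Suc k))" by (rule C[OF n])
      also have "\<dots> \<le> max 1 (C k) * real n powr (1 / real (Suc k))" by (intro mult_right_mono) auto
      finally have "ln (a n) \<le> ln (max 1 (C k) * real n powr (1 / real (Suc k)))"
        using False n by (subst ln_le_cancel_iff) auto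
      also have "\<dots> = c k + ln (real n) / real (Suc k)"
        using n by (subst ln_mult) (auto simp: c_def ln_powr)
      finally show ?thesis using n by simp
    qed
    then have "ln (a n) \<le> \<psi> (ln (real n))"
      unfolding \<psi>_def by (intro cINF_greatest) auto
    then have "exp (ln (a n)) \<le> ?L (real n)" by simp
    then show ?thesis using False by simp
  qed
  ultimately show ?thesis by blast
qed

text \<open>For p < q < \<alpha> the tail eventually shrinks by 2 powr (-q) with each doubling of
  the level. Over dyadic shells the p-th moment is then dominated by a geometric series of ratio 2
  powr (p - q).\<close>

lemma (in prob_space) regular_tail_moment:
  fixes Y :: "'a \<Rightarrow> real"
  assumes [measurable]: "random_variable borel Y" and Y: "\<And>\<omega>. \<omega> \<in> space M \<Longrightarrow> Y \<omega> \<ge> 0"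
    and lim: "((\<lambda>t. prob {\<omega>\<in>space M. Y \<omega> > t * 2} / prob {\<omega>\<in>space M. Y \<omega> > t}) \<longlongrightarrow> 2 powr (- \<alpha>)) at_top"
    and p: "0 \<le> p" "p < \<alpha>"
  shows "integrable M (\<lambda>\<omega>. Y \<omega> powr p)"
proof -
  define G where "G t = prob {\<omega>\<in>space M. Y \<omega> > t}" for t
  obtain q where q: "p < q" "q < \<alpha>" using p dense by blast
  have "2 powr (- \<alpha>) < 2 powr (- q)" using q by simp
  then have "\<forall>\<^sub>F t in at_top. G (t * 2) / G t < 2 powr (- q)"
    using order_tendstoD(2)[OF lim] by (simp add: G_def)
  then have "\<forall>\<^sub>F t in at_top. G (t * 2) / G t < 2 powr (- q) \<and> t > 0"
    using eventually_gt_at_top by (intro eventually_conj)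
  then obtain T where T: "T > 0" "\<And>t. t \<ge> T \<Longrightarrow> G (t * 2) / G t < 2 powr (- q)"
    by (metis (no_types, lifting) eventually_at_top_linorder order_refl)
  have G0: "G t \<ge> 0" for t by (simp add: G_def)
  have Gmono: "G t \<le> G s" if "s \<le> t" for s t
    unfolding G_def using that by (intro finite_measure_mono) auto
  \<comment> \<open>If G t = 0 the ratio is 0 by convention and carries no information; monotonicity
    of the tail then gives the claim.\<close>
  have step: "G (t * 2) \<le> 2 powr (- q) * G t" if "t \<ge> T" for t
  proof (cases "G t = 0")
    case True
    then show ?thesis using Gmono[of t "t * 2"] that T(1) G0[of "t*2"] by simp
  next
    case False
    then have "G t > 0" using G0[of t] by simp
    then show ?thesis using T(2)[OF that] by (simp add: divide_simps split: if_splits)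
  qed
  have pow: "G (T * 2 ^ k) \<le> (2 powr (- q)) ^ k" for k
  proof (induction k)
    case 0 show ?case by (simp add: G_def)
  next
    case (Suc k)
    have "T * 1 \<le> T * 2 ^ k" using T(1) by (intro mult_left_mono) auto
    then have "G (T * 2 ^ k * 2) \<le> 2 powr (- q) * G (T * 2 ^ k)" by (intro step) simp
    also have "\<dots> \<le> 2 powr (- q) * (2 powr (- q)) ^ k" by (intro mult_left_mono Suc) auto
    finally show ?case by (simp add: mult_ac)
  qed
  let ?E = "\<lambda>k. {\<omega>\<in>space M. Y \<omega> > T * 2 ^ k}"
  have dom: "ennreal (Y \<omega> powr p) \<le> ennreal (T powr p) + (\<Sum>k. ennreal ((T * 2 ^ Suc k) powr p) * indicator (?E k) \<omega>)"
    if \<omega>: "\<omega> \<in> space M" for \<omega>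
  proof (cases "Y \<omega> \<le> T")
    case True
    then have "ennreal (Y \<omega> powr p) \<le> ennreal (T powr p)" using p(1) Y[OF \<omega>] by (intro ennreal_leI powr_mono2) auto
    then show ?thesis by (simp add: add_increasing2)
  next
    case False
    have "\<exists>k. Y \<omega> \<le> T * 2 ^ k"
    proof -
      obtain k where "Y \<omega> / T < 2 ^ k" using real_arch_pow[of 2 "Y \<omega> / T"] by auto
      then show ?thesis using T(1) by (intro exI[of _ k]) (simp add: field_simps)
    qed
    then obtain k where k: "Y \<omega> \<le> T * 2 ^ k" "\<And>j. j < k \<Longrightarrow> \<not> Y \<omega> \<le> T * 2 ^ j"
      unfolding exists_least_iff[of "\<lambda>k. Y \<omega> \<le> T * 2 ^ k"] by blast
    then obtain j where j: "k = Suc j" using False by (cases k) auto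
    have "ennreal (Y \<omega> powr p) \<le> ennreal ((T * 2 ^ Suc j) powr p)"
      using k j p(1) Y[OF \<omega>] by (intro ennreal_leI powr_mono2) auto
    also have "\<dots> = ennreal ((T * 2 ^ Suc j) powr p) * indicator (?E j) \<omega>"
      using k(2)[of j] j \<omega> by (auto simp: not_le)
    also have "\<dots> \<le> (\<Sum>k. ennreal ((T * 2 ^ Suc k) powr p) * indicator (?E k) \<omega>)"
    proof -
      have "f j \<le> suminf f" for f :: "nat \<Rightarrow> ennreal"
        using sum_le_suminf[of f "{j}"] by simp
      then show ?thesis .
    qed
    finally show ?thesis by (simp add: add_increasing)
  qed
  have tw: "(T * 2 ^ Suc k) powr p * G (T * 2 ^ k) \<le> (2 * T) powr p * (2 powr (p - q)) ^ k" for k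
  proof -
    have "(2 ^ k) powr p = (2 powr p) ^ k" by (induction k) (simp_all add: powr_mult)
    moreover have "T * 2 ^ Suc k = (2 * T) * 2 ^ k" by simp
    ultimately have "(T * 2 ^ Suc k) powr p = (2 * T) powr p * (2 powr p) ^ k"
      using T(1) by (simp only: powr_mult)
    then have "(T * 2 ^ Suc k) powr p * G (T * 2 ^ k) \<le> (2 * T) powr p * (2 powr p) ^ k * (2 powr (- q)) ^ k"
      using pow[of k] by (simp add: mult_left_mono)
    also have "\<dots> = (2 * T) powr p * (2 powr (p - q)) ^ k"
      by (simp add: power_mult_distrib[symmetric] powr_add[symmetric] mult.assoc)
    finally show ?thesis .
  qed
  show ?thesis
  proof (rule integrableI_bounded)
    have "(\<integral>\<^sup>+\<omega>. ennreal (norm (Y \<omega> powr p)) \<partial>M)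
      \<le> (\<integral>\<^sup>+\<omega>. ennreal (T powr p) + (\<Sum>k. ennreal ((T * 2 ^ Suc k) powr p) * indicator (?E k) \<omega>) \<partial>M)"
      using dom by (intro nn_integral_mono) auto
    also have "\<dots> = ennreal (T powr p) + (\<Sum>k. \<integral>\<^sup>+\<omega>. ennreal ((T * 2 ^ Suc k) powr p) * indicator (?E k) \<omega> \<partial>M)"
      by (subst nn_integral_add) (auto simp: nn_integral_suminf emeasure_space_1)
    also have "\<dots> = ennreal (T powr p) + (\<Sum>k. ennreal ((T * 2 ^ Suc k) powr p * G (T * 2 ^ k)))"
      by (simp add: nn_integral_cmult_indicator G_def emeasure_eq_measure ennreal_mult)
    also have "\<dots> \<le> ennreal (T powr p) + (\<Sum>k. ennreal ((2 * T) powr p * (2 powr (p - q)) ^ k))"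
      using tw by (intro add_left_mono suminf_le ennreal_leI) auto
    also have "\<dots> < \<infinity>"
    proof -
      have "(2::real) powr (p - q) < 2 powr 0" using q by (intro powr_less_mono) auto
      then have "summable (\<lambda>k. (2 * T) powr p * (2 powr (p - q)) ^ k)"
        by (intro summable_mult summable_geometric) simp
      then show ?thesis
        by (subst suminf_ennreal2) (auto simp: ennreal_less_top)
    qed
    finally show "(\<integral>\<^sup>+\<omega>. ennreal (norm (Y \<omega> powr p)) \<partial>M) < \<infinity>" .
  qed measurable
qed

section \<open>Averaging the normal approximation over the largest summand\<close>

context norm_sample
begin

lemma integral_split_max:
  fixes f :: "'b \<Rightarrow> real" and g :: "nat \<Rightarrow> 'b \<Rightarrow> real"
  assumes n: "n \<ge> 1" and [measurable]: "f \<in> borel_measurable M" and g: "\<And>i. i < n \<Longrightarrow> g i \<in> borel_measurable M"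
    and gb: "\<And>i \<omega>. 0 \<le> g i \<omega>" "\<And>i \<omega>. g i \<omega> \<le> 1"
    and fg: "\<And>i \<omega>. \<omega> \<in> space M \<Longrightarrow> i < n \<Longrightarrow> \<forall>k<n. \<omega> \<in> max_at n k \<longleftrightarrow> k = i \<Longrightarrow> f \<omega> = g i \<omega>"
  shows "(\<integral>\<omega>. f \<omega> \<partial>M) = (\<Sum>i<n. \<integral>\<omega>. g i \<omega> * indicator (max_at n i) \<omega> \<partial>M)"
proof -
  have gi: "integrable M (\<lambda>\<omega>. g i \<omega> * indicator (max_at n i) \<omega>)" if "i < n" for i
  proof (rule M.integrable_const_bound[where B=1])
    show "AE \<omega> in M. norm (g i \<omega> * indicator (max_at n i) \<omega>) \<le> 1"
      using gb by (intro AE_I2) (simp add: indicator_def)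
    show "(\<lambda>\<omega>. g i \<omega> * indicator (max_at n i) \<omega>) \<in> borel_measurable M"
      using g[OF that] by measurable
  qed
  have "(\<integral>\<omega>. f \<omega> \<partial>M) = (\<integral>\<omega>. (\<Sum>i<n. g i \<omega> * indicator (max_at n i) \<omega>) \<partial>M)"
  proof (rule integral_cong_AE)
    show "(\<lambda>\<omega>. \<Sum>i<n. g i \<omega> * indicator (max_at n i) \<omega>) \<in> borel_measurable M"
      using gi by (intro borel_measurable_sum) auto
    show "AE \<omega> in M. f \<omega> = (\<Sum>i<n. g i \<omega> * indicator (max_at n i) \<omega>)"
      using max_at_unique[OF n] AE_space[of M]
    proof eventually_elim
      case (elim \<omega>)
      then obtain i where i: "i < n" "\<forall>k<n. \<omega> \<in> max_at n k \<longleftrightarrow> k = i" by blast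
      have "(\<Sum>k<n. g k \<omega> * indicator (max_at n k) \<omega>) = (\<Sum>k<n. if k = i then g i \<omega> else 0)"
        using i by (intro sum.cong) (auto simp: indicator_def)
      also have "\<dots> = g i \<omega>" using i by simp
      finally show ?case using fg[OF elim(2) i] by simp
    qed
  qed simp
  also have "\<dots> = (\<Sum>i<n. \<integral>\<omega>. g i \<omega> * indicator (max_at n i) \<omega> \<partial>M)"
    using gi by (intro Bochner_Integration.integral_sum) auto
  finally show ?thesis .
qed

lemma weight_integrable:
  fixes f :: "real^'d \<Rightarrow> real"
  assumes "integrable P f"
  shows "integrable P (\<lambda>x. F (N x) ^ k * f x)"
proof (rule Bochner_Integration.integrable_bound[OF assms])
  have "F (N x) ^ k * \<bar>f x\<bar> \<le> 1 * \<bar>f x\<bar>" for x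
    by (intro mult_right_mono power_le_one F_le_1) auto
  then show "AE x in P. norm (F (N x) ^ k * f x) \<le> norm (f x)"
    by (simp add: abs_mult)
qed (use borel_measurable_integrable[OF assms] in measurable)

text \<open>Both probabilities are sums over the index of the maximum of integrals with the same
  weight \<open>F (N x) ^ (n - 1)\<close>. They differ only in the conditional probability given the
  maximum, which is exact in one and Gaussian in the other.\<close>

lemma normex_error_le:
  assumes BE: "berry_esseen_const TYPE('d) C" and n: "n \<ge> 2" and B: "convex B" and [measurable]: "B \<in> sets borel"
    and \<kappa>: "integrable P \<kappa>"
    and close: "\<And>x. x \<noteq> 0 \<Longrightarrow> \<bar>measure (convpow (trunc (N x)) (n - 1)) {s. s + x \<in> B} - normal_part (n - 1) B x\<bar> \<le> \<kappa> x"
  shows "\<bar>measure M {\<omega>\<in>space M. (\<Sum>i<n. X i \<omega>) \<in> B} - normex M X N n B\<bar> \<le> real n * (\<integral>x. F (N x) ^ (n - 1) * \<kappa> x \<partial>P)"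
proof -
  define \<phi>1 where "\<phi>1 x s = indicat_real B (s + x)" for x s
  \<comment> \<open>Ignores the sum of the other summands: the Normex law depends on the sample only
    through the maximum.\<close>
  define \<phi>2 where "\<phi>2 x s = normal_part (n - 1) B x" for x s :: "real^'d"
  have n1: "n \<ge> 1" "n - 1 \<ge> 1" using n by auto
  have [measurable]: "normal_part (n - 1) B \<in> borel_measurable borel"
    by (rule normal_part_measurable[OF BE n1(2) B]) simp
  have m1 [measurable]: "case_prod \<phi>1 \<in> borel_measurable (borel \<Otimes>\<^sub>M borel)" unfolding \<phi>1_def by measurable
  have m2 [measurable]: "case_prod \<phi>2 \<in> borel_measurable (borel \<Otimes>\<^sub>M borel)" unfolding \<phi>2_def by measurable
  have b1: "0 \<le> \<phi>1 x s" "\<phi>1 x s \<le> 1" for x s by (simp_all add: \<phi>1_def indicator_le_1)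
  have b2: "0 \<le> \<phi>2 x s" "\<phi>2 x s \<le> 1" for x s by (simp_all add: \<phi>2_def normal_part_bounds)
  have "measure M {\<omega>\<in>space M. (\<Sum>i<n. X i \<omega>) \<in> B} = (\<integral>\<omega>. indicator {\<omega>\<in>space M. (\<Sum>i<n. X i \<omega>) \<in> B} \<omega> \<partial>M)"
    by simp
  also have "\<dots> = (\<Sum>i<n. \<integral>\<omega>. \<phi>1 (X i \<omega>) (\<Sum>j\<in>{..<n} - {i}. X j \<omega>) * indicator (max_at n i) \<omega> \<partial>M)"
  proof (rule integral_split_max[OF n1(1)])
    fix i \<omega> assume "\<omega> \<in> space M" "i < n"
    then show "indicator {\<omega>\<in>space M. (\<Sum>i<n. X i \<omega>) \<in> B} \<omega> = \<phi>1 (X i \<omega>) (\<Sum>j\<in>{..<n} - {i}. X j \<omega>)"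
      using sum.remove[of "{..<n}" i "\<lambda>i. X i \<omega>"] by (simp add: \<phi>1_def indicator_def add.commute)
  next
    show "(\<lambda>\<omega>. \<phi>1 (X i \<omega>) (\<Sum>j\<in>{..<n} - {i}. X j \<omega>)) \<in> borel_measurable M" for i by measurable
  qed (use b1 in auto)
  also have "\<dots> = (\<Sum>i<n. \<integral>y. inner_part n i \<phi>1 y \<partial>P)"
    by (intro sum.cong refl integral_max_at(1) m1 b1) simp
  finally have 1: "measure M {\<omega>\<in>space M. (\<Sum>i<n. X i \<omega>) \<in> B} = \<dots>" .
  have "normex M X N n B = (\<integral>\<omega>. normal_part (n - 1) B (max_summand X N n \<omega>) \<partial>M)"
    by (rule normex_eq[OF BE n B]) simp
  also have "\<dots> = (\<Sum>i<n. \<integral>\<omega>. \<phi>2 (X i \<omega>) (\<Sum>j\<in>{..<n} - {i}. X j \<omega>) * indicator (max_at n i) \<omega> \<partial>M)"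
  proof (rule integral_split_max[OF n1(1)])
    show "(\<lambda>\<omega>. normal_part (n - 1) B (max_summand X N n \<omega>)) \<in> borel_measurable M"
      by (rule normex_eq[OF BE n B]) simp
    show "(\<lambda>\<omega>. \<phi>2 (X i \<omega>) (\<Sum>j\<in>{..<n} - {i}. X j \<omega>)) \<in> borel_measurable M" for i by measurable
  qed (use b2 max_summand_eq in \<open>auto simp: \<phi>2_def\<close>)
  also have "\<dots> = (\<Sum>i<n. \<integral>y. inner_part n i \<phi>2 y \<partial>P)"
    by (intro sum.cong refl integral_max_at(1) m2 b2) simp
  finally have 2: "normex M X N n B = \<dots>" .
  have iw: "integrable P (\<lambda>x. F (N x) ^ (n - 1) * \<kappa> x)" by (rule weight_integrable[OF \<kappa>])
  have d: "\<bar>(\<integral>y. inner_part n i \<phi>1 y \<partial>P) - (\<integral>y. inner_part n i \<phi>2 y \<partial>P)\<bar> \<le> (\<integral>x. F (N x) ^ (n - 1) * \<kappa> x \<partial>P)"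
    if i: "i < n" for i
  proof -
    note i1 = integral_max_at(2)[OF m1 b1 i] and i2 = integral_max_at(2)[OF m2 b2 i]
    have "\<bar>(\<integral>y. inner_part n i \<phi>1 y \<partial>P) - (\<integral>y. inner_part n i \<phi>2 y \<partial>P)\<bar> = \<bar>\<integral>y. inner_part n i \<phi>1 y - inner_part n i \<phi>2 y \<partial>P\<bar>"
      by (simp add: i1 i2)
    also have "\<dots> \<le> (\<integral>y. \<bar>inner_part n i \<phi>1 y - inner_part n i \<phi>2 y\<bar> \<partial>P)" by (rule integral_abs_bound)
    also have "\<dots> \<le> (\<integral>x. F (N x) ^ (n - 1) * \<kappa> x \<partial>P)"
    proof (rule integral_mono_AE)
      show "AE x in P. \<bar>inner_part n i \<phi>1 x - inner_part n i \<phi>2 x\<bar> \<le> F (N x) ^ (n - 1) * \<kappa> x"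
        using P_not_0
      proof eventually_elim
        case (elim x)
        then have y: "N x > 0" by (simp add: N_pos)
        interpret c: prob_space "convpow (trunc (N x)) (n - 1)"
          by (rule prob_space_convpow[OF prob_trunc[OF y] sets_trunc])
        have sp: "space (convpow (trunc (N x)) (n - 1)) = UNIV"
          using sets_eq_imp_space_eq[OF sets_convpow, of "trunc (N x)" "n - 1"] by simp
        have "(\<integral>s. \<phi>1 x s \<partial>convpow (trunc (N x)) (n - 1)) = (\<integral>s. indicator {s. s + x \<in> B} s \<partial>convpow (trunc (N x)) (n - 1))"
          by (simp add: \<phi>1_def indicator_def)
        also have "\<dots> = measure (convpow (trunc (N x)) (n - 1)) {s. s + x \<in> B}"
          using sp convex_shift_set(2)[OF B, of x] by simp
        finally have e1: "inner_part n i \<phi>1 x = F (N x) ^ (n - 1) * measure (convpow (trunc (N x)) (n - 1)) {s. s + x \<in> B}"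
          using inner_part_eq[OF m1 b1 i elim] by simp
        have e2: "inner_part n i \<phi>2 x = F (N x) ^ (n - 1) * normal_part (n - 1) B x"
        proof -
          have "(\<integral>s. \<phi>2 x s \<partial>convpow (trunc (N x)) (n - 1)) = normal_part (n - 1) B x"
            using c.prob_space by (simp add: \<phi>2_def)
          then show ?thesis using inner_part_eq[OF m2 b2 i elim] by simp
        qed
        have "\<bar>inner_part n i \<phi>1 x - inner_part n i \<phi>2 x\<bar> = F (N x) ^ (n - 1) * \<bar>measure (convpow (trunc (N x)) (n - 1)) {s. s + x \<in> B} - normal_part (n - 1) B x\<bar>"
          unfolding e1 e2 by (simp add: right_diff_distrib[symmetric] abs_mult)
        also have "\<dots> \<le> F (N x) ^ (n - 1) * \<kappa> x" by (intro mult_left_mono close elim) auto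
        finally show ?case .
      qed
    qed (use i1 i2 iw in auto)
    finally show ?thesis .
  qed
  have "\<bar>measure M {\<omega>\<in>space M. (\<Sum>i<n. X i \<omega>) \<in> B} - normex M X N n B\<bar>
     = \<bar>\<Sum>i<n. (\<integral>y. inner_part n i \<phi>1 y \<partial>P) - (\<integral>y. inner_part n i \<phi>2 y \<partial>P)\<bar>"
    unfolding 1 2 by (simp add: sum_subtractf)
  also have "\<dots> \<le> (\<Sum>i<n. \<integral>x. F (N x) ^ (n - 1) * \<kappa> x \<partial>P)"
    by (rule order_trans[OF sum_abs]) (intro sum_mono d, simp)
  finally show ?thesis by simp
qed

text \<open>The n-fold weight is the density, with respect to P, of the law of the largest summand.
  Its total mass comes from splitting the constant 1 according to the index of the maximum.\<close>

lemma max_weight_total: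
  assumes "n \<ge> 1" shows "real n * (\<integral>x. F (N x) ^ (n - 1) \<partial>P) = 1"
proof -
  let ?\<phi> = "\<lambda>x s :: real^'d. 1 :: real"
  have m: "case_prod ?\<phi> \<in> borel_measurable (borel \<Otimes>\<^sub>M borel)" by measurable
  have e: "(\<integral>y. inner_part n i ?\<phi> y \<partial>P) = (\<integral>x. F (N x) ^ (n - 1) \<partial>P)" if i: "i < n" for i
  proof (rule integral_cong_AE)
    show "AE x in P. inner_part n i ?\<phi> x = F (N x) ^ (n - 1)"
      using P_not_0
    proof eventually_elim
      case (elim x)
      then have y: "N x > 0" by (simp add: N_pos)
      interpret c: prob_space "convpow (trunc (N x)) (n - 1)"
        by (rule prob_space_convpow[OF prob_trunc[OF y] sets_trunc])
      show ?case using inner_part_eq[OF m _ _ i elim] c.prob_space by simp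
    qed
  qed (use inner_part_measurable[OF m] in measurable)
  have "1 = (\<integral>\<omega>. (1 :: real) \<partial>M)" using M.prob_space by simp
  also have "\<dots> = (\<Sum>i<n. \<integral>\<omega>. ?\<phi> (X i \<omega>) (\<Sum>j\<in>{..<n} - {i}. X j \<omega>) * indicator (max_at n i) \<omega> \<partial>M)"
    by (rule integral_split_max[OF assms]) auto
  also have "\<dots> = (\<Sum>i<n. \<integral>y. inner_part n i ?\<phi> y \<partial>P)"
    by (intro sum.cong refl integral_max_at(1) m) auto
  also have "\<dots> = (\<Sum>i<n. \<integral>x. F (N x) ^ (n - 1) \<partial>P)" by (intro sum.cong refl e) simp
  finally show ?thesis by simp
qed

text \<open>Young's inequality at the scale \<open>n powr (1 / p)\<close> of the maximum.\<close>
lemma max_weight_moment: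
  assumes p: "0 \<le> q" "q \<le> p" "0 < p" and ip: "integrable P (\<lambda>x. N x powr p)" and n: "n \<ge> 1"
  shows "real n * (\<integral>x. F (N x) ^ (n - 1) * N x powr q \<partial>P) \<le> (1 + (\<integral>x. N x powr p \<partial>P)) * real n powr (q / p)"
    and "integrable P (\<lambda>x. N x powr q)"
proof -
  define t where "t = real n powr (1 / p)"
  have t: "t > 0" "t powr p = real n" "t powr q = real n powr (q / p)"
    using n p by (auto simp: t_def powr_powr)
  have young: "a powr q \<le> s powr q * (1 + a powr p / s powr p)" if "a \<ge> 0" "s > 0" for a s :: real
  proof (cases "a \<le> s")
    case True
    then have "a powr q \<le> s powr q * 1" using that p by (simp add: powr_mono2)
    also have "\<dots> \<le> s powr q * (1 + a powr p / s powr p)" by (intro mult_left_mono) auto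
    finally show ?thesis .
  next
    case False
    then have "(a / s) powr q \<le> (a / s) powr p" using that p by (intro powr_mono) auto
    then have "a powr q \<le> s powr q * (a powr p / s powr p)"
      using that by (simp add: powr_divide divide_simps mult_ac)
    also have "\<dots> \<le> s powr q * (1 + a powr p / s powr p)" by (intro mult_left_mono) auto
    finally show ?thesis .
  qed
  show iq: "integrable P (\<lambda>x. N x powr q)"
    by (rule Bochner_Integration.integrable_bound[of _ "\<lambda>x. 1 + N x powr p"])
       (use ip young[of "N x" 1 for x] in auto)
  have "(\<integral>x. F (N x) ^ (n - 1) * N x powr q \<partial>P) \<le> (\<integral>x. t powr q * (F (N x) ^ (n - 1) * 1 + N x powr p / t powr p) \<partial>P)"
  proof (rule Bochner_Integration.integral_mono)
    show "integrable P (\<lambda>x. t powr q * (F (N x) ^ (n - 1) * 1 + N x powr p / t powr p))"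
      by (intro integrable_mult_right Bochner_Integration.integrable_add weight_integrable integrable_const integrable_divide ip)
    fix x
    have "F (N x) ^ (n - 1) * N x powr q \<le> F (N x) ^ (n - 1) * (t powr q * (1 + N x powr p / t powr p))"
      by (intro mult_left_mono young t) auto
    also have "\<dots> = t powr q * (F (N x) ^ (n - 1) * 1 + F (N x) ^ (n - 1) * (N x powr p / t powr p))"
      by (simp add: algebra_simps)
    \<comment> \<open>The weight is kept on the constant term, where n times its integral is 1, and
      bounded by 1 on the moment term, where division by t powr p = n compensates the factor
      n.\<close>
    also have "\<dots> \<le> t powr q * (F (N x) ^ (n - 1) * 1 + 1 * (N x powr p / t powr p))"
      by (intro mult_left_mono add_left_mono mult_right_mono power_le_one F_le_1) auto
    finally show "F (N x) ^ (n - 1) * N x powr q \<le> t powr q * (F (N x) ^ (n - 1) * 1 + N x powr p / t powr p)" by simp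
  qed (rule weight_integrable[OF iq])
  also have "\<dots> = t powr q * ((\<integral>x. F (N x) ^ (n - 1) * 1 \<partial>P) + (\<integral>x. N x powr p \<partial>P) / t powr p)"
    using weight_integrable[OF integrable_const[of 1]] ip by simp
  finally have "real n * (\<integral>x. F (N x) ^ (n - 1) * N x powr q \<partial>P)
    \<le> real n * (t powr q * ((\<integral>x. F (N x) ^ (n - 1) * 1 \<partial>P) + (\<integral>x. N x powr p \<partial>P) / t powr p))"
    by (intro mult_left_mono) auto
  also have "\<dots> = t powr q * (real n * (\<integral>x. F (N x) ^ (n - 1) \<partial>P) + (\<integral>x. N x powr p \<partial>P))"
    unfolding t(2) using n by (simp add: field_simps)
  also have "\<dots> = (1 + (\<integral>x. N x powr p \<partial>P)) * real n powr (q / p)"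
    unfolding t(3) max_weight_total[OF n] by simp
  finally show "real n * (\<integral>x. F (N x) ^ (n - 1) * N x powr q \<partial>P) \<le> (1 + (\<integral>x. N x powr p \<partial>P)) * real n powr (q / p)" .
qed

text \<open>On maxima of norm above 1 the covariance bound is uniform, and the third moment y powr
  (3 - p) averages to n powr ((3 - p) / p). On smaller maxima the trivial error 1 is used, whose
  weight decays geometrically.\<close>

lemma normex_rate:
  assumes p: "2 \<le> p" "p \<le> 3" and ip: "integrable P (\<lambda>x. N x powr p)"
  shows "\<exists>C\<ge>0. \<forall>n\<ge>2. \<forall>B. convex B \<and> B \<in> sets borel \<longrightarrow>
    \<bar>measure M {\<omega>\<in>space M. (\<Sum>i<n. X i \<omega>) \<in> B} - normex M X N n B\<bar>
      \<le> real n * F 1 ^ (n - 1) + C * (harm (n - 1) / sqrt (n - 1)) * real n powr ((3 - p) / p)"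
proof -
  obtain C0 where BE: "berry_esseen_const TYPE('d) C0"
    using berry_esseen_convex_std[where 'd='d] by (auto simp: berry_esseen_const_def)
  then have C0: "C0 > 0" by (simp add: berry_esseen_const_def)
  obtain c where c: "c > 0" "\<And>y u. y \<ge> 1 \<Longrightarrow> c * (norm u)\<^sup>2 \<le> u \<bullet> (cov_mat (trunc y) *v u)"
    using trunc_cov_lower_uniform by blast
  obtain C3 where C3: "C3 \<ge> 0" "\<And>y. y \<ge> 1 \<Longrightarrow> (\<integral>x. norm (x - mean_vec (trunc y)) ^ 3 \<partial>trunc y) \<le> C3 * y powr (3 - p)"
    using trunc_moment3_growth[OF _ p(2) ip] p(1) by auto
  define C4 where "C4 = C0 * (C3 / sqrt c ^ 3)"
  have C4: "C4 \<ge> 0" unfolding C4_def using C0 C3 c by auto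
  define E where "E = 1 + (\<integral>x. N x powr p \<partial>P)"
  have E: "E \<ge> 0" unfolding E_def by (intro add_nonneg_nonneg Bochner_Integration.integral_nonneg) auto
  have "\<bar>measure M {\<omega>\<in>space M. (\<Sum>i<n. X i \<omega>) \<in> B} - normex M X N n B\<bar>
      \<le> real n * F 1 ^ (n - 1) + (C4 * E) * (harm (n - 1) / sqrt (n - 1)) * real n powr ((3 - p) / p)"
    if n: "n \<ge> 2" and B: "convex B" "B \<in> sets borel" for n B
  proof -
    let ?m = "n - 1"
    have m: "?m \<ge> 1" and n1: "n \<ge> 1" using n by auto
    let ?h = "harm ?m / sqrt (real ?m)"
    have h: "0 \<le> ?h" by (simp add: harm_nonneg)
    \<comment> \<open>Error 1 where the norm is at most 1, and the Berry--Esseen bound elsewhere;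
      the sum serves as an integrable majorant for both.\<close>
    define \<kappa> where "\<kappa> x = indicat_real {x. N x \<le> 1} x + C4 * ?h * N x powr (3 - p)" for x
    note mom = max_weight_moment[of "3 - p" p n, OF _ _ _ ip n1]
    have iq: "integrable P (\<lambda>x. N x powr (3 - p))" using mom(2) p by simp
    have i1: "integrable P (indicat_real {x. N x \<le> 1})"
      by (rule integrable_const_bound[where B=1]) (auto simp: indicator_le_1)
    have ik: "integrable P \<kappa>"
      unfolding \<kappa>_def by (intro Bochner_Integration.integrable_add i1 integrable_mult_right iq)
    have close: "\<bar>measure (convpow (trunc (N x)) ?m) {s. s + x \<in> B} - normal_part ?m B x\<bar> \<le> \<kappa> x" if x: "x \<noteq> 0" for x
    proof (cases "N x \<le> 1")
      case True
      have y: "N x > 0" using x by (simp add: N_pos)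
      interpret c: prob_space "convpow (trunc (N x)) ?m"
        by (rule prob_space_convpow[OF prob_trunc[OF y] sets_trunc])
      have "\<bar>measure (convpow (trunc (N x)) ?m) {s. s + x \<in> B} - normal_part ?m B x\<bar> \<le> 1"
        using c.prob_le_1[of "{s. s + x \<in> B}"] measure_nonneg[of "convpow (trunc (N x)) ?m" "{s. s + x \<in> B}"]
          normal_part_bounds[of ?m B x] by linarith
      also have "\<dots> \<le> \<kappa> x"
      proof -
        have "0 \<le> C4 * ?h * N x powr (3 - p)" by (intro mult_nonneg_nonneg C4 h) simp
        moreover have "indicat_real {x. N x \<le> 1} x = 1" using True by simp
        ultimately show ?thesis unfolding \<kappa>_def by linarith
      qed
      finally show ?thesis .
    next
      case False
      then have y: "N x \<ge> 1" by simp
      let ?\<mu> = "mean_vec (trunc (N x))"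
      have s: "{w. real ?m *\<^sub>R ?\<mu> + sqrt (real ?m / real ?m) *\<^sub>R (w - real ?m *\<^sub>R ?\<mu>) + x \<in> B} = {s. s + x \<in> B}"
      proof -
        have "real ?m \<noteq> 0" using m by linarith
        then have "real ?m / real ?m = 1" by (rule divide_self)
        then have "sqrt (real ?m / real ?m) = 1" by (simp only: real_sqrt_one)
        then show ?thesis by (simp only:) simp
      qed
      have "\<bar>measure (convpow (trunc (N x)) ?m) {s. s + x \<in> B} - normal_part ?m B x\<bar>
        \<le> C0 * ((\<integral>z. norm (z - ?\<mu>) ^ 3 \<partial>trunc (N x)) / sqrt c ^ 3) * harm ?m / sqrt ?m"
        using normal_part_approx[OF BE x c(1) c(2)[OF y] m m B] unfolding s .
      also have "\<dots> \<le> C0 * ((C3 * N x powr (3 - p)) / sqrt c ^ 3) * harm ?m / sqrt ?m"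
        using C3(2)[OF y] C0 c(1)
        by (intro divide_right_mono mult_right_mono mult_left_mono) (auto simp: harm_nonneg)
      also have "\<dots> = C4 * ?h * N x powr (3 - p)" by (simp add: C4_def mult_ac)
      also have "\<dots> \<le> \<kappa> x" by (simp add: \<kappa>_def)
      finally show ?thesis .
    qed
    have le: "(\<integral>x. F (N x) ^ ?m * \<kappa> x \<partial>P) \<le> (\<integral>x. F 1 ^ ?m + (C4 * ?h) * (F (N x) ^ ?m * N x powr (3 - p)) \<partial>P)"
    proof (rule integral_mono')
      show "integrable P (\<lambda>x. F 1 ^ ?m + (C4 * ?h) * (F (N x) ^ ?m * N x powr (3 - p)))"
        by (intro Bochner_Integration.integrable_add integrable_const integrable_mult_right weight_integrable iq)
      fix x
      have "F (N x) ^ ?m * indicat_real {x. N x \<le> 1} x \<le> F 1 ^ ?m"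
        using power_mono[OF F_mono[of "N x" 1] F_nonneg, of ?m] by (simp add: indicator_def)
      then show "F (N x) ^ ?m * \<kappa> x \<le> F 1 ^ ?m + (C4 * ?h) * (F (N x) ^ ?m * N x powr (3 - p))"
        by (simp add: \<kappa>_def algebra_simps)
      show "0 \<le> F 1 ^ ?m + (C4 * ?h) * (F (N x) ^ ?m * N x powr (3 - p))"
        using C4 h by (intro add_nonneg_nonneg mult_nonneg_nonneg) auto
    qed
    have "\<bar>measure M {\<omega>\<in>space M. (\<Sum>i<n. X i \<omega>) \<in> B} - normex M X N n B\<bar> \<le> real n * (\<integral>x. F (N x) ^ ?m * \<kappa> x \<partial>P)"
      by (rule normex_error_le[OF BE n B ik close])
    also have "\<dots> \<le> real n * (\<integral>x. F 1 ^ ?m + (C4 * ?h) * (F (N x) ^ ?m * N x powr (3 - p)) \<partial>P)"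
      by (rule mult_left_mono[OF le]) simp
    also have "(\<integral>x. F 1 ^ ?m + (C4 * ?h) * (F (N x) ^ ?m * N x powr (3 - p)) \<partial>P) = F 1 ^ ?m + (C4 * ?h) * (\<integral>x. F (N x) ^ ?m * N x powr (3 - p) \<partial>P)"
    proof -
      have "(\<integral>x. F 1 ^ ?m + (C4 * ?h) * (F (N x) ^ ?m * N x powr (3 - p)) \<partial>P) = (\<integral>x. F 1 ^ ?m \<partial>P) + (\<integral>x. (C4 * ?h) * (F (N x) ^ ?m * N x powr (3 - p)) \<partial>P)"
        by (intro Bochner_Integration.integral_add integrable_const integrable_mult_right weight_integrable iq)
      then show ?thesis using prob_space by simp
    qed
    also have "real n * (F 1 ^ ?m + (C4 * ?h) * (\<integral>x. F (N x) ^ ?m * N x powr (3 - p) \<partial>P))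
      = real n * F 1 ^ ?m + (C4 * ?h) * (real n * (\<integral>x. F (N x) ^ ?m * N x powr (3 - p) \<partial>P))"
      by (simp only: distrib_left mult.left_commute)
    also have "\<dots> \<le> real n * F 1 ^ ?m + (C4 * ?h) * (E * real n powr ((3 - p) / p))"
      unfolding E_def using mom(1) p by (intro add_left_mono mult_left_mono mult_nonneg_nonneg[OF C4 h]) auto
    finally show ?thesis by (simp add: mult_ac)
  qed
  moreover have "C4 * E \<ge> 0" using C4 E by simp
  ultimately show ?thesis by blast
qed

end

text \<open>The expression is the square of n (sqrt r) ^ n, which tends to 0.\<close>

lemma square_times_power_bounded:
  fixes r :: real
  assumes "0 \<le> r" "r < 1"
  shows "\<exists>K\<ge>0. \<forall>n. (real n)\<^sup>2 * r ^ n \<le> K"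
proof -
  have "sqrt r < 1" using assms by simp
  then have "(\<lambda>n. real n * sqrt r ^ n) \<longlonglongrightarrow> 0"
    using assms by (intro powser_times_n_limit_0) auto
  then have "(\<lambda>n. (real n * sqrt r ^ n)\<^sup>2) \<longlonglongrightarrow> 0\<^sup>2"
    by (rule tendsto_power)
  moreover have "(real n * sqrt r ^ n)\<^sup>2 = (real n)\<^sup>2 * r ^ n" for n
  proof -
    have "(sqrt r ^ n)\<^sup>2 = ((sqrt r)\<^sup>2) ^ n" by (simp only: power_mult[symmetric] mult.commute)
    then show ?thesis using assms by (simp add: power_mult_distrib)
  qed
  ultimately have "(\<lambda>n. (real n)\<^sup>2 * r ^ n) \<longlonglongrightarrow> 0" by simp
  then have "Bseq (\<lambda>n. (real n)\<^sup>2 * r ^ n)" by (rule convergent_imp_Bseq[OF convergentI])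
  then obtain K where "K > 0" "\<And>n. norm ((real n)\<^sup>2 * r ^ n) \<le> K" by (auto simp: Bseq_def)
  then show ?thesis using abs_le_D1 by (intro exI[of _ K]) fastforce
qed

text \<open>The geometric term is of order 1 / n, below n powr (\<rho> + \<eta>) since \<rho> \<ge>
  -1/2. In the main term one half of \<eta> pays for the harmonic number, and the other half is the
  loss already allowed in the exponent q.\<close>

lemma rate_le_powr:
  fixes r C q \<rho> \<eta> :: real
  assumes r: "0 < r" "r < 1" and C: "C \<ge> 0" and \<eta>: "\<eta> > 0" and \<rho>: "\<rho> \<ge> -1/2" and q: "q - 1/2 \<le> \<rho> + \<eta> / 2"
  shows "\<exists>K. \<forall>n\<ge>2. real n * r ^ (n - 1) + C * (harm (n - 1) / sqrt (n - 1)) * real n powr q \<le> K * real n powr (\<rho> + \<eta>)"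
proof -
  obtain K where K: "K \<ge> 0" "\<And>n. (real n)\<^sup>2 * r ^ n \<le> K" using square_times_power_bounded[of r] r by auto
  have "real n * r ^ (n - 1) + C * (harm (n - 1) / sqrt (n - 1)) * real n powr q \<le> (K / r + C * (2 * (1 + 2 / \<eta>))) * real n powr (\<rho> + \<eta>)"
    if n: "n \<ge> 2" for n
  proof -
    have n0: "real n > 0" "real n \<ge> 1" using n by auto
    \<comment> \<open>Bounding the square of n, and not n, times r ^ n is what yields the additional
      factor 1 / n.\<close>
    have "real n * r ^ (n - 1) = ((real n)\<^sup>2 * r ^ n) / r * real n powr (-1)"
    proof -
      obtain k where k: "n = Suc k" using n by (cases n) auto
      have "a * R = (a\<^sup>2 * (r * R)) / r * (1 / a)" if "a \<noteq> 0" for a R :: real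
        using that r by (simp add: power2_eq_square)
      from this[of "real n" "r ^ k"] show ?thesis
        using n0 k by (simp add: powr_minus divide_inverse)
    qed
    also have "\<dots> \<le> K / r * real n powr (\<rho> + \<eta>)"
      using K r n0 \<rho> \<eta> by (intro mult_mono divide_right_mono powr_mono) auto
    finally have 1: "real n * r ^ (n - 1) \<le> K / r * real n powr (\<rho> + \<eta>)" .
    have "harm (n - 1) \<le> (harm n :: real)" by (intro harm_mono) simp
    also have "\<dots> \<le> (1 + 1 / (\<eta> / 2)) * real n powr (\<eta> / 2)" using \<eta> n by (intro harm_le_powr) auto
    finally have h: "harm (n - 1) \<le> (1 + 2 / \<eta>) * real n powr (\<eta> / 2)" by simp
    have s: "1 / sqrt (real (n - 1)) \<le> 2 * real n powr (- (1/2))"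
    proof -
      have "sqrt n \<le> sqrt (4 * real (n - 1))" using n by (intro real_sqrt_le_mono) (simp add: of_nat_diff)
      then have "sqrt n \<le> 2 * sqrt (real (n - 1))" by (simp add: real_sqrt_mult)
      then have "1 / sqrt (real (n - 1)) \<le> 2 / sqrt n" using n by (simp add: divide_simps)
      moreover have "real n powr (- (1/2)) = 1 / sqrt n"
        using n0 by (simp only: powr_minus_divide) (simp add: powr_half_sqrt)
      ultimately show ?thesis by simp
    qed
    have "harm (n - 1) * (1 / sqrt (real (n - 1))) \<le> ((1 + 2 / \<eta>) * real n powr (\<eta> / 2)) * (2 * real n powr (- (1/2)))"
      using \<eta> by (intro mult_mono h s) (auto simp: harm_nonneg)
    then have "C * (harm (n - 1) * (1 / sqrt (real (n - 1)))) * real n powr q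
        \<le> C * (((1 + 2 / \<eta>) * real n powr (\<eta> / 2)) * (2 * real n powr (- (1/2)))) * real n powr q"
      using C by (intro mult_right_mono mult_left_mono) auto
    also have "\<dots> = C * (2 * (1 + 2 / \<eta>)) * (real n powr (\<eta> / 2) * real n powr (- (1/2)) * real n powr q)"
      by (simp only: mult_ac)
    also have "real n powr (\<eta> / 2) * real n powr (- (1/2)) * real n powr q = real n powr (\<eta> / 2 + (q - 1/2))"
      by (simp add: powr_add[symmetric] algebra_simps)
    also have "C * (2 * (1 + 2 / \<eta>)) * real n powr (\<eta> / 2 + (q - 1/2)) \<le> C * (2 * (1 + 2 / \<eta>)) * real n powr (\<rho> + \<eta>)"
      using C \<eta> q n0 by (intro mult_left_mono powr_mono mult_nonneg_nonneg add_nonneg_nonneg) auto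
    finally have 2: "C * (harm (n - 1) / sqrt (real (n - 1))) * real n powr q \<le> C * (2 * (1 + 2 / \<eta>)) * real n powr (\<rho> + \<eta>)"
      by (simp only: times_divide_eq_right mult_1_right)
    show ?thesis using add_mono[OF 1 2] by (simp only: distrib_right)
  qed
  then show ?thesis by blast
qed

lemma norm_sampleI:
  fixes M :: "'b measure" and X :: "nat \<Rightarrow> 'b \<Rightarrow> real^'d" and N :: "real^'d \<Rightarrow> real"
  assumes M: "prob_space M" and N: "is_norm N"
    and indep: "prob_space.indep_vars M (\<lambda>_. borel) X UNIV"
    and ident: "\<forall>i. distr M borel (X i) = distr M borel (X 0)"
    and C1: "\<forall>y>0. measure M (trunc_event M (X 0) N y) > 0 \<and>
               (\<forall>a b. a \<noteq> 0 \<longrightarrow>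
                  measure M {\<omega> \<in> trunc_event M (X 0) N y. a \<bullet> X 0 \<omega> = b}
                  < measure M (trunc_event M (X 0) N y))"
    and C2_ac: "absolutely_continuous lborel (distr M borel (\<lambda>\<omega>. N (X 0 \<omega>)))"
  shows "norm_sample (distr M borel (X 0)) N M X"
proof -
  interpret prob_space M by fact
  have [measurable]: "X i \<in> borel_measurable M" for i using indep by (simp add: indep_vars_def)
  have [measurable]: "N \<in> borel_measurable borel"
    using norm_bounds(3)[OF N] by (rule borel_measurable_continuous_onI)
  have ms: "measure (distr M borel (X 0)) {x. Q x} = measure M {\<omega>\<in>space M. Q (X 0 \<omega>)}"
    if "Measurable.pred borel Q" for Q
    using that by (subst measure_distr) (auto simp: vimage_def Int_def conj_commute)
  show ?thesis
  proof (intro norm_sample.intro norm_law.intro norm_sample_axioms.intro M N indep)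
    show "prob_space (distr M borel (X 0))" by (rule prob_space_distr) measurable
    show "distr M borel (X i) = distr M borel (X 0)" for i using ident by simp
    show "measure (distr M borel (X 0)) {x. N x = t} = 0" for t
    proof -
      have "{t} \<in> null_sets (distr M borel (\<lambda>\<omega>. N (X 0 \<omega>)))"
      proof -
        have "{t} \<in> null_sets lborel" by (simp add: null_sets_def)
        then show ?thesis using C2_ac unfolding absolutely_continuous_def by blast
      qed
      then have "measure (distr M borel (\<lambda>\<omega>. N (X 0 \<omega>))) {t} = 0" by (simp add: null_sets_def measure_def)
      moreover have "measure (distr M borel (\<lambda>\<omega>. N (X 0 \<omega>))) {t} = measure M {\<omega>\<in>space M. N (X 0 \<omega>) = t}"
        by (subst measure_distr) (auto simp: vimage_def Int_def conj_commute)
      ultimately show ?thesis by (subst ms) auto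
    qed
    show "measure (distr M borel (X 0)) {x. N x \<le> y} > 0" if "y > 0" for y
      using C1 that by (subst ms) (auto simp: trunc_event_def)
    show "measure (distr M borel (X 0)) {x. N x \<le> y \<and> a \<bullet> x = b} < measure (distr M borel (X 0)) {x. N x \<le> y}"
      if "y > 0" "a \<noteq> 0" for y a b
      using C1 that by (subst (1 2) ms) (auto simp: trunc_event_def)
  qed simp
qed

theorem theorem3p1:
  fixes M :: "'b measure" and X :: "nat \<Rightarrow> 'b \<Rightarrow> real^'d"
    and N :: "real^'d \<Rightarrow> real" and \<alpha> :: real
  assumes "prob_space M"
    and "is_norm N"
    and indep: "prob_space.indep_vars M (\<lambda>_. borel) X UNIV"
    and ident: "\<forall>i. distr M borel (X i) = distr M borel (X 0)"
    and C1: "\<forall>y>0. measure M (trunc_event M (X 0) N y) > 0 \<and>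
               (\<forall>a b. a \<noteq> 0 \<longrightarrow>
                  measure M {\<omega> \<in> trunc_event M (X 0) N y. a \<bullet> X 0 \<omega> = b}
                  < measure M (trunc_event M (X 0) N y))"
    and C2_ac: "absolutely_continuous lborel (distr M borel (\<lambda>\<omega>. N (X 0 \<omega>)))"
    and C2_rv: "\<forall>x>0. ((\<lambda>t. measure M {\<omega> \<in> space M. N (X 0 \<omega>) > t * x}
                             / measure M {\<omega> \<in> space M. N (X 0 \<omega>) > t})
                       \<longlongrightarrow> x powr (- \<alpha>)) at_top"
    and \<alpha>: "2 < \<alpha>" "\<alpha> \<le> 3"
  shows "\<exists>L. slowly_varying L \<and>
           (\<forall>n\<ge>1. \<forall>B. B \<in> sets borel \<and> convex B \<longrightarrow>
              \<bar>measure M {\<omega> \<in> space M. (\<Sum>i<n. X i \<omega>) \<in> B} - normex M X N n B\<bar>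
                \<le> L (real n) * real n powr (- 1/2 + (3 - \<alpha>) / \<alpha>))"
proof -
  let ?P = "distr M borel (X 0)"
  interpret S: norm_sample ?P N M X
    by (rule norm_sampleI[OF assms(1,2) indep ident C1 C2_ac])
  let ?\<rho> = "- 1/2 + (3 - \<alpha>) / \<alpha>"
  define err where "err n B = \<bar>measure M {\<omega> \<in> space M. (\<Sum>i<n. X i \<omega>) \<in> B} - normex M X N n B\<bar>" for n B
  \<comment> \<open>The majorant must not depend on the set, so the supremum over convex sets is
    taken before it is constructed.\<close>
  define D where "D n = (SUP B\<in>{B. B \<in> sets borel \<and> convex B}. err n B)" for n
  have err1: "err n B \<le> 1" for n B
  proof -
    have g: "measure (gaussian v \<Gamma> :: (real^'d) measure) A \<le> 1" for v \<Gamma> A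
      by (rule prob_space.prob_le_1[OF prob_space_gaussian])
    have "normex M X N n B \<le> (\<integral>\<omega>. 1 \<partial>M)"
      unfolding normex_def Let_def using g by (intro integral_mono') auto
    moreover have "0 \<le> normex M X N n B"
      unfolding normex_def Let_def by (intro Bochner_Integration.integral_nonneg) simp
    moreover have "(\<integral>\<omega>. (1 :: real) \<partial>M) = 1" using S.M.prob_space by simp
    ultimately show ?thesis
      using S.M.prob_le_1[of "{\<omega> \<in> space M. (\<Sum>i<n. X i \<omega>) \<in> B}"]
        measure_nonneg[of M "{\<omega> \<in> space M. (\<Sum>i<n. X i \<omega>) \<in> B}"] unfolding err_def abs_le_iff by linarith
  qed
  have bdd: "bdd_above (err n ` {B. B \<in> sets borel \<and> convex B})" for n
    using err1 by (intro bdd_aboveI2[of _ _ 1])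
  have errD: "err n B \<le> D n" if "B \<in> sets borel" "convex B" for n B
    unfolding D_def using that by (intro cSUP_upper bdd) auto
  have D_le: "D n \<le> c" if "\<And>B. B \<in> sets borel \<Longrightarrow> convex B \<Longrightarrow> err n B \<le> c" for n c
    unfolding D_def using that by (intro cSUP_least) (auto intro!: exI[of _ "{}"])
  \<comment> \<open>A norm almost surely bounded by 1 would have vanishing tails beyond 1, hence
    tail ratios 0 / 0 = 0, whereas regular variation makes them tend to 2 powr (- \<alpha>), which
    is positive.\<close>
  have F1: "S.F 1 < 1"
  proof (rule ccontr)
    assume "\<not> S.F 1 < 1"
    then have "S.F 1 = 1" using S.F_le_1[of 1] by simp
    moreover have "S.F 1 = measure M {\<omega> \<in> space M. N (X 0 \<omega>) \<le> 1}"
      unfolding S.F_def by (subst measure_distr) (auto simp: vimage_def Int_def conj_commute)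
    ultimately have "AE \<omega> in M. N (X 0 \<omega>) \<le> 1"
      by (subst (asm) eq_commute) (auto simp: S.M.prob_Collect_eq_1)
    then have "measure M {\<omega> \<in> space M. N (X 0 \<omega>) > t} = 0" if "t \<ge> 1" for t
      using that by (subst S.M.prob_Collect_eq_0) (auto elim!: eventually_mono)
    then have "\<forall>\<^sub>F t in at_top. measure M {\<omega> \<in> space M. N (X 0 \<omega>) > t * 2} / measure M {\<omega> \<in> space M. N (X 0 \<omega>) > t} = 0"
      by (intro eventually_mono[OF eventually_ge_at_top[of 1]]) simp
    then have "((\<lambda>t. measure M {\<omega> \<in> space M. N (X 0 \<omega>) > t * 2} / measure M {\<omega> \<in> space M. N (X 0 \<omega>) > t}) \<longlongrightarrow> 0) at_top"
      by (rule tendsto_eventually)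
    with C2_rv[rule_format, of 2] have "2 powr (- \<alpha>) = 0"
      by (intro tendsto_unique[OF trivial_limit_at_top_linorder]) auto
    then show False by simp
  qed
  have "\<exists>L. slowly_varying L \<and> (\<forall>n\<ge>1. D n * real n powr (- ?\<rho>) \<le> L (real n))"
  proof (rule slowly_varying_majorant)
    fix \<eta> :: real assume \<eta>: "\<eta> > 0"
    \<comment> \<open>The threshold is the p at which 3 / p exceeds 3 / \<alpha> by exactly \<eta> /
      2. Any p between it (and 2) and \<alpha> has a finite moment and loses at most half of \<eta>
      in the exponent.\<close>
    have "3 / (3 / \<alpha> + \<eta> / 2) < \<alpha>" using \<alpha> \<eta> by (simp add: divide_simps distrib_left add_pos_pos)
    then have "max 2 (3 / (3 / \<alpha> + \<eta> / 2)) < \<alpha>" using \<alpha> by simp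
    then obtain p where "max 2 (3 / (3 / \<alpha> + \<eta> / 2)) < p" "p < \<alpha>" using dense by blast
    then have p: "2 < p" "p < \<alpha>" "3 / (3 / \<alpha> + \<eta> / 2) < p" by auto
    have "3 / p \<le> 3 / \<alpha> + \<eta> / 2"
      using p \<alpha> \<eta> by (simp add: divide_less_eq add_pos_pos divide_le_eq mult.commute)
    then have q: "(3 - p) / p - 1/2 \<le> ?\<rho> + \<eta> / 2"
      using p \<alpha> by (simp add: diff_divide_distrib)
    have "integrable M (\<lambda>\<omega>. N (X 0 \<omega>) powr p)"
      by (rule S.M.regular_tail_moment[OF _ _ C2_rv[rule_format, of 2]]) (use p in auto)
    then have ip: "integrable ?P (\<lambda>x. N x powr p)" by (subst integrable_distr_eq) auto
    obtain C where C: "C \<ge> 0" "\<And>n B. n \<ge> 2 \<Longrightarrow> convex B \<Longrightarrow> B \<in> sets borel \<Longrightarrow>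
        err n B \<le> real n * S.F 1 ^ (n - 1) + C * (harm (n - 1) / sqrt (n - 1)) * real n powr ((3 - p) / p)"
      using S.normex_rate[OF _ _ ip] p \<alpha> unfolding err_def by fastforce
    have "?\<rho> \<ge> -1/2" using \<alpha> by simp
    then obtain K where K: "\<And>n. n \<ge> 2 \<Longrightarrow> real n * S.F 1 ^ (n - 1) + C * (harm (n - 1) / sqrt (n - 1)) * real n powr ((3 - p) / p)
        \<le> K * real n powr (?\<rho> + \<eta>)"
      using rate_le_powr[OF S.F_pos[of 1] F1 C(1) \<eta> _ q] by auto
    \<comment> \<open>For n = 1 no summand remains beside the maximum and \<open>normex_rate\<close>
      does not apply; the trivial bound 1 on the error is the reason for the maximum with 1.\<close>
    have "D n * real n powr (- ?\<rho>) \<le> max 1 K * real n powr \<eta>" if n: "n \<ge> 1" for n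
    proof (cases "n = 1")
      case True
      then show ?thesis using D_le[of n 1] err1 by simp
    next
      case False
      then have n2: "n \<ge> 2" using n by simp
      have "D n \<le> K * real n powr (?\<rho> + \<eta>)"
        using C(2)[OF n2] K[OF n2] by (intro D_le) (meson order_trans)
      then have "D n * real n powr (- ?\<rho>) \<le> K * real n powr (?\<rho> + \<eta>) * real n powr (- ?\<rho>)"
        by (intro mult_right_mono) auto
      also have "\<dots> = K * real n powr \<eta>" by (simp add: mult.assoc powr_add[symmetric])
      also have "\<dots> \<le> max 1 K * real n powr \<eta>" by (intro mult_right_mono) auto
      finally show ?thesis .
    qed
    then show "\<exists>C. \<forall>n\<ge>1. D n * real n powr (- ?\<rho>) \<le> C * real n powr \<eta>" by blast
  qed
  then obtain L where L: "slowly_varying L" "\<And>n. n \<ge> 1 \<Longrightarrow> D n * real n powr (- ?\<rho>) \<le> L (real n)" by blast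
  have "err n B \<le> L (real n) * real n powr ?\<rho>" if n: "n \<ge> 1" and B: "B \<in> sets borel" "convex B" for n B
  proof -
    have "err n B \<le> D n" by (rule errD[OF B])
    also have "D n = D n * real n powr (- ?\<rho>) * real n powr ?\<rho>"
      using n by (simp add: mult.assoc powr_add[symmetric])
    also have "\<dots> \<le> L (real n) * real n powr ?\<rho>"
      using L(2)[OF n] by (intro mult_right_mono) auto
    finally show ?thesis .
  qed
  with L(1) show ?thesis unfolding err_def by blast
qed

end
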